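(* Let $(R,R^+)$ be a strongly noetherian complete Tate-Huber pair, and let $i\colon(A,A^+)\to(B,B^+)$ be a finite injective morphism of complete Tate-Huber $(R,R^+)$-pairs. If $(B,B^+)$ is a topologically finite type $(R,R^+)$-Tate-Huber pair, then so is $(A,A^+)$.
   Context: A Tate-Huber pair $(A,A^+)$ is a Huber ring $A$ having a topologically nilpotent unit together with an open integrally closed subring $A^+\subset A^\circ$; it is complete if $A$ is complete (and Hausdorff). Morphisms $(A,A^+)\to(B,B^+)$ are continuous ring homomorphisms $A\to B$ mapping $A^+$ into $B^+$; an $(R,R^+)$-pair is a pair with a morphism from $(R,R^+)$, and morphisms of $(R,R^+)$-pairs are compatible with these. $(R,R^+)$ is strongly noetherian if $R\langle T_1,\dots,T_n\rangle$ is noetherian for all $n$. A morphism of complete Tate-Huber pairs $(A,A^+)\to(B,B^+)$ is finite if $A\to B$ is a finite ring homomorphism and $A^+\to B^+$ is integral. It is topologically of finite type if there is a continuous surjective $A$-algebra quotient map $f\colon A\langle T_1,\dots,T_n\rangle\to B$, for some $n$, such that $B^+$ is integral over (the image of) $A^+\langle T_1,\dots,T_n\rangle$. Injective means $A\to B$ is injective. *)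

theory Defs
  imports
    "HOL-Algebra.Ring_Divisibility"
    "HOL-Algebra.Ideal_Product"
    "HOL-Algebra.Subrings"
    "HOL-Analysis.T1_Spaces"
    "HOL-Analysis.Abstract_Limits"
    "HOL-Library.Poly_Mapping"
begin

section \<open>Topological rings\<close>

record 'a top_ring = "'a ring" +
  topo :: "'a topology"

locale topological_cring = cring R for R :: "('a, 'm) top_ring_scheme" (structure) +
  assumes topspace_topo: "topspace (topo R) = carrier R"
    and continuous_add:
      "continuous_map (prod_topology (topo R) (topo R)) (topo R) (\<lambda>(x, y). x \<oplus> y)"
    and continuous_a_inv: "continuous_map (topo R) (topo R) (\<lambda>x. \<ominus> x)"
    and continuous_mult:
      "continuous_map (prod_topology (topo R) (topo R)) (topo R) (\<lambda>(x, y). x \<otimes> y)"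

definition subspace_ring :: "('a, 'm) top_ring_scheme \<Rightarrow> 'a set \<Rightarrow> ('a, 'm) top_ring_scheme" where
  "subspace_ring R S = R\<lparr>carrier := S, topo := subtopology (topo R) S\<rparr>"

text \<open>In the following definition, the monoid \<^term>\<open>ideals_set R\<close> has ideal multiplication as
  product and \<^term>\<open>carrier R\<close> as unit, so its powers are the powers of the ideal.\<close>

definition adic :: "('a, 'm) top_ring_scheme \<Rightarrow> 'a set \<Rightarrow> bool" where
  "adic R I \<longleftrightarrow> (\<forall>U. openin (topo R) U \<longleftrightarrow>
     U \<subseteq> carrier R \<and> (\<forall>x\<in>U. \<exists>n::nat. x <+\<^bsub>R\<^esub> (I [^]\<^bsub>ideals_set R\<^esub> n) \<subseteq> U))"

locale huber_ring = topological_cring +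
  assumes pair_of_definition:
    "\<exists>A\<^sub>0 S. subring A\<^sub>0 R \<and> openin (topo R) A\<^sub>0 \<and> finite S \<and> S \<subseteq> A\<^sub>0 \<and>
       adic (subspace_ring R A\<^sub>0) (Idl\<^bsub>subspace_ring R A\<^sub>0\<^esub> S)"

definition topologically_nilpotent :: "('a, 'm) top_ring_scheme \<Rightarrow> 'a \<Rightarrow> bool" where
  "topologically_nilpotent R x \<longleftrightarrow>
     x \<in> carrier R \<and> limitin (topo R) (\<lambda>n::nat. x [^]\<^bsub>R\<^esub> n) \<zero>\<^bsub>R\<^esub> sequentially"

locale tate_ring = huber_ring +
  assumes top_nilpotent_unit: "\<exists>u\<in>Units R. topologically_nilpotent R u"

definition bounded_subset :: "('a, 'm) top_ring_scheme \<Rightarrow> 'a set \<Rightarrow> bool" where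
  "bounded_subset R S \<longleftrightarrow> S \<subseteq> carrier R \<and>
     (\<forall>U. openin (topo R) U \<and> \<zero>\<^bsub>R\<^esub> \<in> U \<longrightarrow>
        (\<exists>V. openin (topo R) V \<and> \<zero>\<^bsub>R\<^esub> \<in> V \<and> (\<forall>v\<in>V. \<forall>s\<in>S. v \<otimes>\<^bsub>R\<^esub> s \<in> U)))"

definition power_bounded :: "('a, 'm) top_ring_scheme \<Rightarrow> 'a set" where
  "power_bounded R = {a \<in> carrier R. bounded_subset R (range (\<lambda>n::nat. a [^]\<^bsub>R\<^esub> n))}"

definition cauchy_in :: "('a, 'm) top_ring_scheme \<Rightarrow> 'a filter \<Rightarrow> bool" where
  "cauchy_in R F \<longleftrightarrow> (\<forall>U. openin (topo R) U \<and> \<zero>\<^bsub>R\<^esub> \<in> U \<longrightarrow>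
     (\<exists>S \<subseteq> carrier R. eventually (\<lambda>x. x \<in> S) F \<and> (\<forall>x\<in>S. \<forall>y\<in>S. x \<ominus>\<^bsub>R\<^esub> y \<in> U)))"

definition complete_ring :: "('a, 'm) top_ring_scheme \<Rightarrow> bool" where
  "complete_ring R \<longleftrightarrow>
     (\<forall>F. F \<noteq> bot \<and> cauchy_in R F \<longrightarrow> (\<exists>l. limitin (topo R) (\<lambda>x. x) l F))"


section \<open>Integrality and finiteness\<close>

text \<open>The equation of integral dependence is written out, because the list polynomials of the
  library do not include a monic polynomial over the zero ring, which is not excluded here.\<close>

definition integral_elem :: "('a, 'm) ring_scheme \<Rightarrow> 'a set \<Rightarrow> 'a \<Rightarrow> bool" where
  "integral_elem R S x \<longleftrightarrow> x \<in> carrier R \<and>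
     (\<exists>(n::nat) c. c \<in> {..<n} \<rightarrow> S \<and>
        x [^]\<^bsub>R\<^esub> n \<oplus>\<^bsub>R\<^esub> (\<Oplus>\<^bsub>R\<^esub>i\<in>{..<n}. c i \<otimes>\<^bsub>R\<^esub> x [^]\<^bsub>R\<^esub> i) = \<zero>\<^bsub>R\<^esub>)"

definition finite_ring_hom :: "('a, 'm) ring_scheme \<Rightarrow> ('b, 'n) ring_scheme \<Rightarrow> ('a \<Rightarrow> 'b) \<Rightarrow> bool" where
  "finite_ring_hom A B f \<longleftrightarrow> f \<in> ring_hom A B \<and>
     (\<exists>G. finite G \<and> G \<subseteq> carrier B \<and>
        (\<forall>b\<in>carrier B. \<exists>c\<in>G \<rightarrow> carrier A. b = (\<Oplus>\<^bsub>B\<^esub>g\<in>G. f (c g) \<otimes>\<^bsub>B\<^esub> g)))"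


section \<open>Tate-Huber pairs\<close>

record 'a huber_pair = "'a top_ring" +
  plus_ring :: "'a set"

locale tate_huber_pair = tate_ring A for A :: "'a huber_pair" (structure) +
  assumes plus_subring: "subring (plus_ring A) A"
    and plus_open: "openin (topo A) (plus_ring A)"
    and plus_power_bounded: "plus_ring A \<subseteq> power_bounded A"
    and plus_integrally_closed: "integral_elem A (plus_ring A) x \<Longrightarrow> x \<in> plus_ring A"

locale complete_tate_huber_pair = tate_huber_pair +
  assumes complete: "complete_ring A"
    and Hausdorff: "Hausdorff_space (topo A)"

definition pair_hom :: "'a huber_pair \<Rightarrow> 'b huber_pair \<Rightarrow> ('a \<Rightarrow> 'b) set" where
  "pair_hom A B =
     {f \<in> ring_hom A B. continuous_map (topo A) (topo B) f \<and> f ` plus_ring A \<subseteq> plus_ring B}"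

definition finite_pair_hom :: "'a huber_pair \<Rightarrow> 'b huber_pair \<Rightarrow> ('a \<Rightarrow> 'b) \<Rightarrow> bool" where
  "finite_pair_hom A B f \<longleftrightarrow> f \<in> pair_hom A B \<and> finite_ring_hom A B f \<and>
     (\<forall>b\<in>plus_ring B. integral_elem B (f ` plus_ring A) b)"


section \<open>Restricted power series\<close>

text \<open>A power series in \<open>T\<^sub>1, \<dots>, T\<^sub>n\<close> is given by its coefficients on exponents \<open>\<nu>\<close>, where
  \<open>Poly_Mapping.lookup \<nu> i\<close> for \<open>i < n\<close> is the exponent of the variable with number \<open>i + 1\<close>; exponents
  involving any other variable get coefficient zero. Restricted means that the coefficients tend
  to zero along the cofinite filter. This describes the usual ring \<open>A\<langle>T\<^sub>1, \<dots>, T\<^sub>n\<rangle>\<close> when \<open>A\<close> is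
  complete and Hausdorff.\<close>

definition restricted_series :: "nat \<Rightarrow> ('a, 'm) top_ring_scheme \<Rightarrow> ((nat \<Rightarrow>\<^sub>0 nat) \<Rightarrow> 'a) set" where
  "restricted_series n A = {f. range f \<subseteq> carrier A \<and>
     (\<forall>\<nu>. \<not> Poly_Mapping.keys \<nu> \<subseteq> {..<n} \<longrightarrow> f \<nu> = \<zero>\<^bsub>A\<^esub>) \<and>
     (\<forall>U. openin (topo A) U \<and> \<zero>\<^bsub>A\<^esub> \<in> U \<longrightarrow> finite {\<nu>. f \<nu> \<notin> U})}"

text \<open>Neighbourhoods of a series \<open>f\<close> are given by the sets \<open>f + U\<langle>T\<^sub>1, \<dots>, T\<^sub>n\<rangle>\<close> for \<open>U\<close> an open
  neighbourhood of zero.\<close>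

definition series_open ::
    "nat \<Rightarrow> ('a, 'm) top_ring_scheme \<Rightarrow> ((nat \<Rightarrow>\<^sub>0 nat) \<Rightarrow> 'a) set \<Rightarrow> bool" where
  "series_open n A W \<longleftrightarrow> W \<subseteq> restricted_series n A \<and>
     (\<forall>f\<in>W. \<exists>U. openin (topo A) U \<and> \<zero>\<^bsub>A\<^esub> \<in> U \<and>
        (\<forall>g\<in>restricted_series n A. range g \<subseteq> U \<longrightarrow> (\<lambda>\<nu>. f \<nu> \<oplus>\<^bsub>A\<^esub> g \<nu>) \<in> W))"

definition const_series :: "('a, 'm) ring_scheme \<Rightarrow> 'a \<Rightarrow> (nat \<Rightarrow>\<^sub>0 nat) \<Rightarrow> 'a" where
  "const_series A a = (\<lambda>\<nu>. if \<nu> = 0 then a else \<zero>\<^bsub>A\<^esub>)"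

definition tate_algebra :: "nat \<Rightarrow> 'a huber_pair \<Rightarrow> ((nat \<Rightarrow>\<^sub>0 nat) \<Rightarrow> 'a) huber_pair" where
  "tate_algebra n A =
     \<lparr>carrier = restricted_series n A,
      mult = (\<lambda>f g \<nu>. \<Oplus>\<^bsub>A\<^esub>p\<in>{(\<mu>, \<kappa>). \<mu> + \<kappa> = \<nu>}. f (fst p) \<otimes>\<^bsub>A\<^esub> g (snd p)),
      one = const_series A \<one>\<^bsub>A\<^esub>,
      zero = (\<lambda>\<nu>. \<zero>\<^bsub>A\<^esub>),
      add = (\<lambda>f g \<nu>. f \<nu> \<oplus>\<^bsub>A\<^esub> g \<nu>),
      topo = topology (series_open n A),
      plus_ring = {f \<in> restricted_series n A. range f \<subseteq> plus_ring A}\<rparr>"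

lemma istopology_series_open: "istopology (series_open n A)"
proof -
  let ?P = "\<lambda>U f W. openin (topo A) U \<and> \<zero>\<^bsub>A\<^esub> \<in> U \<and>
        (\<forall>g\<in>restricted_series n A. range g \<subseteq> U \<longrightarrow> (\<lambda>\<nu>. f \<nu> \<oplus>\<^bsub>A\<^esub> g \<nu>) \<in> W)"
  have open_iff: "series_open n A W \<longleftrightarrow>
      W \<subseteq> restricted_series n A \<and> (\<forall>f\<in>W. \<exists>U. ?P U f W)" for W
    by (simp add: series_open_def)
  have "series_open n A (S \<inter> T)" if S: "series_open n A S" and T: "series_open n A T" for S T
  proof -
    have "\<exists>U. ?P U f (S \<inter> T)" if f: "f \<in> S \<inter> T" for f
    proof -
      have "\<exists>U. ?P U f S" using S f unfolding open_iff by simp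
      then obtain U where "?P U f S" by (rule exE)
      moreover have "\<exists>V. ?P V f T" using T f unfolding open_iff by simp
      then obtain V where "?P V f T" by (rule exE)
      ultimately have "?P (U \<inter> V) f (S \<inter> T)"
        by (simp add: openin_Int)
      then show ?thesis by (rule exI)
    qed
    moreover have "S \<inter> T \<subseteq> restricted_series n A" using S unfolding open_iff by blast
    ultimately show ?thesis unfolding open_iff by blast
  qed
  moreover have "series_open n A (\<Union>\<K>)" if K: "\<forall>K\<in>\<K>. series_open n A K" for \<K>
  proof -
    have "\<exists>U. ?P U f (\<Union>\<K>)" if f: "f \<in> \<Union>\<K>" for f
    proof -
      obtain K where "K \<in> \<K>" "f \<in> K" using f by blast
      moreover have "\<exists>U. ?P U f K" using K calculation unfolding open_iff by simp
      then obtain U where "?P U f K" by (rule exE)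
      ultimately have "?P U f (\<Union>\<K>)" by auto
      then show ?thesis by (rule exI)
    qed
    moreover have "\<Union>\<K> \<subseteq> restricted_series n A" using K unfolding open_iff by blast
    ultimately show ?thesis unfolding open_iff by simp
  qed
  ultimately show ?thesis unfolding istopology_def by blast
qed

lemma openin_tate_algebra: "openin (topo (tate_algebra n A)) W \<longleftrightarrow> series_open n A W"
  by (simp add: tate_algebra_def topology_inverse'[OF istopology_series_open])

definition strongly_noetherian :: "'a huber_pair \<Rightarrow> bool" where
  "strongly_noetherian A \<longleftrightarrow> (\<forall>n. noetherian_ring (tate_algebra n A))"

text \<open>The last argument is the structure morphism of the \<open>A\<close>-pair \<open>B\<close>.\<close>

definition topologically_finite_type ::
    "'a huber_pair \<Rightarrow> 'b huber_pair \<Rightarrow> ('a \<Rightarrow> 'b) \<Rightarrow> bool" where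
  "topologically_finite_type A B \<phi> \<longleftrightarrow> \<phi> \<in> pair_hom A B \<and>
     (\<exists>n f. f \<in> ring_hom (tate_algebra n A) B \<and>
        (\<forall>a\<in>carrier A. f (const_series A a) = \<phi> a) \<and>
        f ` carrier (tate_algebra n A) = carrier B \<and>
        quotient_map (topo (tate_algebra n A)) (topo B) f \<and>
        f ` plus_ring (tate_algebra n A) \<subseteq> plus_ring B \<and>
        (\<forall>b\<in>plus_ring B. integral_elem B (f ` plus_ring (tate_algebra n A)) b))"

end

theory Submission
  imports Defs
begin

text \<open>
  Write \<open>b\<^sub>j\<close> for the image in \<open>B\<close> of the \<open>j\<close>-th variable of \<open>R\<langle>T\<^sub>1, \<dots>, T\<^sub>n\<rangle>\<close>. Each \<open>b\<^sub>j\<close> lies in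
  \<open>B\<^sup>+\<close>, hence satisfies an integral equation over \<open>A\<^sup>+\<close>. Evaluation at the finitely many coefficients
  of these equations gives \<open>R\<langle>X\<rangle> \<rightarrow> A\<close>. Finitely many monomials in the \<open>b\<^sub>j\<close> span, over the image of
  \<open>R\<^sub>0\<langle>X\<rangle>\<close> for an open bounded subring \<open>R\<^sub>0\<close> of \<open>R\<^sup>+\<close>, all monomials; by successive approximation they span \<open>B\<close> over \<open>R\<langle>X\<rangle>\<close>, and they span
  a module containing the image of \<open>R\<^sup>+\<langle>T\<rangle>\<close> over the image of \<open>R\<^sup>+\<langle>X\<rangle>\<close>. As \<open>R\<langle>X\<rangle>\<close> is noetherian, the
  submodule \<open>A\<close> of \<open>B\<close> is finitely generated, with generators that can be scaled into \<open>A\<^sup>+\<close>. Sending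
  further variables \<open>Y\<close> to them gives a surjection \<open>R\<langle>X, Y\<rangle> \<rightarrow> A\<close>, which is a quotient map by the open
  mapping theorem. Every element of \<open>A\<^sup>+\<close> is integral over the image of \<open>R\<^sup>+\<langle>T\<rangle>\<close> in \<open>B\<close>, hence over
  that of \<open>R\<^sup>+\<langle>X\<rangle>\<close>.
\<close>


section \<open>Spans\<close>

text \<open>This is an Artin-Tate argument for affinoid rings, and its obstacle is that
  \<open>R\<^sup>+\<close> need not be bounded. An infinite expansion needs remainders with a common
  denominator, which series over \<open>R\<^sup>+\<close> do not offer, whereas an expansion over
  \<open>R\<^sub>0\<close> alone says nothing about the image of
  \<open>R\<^sup>+\<langle>T\<rangle>\<close>. The way out is to split a series over
  \<open>R\<^sup>+\<close> into a polynomial over \<open>R\<^sup>+\<close>, which is reduced term by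
  term, and a topologically nilpotent unit times a series over \<open>R\<^sub>0\<close>, and to
  expand only the latter infinitely often. The spanning monomials lie in the image of
  \<open>R\<^sup>+\<langle>T\<rangle>\<close>, which is a ring. Hence products of this image with
  the monomials stay in the module spanned over the image of
  \<open>R\<^sup>+\<langle>X\<rangle>\<close>; this is the form of finiteness from which integrality
  is deduced. The resulting equations have coefficients coming from \<open>A\<close>, so injectivity
  makes them equations in \<open>A\<close>.\<close>

definition lin_span :: "('a, 'm) ring_scheme \<Rightarrow> 'a set \<Rightarrow> ('i \<Rightarrow> 'a) \<Rightarrow> 'i set \<Rightarrow> 'a set" where
  "lin_span R C g I = {(\<Oplus>\<^bsub>R\<^esub>i\<in>I. c i \<otimes>\<^bsub>R\<^esub> g i) | c. c \<in> I \<rightarrow> C}"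

lemma spanI: "c \<in> I \<rightarrow> C \<Longrightarrow> (\<Oplus>\<^bsub>R\<^esub>i\<in>I. c i \<otimes>\<^bsub>R\<^esub> g i) \<in> lin_span R C g I"
  unfolding lin_span_def by blast

lemma spanE:
  assumes "x \<in> lin_span R C g I"
  obtains c where "c \<in> I \<rightarrow> C" "x = (\<Oplus>\<^bsub>R\<^esub>i\<in>I. c i \<otimes>\<^bsub>R\<^esub> g i)"
  using assms unfolding lin_span_def by blast

lemma span_mono: "C \<subseteq> D \<Longrightarrow> lin_span R C g I \<subseteq> lin_span R D g I"
  unfolding lin_span_def by blast

locale coeffs = cring R for R (structure) +
  fixes C
  assumes sub: "C \<subseteq> carrier R" and zero: "\<zero> \<in> C"
    and add: "\<And>x y. x \<in> C \<Longrightarrow> y \<in> C \<Longrightarrow> x \<oplus> y \<in> C"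
begin

lemma span_sub: "g \<in> I \<rightarrow> carrier R \<Longrightarrow> lin_span R C g I \<subseteq> carrier R"
  using sub by (auto simp: lin_span_def intro!: finsum_closed)

lemma span_add:
  assumes g: "g \<in> I \<rightarrow> carrier R" and "x \<in> lin_span R C g I" "y \<in> lin_span R C g I"
  shows "x \<oplus> y \<in> lin_span R C g I"
proof -
  obtain c d where c: "c \<in> I \<rightarrow> C" "x = (\<Oplus>i\<in>I. c i \<otimes> g i)"
    and d: "d \<in> I \<rightarrow> C" "y = (\<Oplus>i\<in>I. d i \<otimes> g i)"
    using assms unfolding lin_span_def by blast
  have car: "c i \<in> carrier R" "d i \<in> carrier R" "g i \<in> carrier R" if "i \<in> I" for i
    using that c(1) d(1) g sub by (auto simp: Pi_iff)
  have "x \<oplus> y = (\<Oplus>i\<in>I. c i \<otimes> g i \<oplus> d i \<otimes> g i)"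
    unfolding c d using car by (subst finsum_addf) auto
  also have "\<dots> = (\<Oplus>i\<in>I. (c i \<oplus> d i) \<otimes> g i)"
    using car by (intro finsum_cong') (auto simp: l_distr)
  finally have "x \<oplus> y = (\<Oplus>i\<in>I. (c i \<oplus> d i) \<otimes> g i)" .
  moreover have "(\<lambda>i. c i \<oplus> d i) \<in> I \<rightarrow> C" using c(1) d(1) add by auto
  ultimately show ?thesis using spanI[of "\<lambda>i. c i \<oplus> d i" I C R g] by simp
qed

lemma span_zero:
  assumes "g \<in> I \<rightarrow> carrier R" shows "\<zero> \<in> lin_span R C g I"
proof -
  have "(\<Oplus>i\<in>I. \<zero> \<otimes> g i) = (\<Oplus>i\<in>I. \<zero>)"
    using assms by (intro finsum_cong') (auto simp: Pi_iff)
  then show ?thesis using zero spanI[of "\<lambda>_. \<zero>" I C R g] by simp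
qed

lemma span_base:
  assumes "g \<in> I \<rightarrow> carrier R" "finite I" "i \<in> I" "c \<in> C"
  shows "c \<otimes> g i \<in> lin_span R C g I"
proof -
  have "c \<otimes> g i = (\<Oplus>j\<in>I. if i = j then c \<otimes> g i else \<zero>)"
    using finsum_singleton[of i I "\<lambda>_. c \<otimes> g i"] assms sub by (auto simp: Pi_iff subset_iff)
  also have "\<dots> = (\<Oplus>j\<in>I. (if i = j then c else \<zero>) \<otimes> g j)"
    using assms sub by (intro finsum_cong') (auto simp: Pi_iff subset_iff)
  finally show ?thesis using assms zero unfolding lin_span_def
    by (auto intro!: exI[of _ "\<lambda>j. if i = j then c else \<zero>"])
qed

lemma span_finsum:
  assumes "g \<in> I \<rightarrow> carrier R" "finite J" "\<And>j. j \<in> J \<Longrightarrow> z j \<in> lin_span R C g I"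
  shows "(\<Oplus>j\<in>J. z j) \<in> lin_span R C g I"
  using assms(2,3)
proof (induction J)
  case empty then show ?case using span_zero[OF assms(1)] by simp
next
  case (insert j J)
  then have "z \<in> J \<rightarrow> carrier R" "z j \<in> carrier R"
    using span_sub[OF assms(1)] by auto
  then show ?case using insert span_add[OF assms(1)] by (subst finsum_insert) auto
qed

end

text \<open>Induction over a span: a property of its elements is proved by taking \<open>N\<close>
  to be the set of elements that have it. Most later work with spans goes through generators in this
  way instead of through explicit sums.\<close>

lemma (in coeffs) span_minimal:
  assumes "g \<in> I \<rightarrow> carrier R" "finite I" "\<zero> \<in> N"
    and "\<And>x y. x \<in> N \<Longrightarrow> y \<in> N \<Longrightarrow> x \<oplus> y \<in> N"
    and "\<And>c i. c \<in> C \<Longrightarrow> i \<in> I \<Longrightarrow> c \<otimes> g i \<in> N"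
  shows "lin_span R C g I \<subseteq> N"
proof
  fix x assume "x \<in> lin_span R C g I"
  then obtain c where c: "c \<in> I \<rightarrow> C" "x = (\<Oplus>i\<in>I. c i \<otimes> g i)"
    unfolding lin_span_def by blast
  have "(\<Oplus>i\<in>J. c i \<otimes> g i) \<in> N" if "J \<subseteq> I" for J
    using finite_subset[OF that \<open>finite I\<close>] that
  proof (induction J)
    case empty then show ?case using assms by simp
  next
    case (insert j J)
    moreover have "(\<lambda>i. c i \<otimes> g i) \<in> J \<rightarrow> carrier R" "c j \<otimes> g j \<in> carrier R"
      using insert.prems c(1) assms(1) sub by (auto simp: Pi_iff subset_iff)
    moreover have "c j \<otimes> g j \<in> N" using c(1) assms(5) insert.prems by auto
    ultimately show ?case using assms(4) by (subst finsum_insert) auto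
  qed
  then show "x \<in> N" using c by simp
qed

text \<open>Neither set of coefficients is assumed to be a ring: the elimination below works with
  coefficients of bounded degree.\<close>

lemma (in cring) span_mult:
  assumes C: "coeffs R C" and D: "coeffs R D" and g: "g \<in> I \<rightarrow> carrier R" "finite I"
    and h: "h \<in> J \<rightarrow> carrier R" and x: "x \<in> carrier R"
    and gen: "\<And>c i. c \<in> C \<Longrightarrow> i \<in> I \<Longrightarrow> x \<otimes> (c \<otimes> g i) \<in> lin_span R D h J"
    and m: "m \<in> lin_span R C g I"
  shows "x \<otimes> m \<in> lin_span R D h J"
proof -
  interpret C: coeffs R C by fact
  interpret D: coeffs R D by fact
  let ?N = "{m \<in> carrier R. x \<otimes> m \<in> lin_span R D h J}"
  have "lin_span R C g I \<subseteq> ?N"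
    using g h x gen C.sub D.span_add[OF h] D.span_zero[OF h]
    by (intro C.span_minimal) (auto simp: r_distr)
  then show ?thesis using m by blast
qed

lemma (in cring) subring_coeffs: "subring C R \<Longrightarrow> coeffs R C"
  using subringE[of C R] by unfold_locales auto

lemma (in cring) span_scale:
  assumes C: "subring C R" and g: "g \<in> I \<rightarrow> carrier R" "finite I"
    and "c \<in> C" "m \<in> lin_span R C g I"
  shows "c \<otimes> m \<in> lin_span R C g I"
proof -
  note C' = subring_coeffs[OF C]
  interpret coeffs R C by (rule C')
  show ?thesis
  proof (rule span_mult[OF C' C' g g(1) _ _ assms(5)])
    fix d i assume "d \<in> C" "i \<in> I"
    then have "c \<otimes> (d \<otimes> g i) = (c \<otimes> d) \<otimes> g i" "c \<otimes> d \<in> C"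
      using g subringE[OF C] assms by (auto simp: m_assoc Pi_iff subset_iff)
    then show "c \<otimes> (d \<otimes> g i) \<in> lin_span R C g I" using span_base g \<open>i \<in> I\<close> by simp
  qed (use assms sub in auto)
qed

section \<open>Integral dependence\<close>

locale over_subring = cring R for R (structure) +
  fixes C x
  assumes subring: "subring C R" and x: "x \<in> carrier R"
begin

text \<open>Values at \<open>x\<close> of polynomials over \<open>C\<close>, not polynomials: the
  degree bound is kept as an index, since a value does not determine it. Degree bounds add under
  products, which is what the elimination exploits.\<close>

definition low :: "nat \<Rightarrow> 'a set" where
  "low e = lin_span R C (\<lambda>k. x [^] k) {..<e}"

definition monic :: "nat \<Rightarrow> 'a set" where
  "monic e = (\<lambda>l. x [^] e \<oplus> l) ` low e"

sublocale C: coeffs R C by (rule subring_coeffs[OF subring])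

lemma pow_closed: "(\<lambda>k::nat. x [^] k) \<in> K \<rightarrow> carrier R"
  using x by simp

sublocale low: coeffs R "low e"
  using C.span_sub[OF pow_closed] C.span_zero[OF pow_closed] C.span_add[OF pow_closed]
  by unfold_locales (auto simp: low_def)

lemma low_base: "c \<in> C \<Longrightarrow> k < e \<Longrightarrow> c \<otimes> x [^] k \<in> low e"
  unfolding low_def using C.span_base[OF pow_closed, of "{..<e}" k c] by auto

lemma low_minimal:
  assumes "\<zero> \<in> N" "\<And>x y. x \<in> N \<Longrightarrow> y \<in> N \<Longrightarrow> x \<oplus> y \<in> N"
    and "\<And>c k. c \<in> C \<Longrightarrow> k < e \<Longrightarrow> c \<otimes> x [^] k \<in> N"
  shows "low e \<subseteq> N"
  unfolding low_def using assms by (intro C.span_minimal[OF pow_closed]) auto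

lemma low_mult:
  assumes "p \<in> low d" "q \<in> low e"
  shows "p \<otimes> q \<in> low (d + e)"
proof -
  let ?N = "{p \<in> carrier R. \<forall>q\<in>low e. p \<otimes> q \<in> low (d + e)}"
  have "low d \<subseteq> ?N"
  proof (rule low_minimal)
    show "\<zero> \<in> ?N" using low.sub low.zero by (auto simp: subset_iff)
    show "y \<oplus> z \<in> ?N" if "y \<in> ?N" "z \<in> ?N" for y z
      using that low.sub low.add by (auto simp: l_distr subset_iff)
  next
    fix c k assume c: "c \<in> C" "k < d"
    let ?y = "c \<otimes> x [^] k"
    have y: "?y \<in> carrier R" using c x C.sub by auto
    have "low e \<subseteq> {q \<in> carrier R. ?y \<otimes> q \<in> low (d + e)}"
    proof (rule low_minimal)
      show "a \<oplus> b \<in> {q \<in> carrier R. ?y \<otimes> q \<in> low (d + e)}"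
        if "a \<in> {q \<in> carrier R. ?y \<otimes> q \<in> low (d + e)}" "b \<in> {q \<in> carrier R. ?y \<otimes> q \<in> low (d + e)}"
        for a b using that y low.add by (auto simp: r_distr)
      fix c' k' assume c': "c' \<in> C" "k' < e"
      have "?y \<otimes> (c' \<otimes> x [^] k') = (c \<otimes> c') \<otimes> x [^] (k + k')"
        using c c' x C.sub by (auto simp: subset_iff m_ac nat_pow_mult[symmetric])
      moreover have "c \<otimes> c' \<in> C" using subringE(6)[OF subring] c c' by auto
      ultimately show "c' \<otimes> x [^] k' \<in> {q \<in> carrier R. ?y \<otimes> q \<in> low (d + e)}"
        using c c' x low_base[of "c \<otimes> c'" "k + k'" "d + e"] C.sub by auto
    qed (use y low.zero in auto)
    then show "?y \<in> ?N" using y by auto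
  qed
  then show ?thesis using assms by auto
qed

lemma low_mono: "d \<le> e \<Longrightarrow> low d \<subseteq> low e"
  by (intro low_minimal low.zero low.add low_base) auto

lemma pow_low: "k < e \<Longrightarrow> x [^] k \<in> low e"
  using low_base[of \<one> k e] subringE(3)[OF subring] x by auto

lemma pow_mult_low:
  assumes "q \<in> low e" shows "x [^] d \<otimes> q \<in> low (d + e)"
proof -
  have "low e \<subseteq> {q \<in> carrier R. x [^] d \<otimes> q \<in> low (d + e)}"
  proof (rule low_minimal)
    fix c k assume c: "c \<in> C" "k < e"
    have "x [^] d \<otimes> (c \<otimes> x [^] k) = c \<otimes> x [^] (d + k)"
      using c x C.sub by (auto simp: subset_iff m_ac nat_pow_mult[symmetric])
    then show "c \<otimes> x [^] k \<in> {q \<in> carrier R. x [^] d \<otimes> q \<in> low (d + e)}"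
      using c x C.sub low_base[of c "d + k" "d + e"] by auto
  qed (use x low.zero low.add in \<open>auto simp: r_distr\<close>)
  then show ?thesis using assms by auto
qed

lemma monic_sub: "monic e \<subseteq> carrier R"
  using low.sub x by (auto simp: monic_def)

lemma monic_mult_low:
  assumes "p \<in> monic d" "q \<in> low e" shows "p \<otimes> q \<in> low (d + e)"
proof -
  obtain l where l: "l \<in> low d" "p = x [^] d \<oplus> l" using assms by (auto simp: monic_def)
  then have "p \<otimes> q = x [^] d \<otimes> q \<oplus> l \<otimes> q"
    using assms x low.sub by (auto simp: l_distr subset_iff)
  then show ?thesis using l assms low_mult pow_mult_low low.add by simp
qed

lemma monic_mult:
  assumes "p \<in> monic d" "q \<in> monic e" shows "p \<otimes> q \<in> monic (d + e)"
proof -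
  obtain l m where l: "l \<in> low d" "p = x [^] d \<oplus> l" and m: "m \<in> low e" "q = x [^] e \<oplus> m"
    using assms by (auto simp: monic_def)
  have "p \<otimes> q = x [^] (d + e) \<oplus> (x [^] e \<otimes> l \<oplus> p \<otimes> m)"
    using l m x low.sub[of d] low.sub[of e]
    by (auto simp: l_distr r_distr subset_iff nat_pow_mult[symmetric] a_ac m_ac)
  moreover have "x [^] e \<otimes> l \<oplus> p \<otimes> m \<in> low (d + e)"
    using pow_mult_low[OF l(1), of e] monic_mult_low[OF assms(1) m(1)] low.add
    by (simp add: add.commute)
  ultimately show ?thesis by (simp add: monic_def)
qed

lemma low_neg:
  assumes "q \<in> low e" shows "\<ominus> q \<in> low e"
proof -
  have "low e \<subseteq> {q \<in> carrier R. \<ominus> q \<in> low e}"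
  proof (rule low_minimal)
    fix c k assume c: "c \<in> C" "k < e"
    have "\<ominus> (c \<otimes> x [^] k) = (\<ominus> c) \<otimes> x [^] k"
      using c x C.sub by (auto simp: l_minus subset_iff)
    then show "c \<otimes> x [^] k \<in> {q \<in> carrier R. \<ominus> q \<in> low e}"
      using c x C.sub low_base[of "\<ominus> c" k e] subringE(5)[OF subring] by auto
  qed (use low.zero low.add in \<open>auto simp: minus_add\<close>)
  then show ?thesis using assms by auto
qed

text \<open>Monic values multiply to monic values, so this form of integral dependence fits the
  elimination: it suffices to produce one monic value that vanishes.\<close>

lemma integral_elem_iff: "integral_elem R C x \<longleftrightarrow> (\<exists>e. \<zero> \<in> monic e)"
  using x by (auto simp: integral_elem_def monic_def low_def lin_span_def image_iff) metis+

text \<open>Elimination of one unknown after the other from a linear system replaces the usual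
  determinant: the coefficient of the eliminated unknown is monic in \<open>x\<close>, hence the degrees in
  the remaining system merely double.\<close>

lemma elimination:
  assumes "finite I" "m \<in> I \<rightarrow> carrier R"
    and "\<And>i. i \<in> I \<Longrightarrow> x [^] e \<otimes> m i \<in> lin_span R (low e) m I"
  shows "\<exists>d. \<exists>p\<in>monic d. \<forall>i\<in>I. p \<otimes> m i = \<zero>"
  using assms
proof (induction I arbitrary: e)
  case empty
  have "x [^] (0::nat) \<oplus> \<zero> \<in> monic 0" unfolding monic_def using low.zero by blast
  then show ?case by blast
next
  case (insert a J)
  have mJ: "m \<in> J \<rightarrow> carrier R" and ma: "m a \<in> carrier R" using insert.prems by auto
  have split: "\<exists>q\<in>low e. \<exists>s\<in>lin_span R (low e) m J. z = q \<otimes> m a \<oplus> s"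
    if z: "z \<in> lin_span R (low e) m (insert a J)" for z
  proof -
    obtain c where c: "c \<in> insert a J \<rightarrow> low e" "z = (\<Oplus>i\<in>insert a J. c i \<otimes> m i)"
      using z unfolding lin_span_def by blast
    have "z = c a \<otimes> m a \<oplus> (\<Oplus>i\<in>J. c i \<otimes> m i)"
      unfolding c(2) using insert.hyps c(1) mJ ma low.sub
      by (intro finsum_insert) (auto simp: Pi_iff subset_iff)
    then show ?thesis using c(1) unfolding lin_span_def by blast
  qed
  obtain q s where q: "q \<in> low e" and s: "s \<in> lin_span R (low e) m J"
    and eqa: "x [^] e \<otimes> m a = q \<otimes> m a \<oplus> s"
    using split[OF insert.prems(2)[of a]] by auto
  \<comment> \<open>The equation for \<open>m a\<close> is solved for its own unknown: all multiples
    of \<open>m a\<close> go to one side, where their coefficient \<open>p\<close> is monic.\<close>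
  define p where "p = x [^] e \<oplus> \<ominus> q"
  have p: "p \<in> monic e" unfolding p_def monic_def using low_neg[OF q] by blast
  have car: "q \<in> carrier R" "s \<in> carrier R" "p \<in> carrier R"
    using q s p low.sub low.span_sub[OF mJ] monic_sub by blast+
  have pma: "p \<otimes> m a = s"
  proof -
    have "p \<otimes> m a = x [^] e \<otimes> m a \<oplus> \<ominus> (q \<otimes> m a)"
      using car ma x by (simp add: p_def l_distr l_minus)
    also have "\<dots> = s" unfolding eqa using car ma x
      by (simp add: a_ac r_neg r_neg1 r_neg2)
    finally show ?thesis .
  qed
  note cl = low.coeffs_axioms
  have lowmul: "y \<otimes> z \<in> lin_span R (low (e + e)) m J"
    if y: "y \<in> carrier R" and yl: "\<And>l. l \<in> low e \<Longrightarrow> y \<otimes> l \<in> low (e + e)"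
      and z: "z \<in> lin_span R (low e) m J" for y z
  proof (rule span_mult[OF cl cl mJ _ mJ y _ z])
    fix c i assume "c \<in> low e" "i \<in> J"
    then have "y \<otimes> (c \<otimes> m i) = (y \<otimes> c) \<otimes> m i"
      using y mJ low.sub by (auto simp: m_assoc subset_iff Pi_iff)
    then show "y \<otimes> (c \<otimes> m i) \<in> lin_span R (low (e + e)) m J"
      using low.span_base[OF mJ] insert.hyps yl \<open>c \<in> low e\<close> \<open>i \<in> J\<close> by simp
  qed (use insert in auto)
  \<comment> \<open>Write one factor \<open>x [^] e\<close> as \<open>p \<oplus> q\<close>. The part
    with \<open>p\<close> turns \<open>p \<otimes> m a\<close> into \<open>s\<close>, which
    eliminates \<open>m a\<close>; the part with \<open>q\<close> stays a multiple of
    \<open>m i\<close>, with a coefficient of degree below \<open>e + e\<close>.\<close>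
  have "x [^] (e + e) \<otimes> m i \<in> lin_span R (low (e + e)) m J" if i: "i \<in> J" for i
  proof -
    obtain q' s' where q': "q' \<in> low e" and s': "s' \<in> lin_span R (low e) m J"
      and eqi: "x [^] e \<otimes> m i = q' \<otimes> m a \<oplus> s'"
      using split[OF insert.prems(2)[of i]] i by auto
    have car': "q' \<in> carrier R" "s' \<in> carrier R" "m i \<in> carrier R"
      using q' s' low.sub low.span_sub[OF mJ] mJ i by blast+
    have "x [^] (e + e) \<otimes> m i = x [^] e \<otimes> (x [^] e \<otimes> m i)"
      using x car' by (simp add: nat_pow_mult[symmetric] m_assoc)
    also have "\<dots> = (p \<oplus> q) \<otimes> (x [^] e \<otimes> m i)"
      using x car by (simp add: p_def a_assoc l_neg)
    also have "\<dots> = q' \<otimes> s \<oplus> (p \<otimes> s' \<oplus> (x [^] e \<otimes> q) \<otimes> m i)"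
    proof -
      have "(p \<oplus> q) \<otimes> (x [^] e \<otimes> m i) = p \<otimes> (q' \<otimes> m a \<oplus> s') \<oplus> q \<otimes> (x [^] e \<otimes> m i)"
        using x car car' by (simp add: l_distr eqi[symmetric])
      also have "p \<otimes> (q' \<otimes> m a \<oplus> s') = q' \<otimes> (p \<otimes> m a) \<oplus> p \<otimes> s'"
        using car car' ma by (simp add: r_distr m_ac)
      finally show ?thesis using x car car' by (simp add: pma a_assoc m_ac)
    qed
    also have "\<dots> \<in> lin_span R (low (e + e)) m J"
    proof (intro low.span_add mJ)
      show "q' \<otimes> s \<in> lin_span R (low (e + e)) m J"
        using lowmul[OF car'(1) low_mult[OF q'] s] .
      show "p \<otimes> s' \<in> lin_span R (low (e + e)) m J"
        using lowmul[OF car(3) monic_mult_low[OF p] s'] .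
      show "(x [^] e \<otimes> q) \<otimes> m i \<in> lin_span R (low (e + e)) m J"
        using low.span_base[OF mJ insert.hyps(1) i pow_mult_low[OF q]] .
    qed
    finally show ?thesis .
  qed
  then obtain d p' where p': "p' \<in> monic d" "\<forall>i\<in>J. p' \<otimes> m i = \<zero>"
    using insert.IH[OF mJ] by blast
  have p'c: "p' \<in> carrier R" using p' monic_sub by auto
  have "s \<in> lin_span R (low e) m J" by fact
  \<comment> \<open>\<open>p'\<close> annihilates the remaining unknowns, hence also
    \<open>s = p \<otimes> m a\<close>; so \<open>p' \<otimes> p\<close> annihilates all of
    them.\<close>
  have "lin_span R (low e) m J \<subseteq> {z \<in> carrier R. p' \<otimes> z = \<zero>}"
  proof (rule low.span_minimal[OF mJ insert.hyps(1)])
    fix c i assume "c \<in> low e" "i \<in> J"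
    moreover have "p' \<otimes> (c \<otimes> m i) = c \<otimes> (p' \<otimes> m i)"
      using calculation p'c low.sub mJ by (intro m_lcomm) auto
    ultimately show "c \<otimes> m i \<in> {z \<in> carrier R. p' \<otimes> z = \<zero>}"
      using p' low.sub[of e] mJ by (auto simp: Pi_iff subset_iff)
  qed (use p'c in \<open>auto simp: r_distr\<close>)
  then have "p' \<otimes> s = \<zero>" using s by blast
  then have "(p' \<otimes> p) \<otimes> m a = \<zero>" using p'c car ma pma by (simp add: m_assoc)
  moreover have "(p' \<otimes> p) \<otimes> m i = \<zero>" if "i \<in> J" for i
  proof -
    have "m i \<in> carrier R" using that mJ by auto
    then have "(p' \<otimes> p) \<otimes> m i = p \<otimes> (p' \<otimes> m i)" using p'c car by (simp add: m_ac)
    then show ?thesis using p' that car by simp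
  qed
  ultimately show ?case using monic_mult[OF p'(1) p] by blast
qed

text \<open>A form of the Cayley-Hamilton theorem. Elimination with \<open>e = 1\<close> yields a
  monic value \<open>p\<close> that annihilates all generators; as one lies in their span,
  \<open>p\<close> itself vanishes.\<close>

lemma integral_if_finite_module:
  assumes "finite I" and m: "m \<in> I \<rightarrow> carrier R" and one: "\<one> \<in> lin_span R C m I"
    and stable: "\<And>i. i \<in> I \<Longrightarrow> x \<otimes> m i \<in> lin_span R C m I"
  shows "integral_elem R C x"
proof -
  have "C \<subseteq> low 1"
    using low_base[of _ 0 1] C.sub by force
  then have "x [^] (1::nat) \<otimes> m i \<in> lin_span R (low 1) m I" if "i \<in> I" for i
    using stable[OF that] span_mono[of C "low 1" R m I] x by auto
  then obtain d p where p: "p \<in> monic d" "\<forall>i\<in>I. p \<otimes> m i = \<zero>"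
    using elimination[OF assms(1,2)] by blast
  have pc: "p \<in> carrier R" using p monic_sub by auto
  have "lin_span R C m I \<subseteq> {z \<in> carrier R. p \<otimes> z = \<zero>}"
  proof (rule C.span_minimal[OF m assms(1)])
    fix c i assume "c \<in> C" "i \<in> I"
    moreover have "p \<otimes> (c \<otimes> m i) = c \<otimes> (p \<otimes> m i)"
      using calculation pc C.sub m by (intro m_lcomm) auto
    ultimately show "c \<otimes> m i \<in> {z \<in> carrier R. p \<otimes> z = \<zero>}"
      using p C.sub m by (auto simp: Pi_iff subset_iff)
  qed (use pc in \<open>auto simp: r_distr\<close>)
  then have "p = \<zero>" using one pc by auto
  then show ?thesis using p integral_elem_iff by auto
qed

end

lemma (in coeffs) span_index_mono:
  assumes "g \<in> J \<rightarrow> carrier R" "finite J" "I \<subseteq> J"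
  shows "lin_span R C g I \<subseteq> lin_span R C g J"
proof (rule span_minimal)
  show "c \<otimes> g i \<in> lin_span R C g J" if "c \<in> C" "i \<in> I" for c i
    using span_base[OF assms(1,2)] that assms(3) by blast
qed (use assms finite_subset span_zero[OF assms(1)] span_add[OF assms(1)] in auto)

text \<open>The elements of \<open>E\<close> are adjoined one at a time, multiplying the generators
  by powers of the new element up to the degree of its equation. The generators are monomials in
  \<open>E\<close>, and the second subring \<open>D\<close> records where they lie; later it is an
  intersection that encodes two different properties of \<open>G\<close>.\<close>

lemma (in cring) finite_module_of_integrals:
  assumes C: "subring C R" and D: "subring D R" and "finite E" "E \<subseteq> D"
    and "\<And>b. b \<in> E \<Longrightarrow> integral_elem R C b"
  shows "\<exists>G. finite G \<and> G \<subseteq> D \<and> \<one> \<in> G \<and> (\<forall>b\<in>E. \<forall>g\<in>G. b \<otimes> g \<in> lin_span R C (\<lambda>g. g) G)"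
  using assms(3-5)
proof (induction E)
  case empty
  have "finite {\<one>}" "{\<one>} \<subseteq> D" using subringE(3)[OF D] by auto
  then show ?case by blast
next
  case (insert b E)
  have "E \<subseteq> D" "\<And>b. b \<in> E \<Longrightarrow> integral_elem R C b" using insert.prems by auto
  from insert.IH[OF this] obtain G where G: "finite G" "G \<subseteq> D" "\<one> \<in> G"
    and EG: "\<And>b g. b \<in> E \<Longrightarrow> g \<in> G \<Longrightarrow> b \<otimes> g \<in> lin_span R C (\<lambda>g. g) G"
    by blast
  note Dc = subringE(1)[OF D]
  have b: "b \<in> carrier R" using insert.prems Dc by auto
  interpret over_subring R C b
    by (intro over_subring.intro over_subring_axioms.intro cring_axioms C b)
  have Gc: "(\<lambda>g. g) \<in> G \<rightarrow> carrier R" using G Dc by auto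
  have "\<exists>e. \<zero> \<in> monic e" using insert.prems(2)[of b] integral_elem_iff by blast
  then obtain e l where l: "l \<in> low e" "b [^] e \<oplus> l = \<zero>" unfolding monic_def by force
  \<comment> \<open>The exponent \<open>e\<close> is included so that one remains a generator when
    \<open>e = 0\<close>, which can happen in the zero ring.\<close>
  define H where "H = (\<lambda>(g, k). g \<otimes> b [^] k) ` (G \<times> {..e})"
  have bD: "b [^] k \<in> D" for k :: nat
    using insert.prems(1) subringE[OF D] by (induction k) auto
  have Hf: "finite H" and HD: "H \<subseteq> D"
    using G bD subringE(6)[OF D] by (auto simp: H_def)
  have Hc: "(\<lambda>g. g) \<in> H \<rightarrow> carrier R" using HD Dc by auto
  have mem: "g \<otimes> b [^] k \<in> H" if "g \<in> G" "k \<le> e" for g k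
    unfolding H_def using that by force
  have base: "c \<otimes> (g \<otimes> b [^] k) \<in> lin_span R C (\<lambda>g. g) H" if "c \<in> C" "g \<in> G" "k \<le> e" for c g k
    using C.span_base[OF Hc Hf mem[OF that(2,3)] that(1)] .
  have gc: "g \<in> carrier R" if "g \<in> G" for g using that G Dc by auto
  have "\<one> \<in> H" using mem[of \<one> 0] G by simp
  moreover have "b' \<otimes> h \<in> lin_span R C (\<lambda>g. g) H" if b': "b' \<in> insert b E" and "h \<in> H" for b' h
  proof -
    obtain g k where gk: "g \<in> G" "k \<le> e" "h = g \<otimes> b [^] k"
      using \<open>h \<in> H\<close> by (auto simp: H_def)
    have b'c: "b' \<in> carrier R" using b' insert.prems(1) Dc by auto
    consider "b' \<in> E" | "b' = b" "k < e" | "b' = b" "k = e" using b' gk by force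
    then show ?thesis
    proof cases
      case 1
      have "b [^] k \<otimes> (b' \<otimes> g) \<in> lin_span R C (\<lambda>g. g) H"
      proof (rule span_mult[OF C.coeffs_axioms C.coeffs_axioms Gc G(1) Hc _ _ EG[OF 1 gk(1)]])
        fix c i assume "c \<in> C" "i \<in> G"
        moreover have "b [^] k \<otimes> (c \<otimes> i) = c \<otimes> (i \<otimes> b [^] k)"
          using C.sub calculation gc b by (auto simp: subset_iff m_ac)
        ultimately show "b [^] k \<otimes> (c \<otimes> i) \<in> lin_span R C (\<lambda>g. g) H"
          using base gk by simp
      qed (use b in simp)
      moreover have "b [^] k \<otimes> (b' \<otimes> g) = b' \<otimes> h"
        using gk b b'c gc by (simp add: m_ac)
      ultimately show ?thesis by simp
    next
      case 2
      then have "b' \<otimes> h = \<one> \<otimes> (g \<otimes> b [^] Suc k)"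
        using gk b gc by (simp add: m_ac)
      then show ?thesis using base[of \<one> g "Suc k"] 2 gk subringE(3)[OF C] by simp
    next
      case 3
      \<comment> \<open>The equation expresses \<open>b [^] e\<close> in degree below
        \<open>e\<close>, so a further factor \<open>b\<close> leads to exponents up to
        \<open>e\<close> only.\<close>
      have "b [^] e = \<ominus> l" using l b low.sub[of e] minus_equality[of "b [^] e" l] by (auto simp: subset_iff)
      then have "b \<otimes> b [^] e \<in> low (1 + e)"
        using pow_mult_low[OF low_neg[OF l(1)], of 1] b by simp
      then have *: "b \<otimes> b [^] e \<in> lin_span R C (\<lambda>k. b [^] k) {..<Suc e}" unfolding low_def by simp
      have "g \<otimes> (b \<otimes> b [^] e) \<in> lin_span R C (\<lambda>g. g) H"
      proof (rule span_mult[OF C.coeffs_axioms C.coeffs_axioms pow_closed _ Hc _ _ *])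
        fix c i assume "c \<in> C" "i \<in> {..<Suc e}"
        moreover have "g \<otimes> (c \<otimes> b [^] i) = c \<otimes> (g \<otimes> b [^] i)"
          using C.sub calculation gc gk b by (auto simp: subset_iff m_ac)
        ultimately show "g \<otimes> (c \<otimes> b [^] i) \<in> lin_span R C (\<lambda>g. g) H"
          using base gk by simp
      qed (use gc gk in auto)
      moreover have "g \<otimes> (b \<otimes> b [^] e) = b' \<otimes> h"
        using gk b gc 3 by (simp add: m_ac)
      ultimately show ?thesis by simp
    qed
  qed
  ultimately show ?case using Hf HD by (intro exI[of _ H]) auto
qed

text \<open>If \<open>x\<close> satisfies an equation of degree \<open>n\<close> over
  \<open>D\<close>, the products \<open>g \<otimes> x [^] k\<close> span a \<open>C\<close>-module
  that \<open>x\<close> preserves: the equation produces coefficients from \<open>D\<close>, and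
  these are absorbed by \<open>G\<close>. \<open>D\<close> enters only through its products with
  \<open>G\<close>, so it may be infinite.\<close>

lemma (in cring) integral_elem_trans:
  assumes C: "subring C R" and G: "finite G" "G \<subseteq> carrier R" "\<one> \<in> G" and D: "D \<subseteq> carrier R"
    and DG: "\<And>d g. d \<in> D \<Longrightarrow> g \<in> G \<Longrightarrow> d \<otimes> g \<in> lin_span R C (\<lambda>g. g) G"
    and xi: "integral_elem R D x"
  shows "integral_elem R C x"
proof -
  have xc: "x \<in> carrier R" using xi by (simp add: integral_elem_def)
  interpret over_subring R C x
    by (intro over_subring.intro over_subring_axioms.intro cring_axioms C xc)
  obtain n :: nat and c where c: "c \<in> {..<n} \<rightarrow> D"
    and eq: "x [^] n \<oplus> (\<Oplus>i\<in>{..<n}. c i \<otimes> x [^] i) = \<zero>"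
    using xi unfolding integral_elem_def by blast
  \<comment> \<open>With exponents below \<open>n\<close> only, the generator one would be missing
    for \<open>n = 0\<close>.\<close>
  let ?I = "G \<times> {..n}" and ?m = "\<lambda>(g, k). g \<otimes> x [^] k"
  have Gc: "(\<lambda>g. g) \<in> G \<rightarrow> carrier R" and gc: "\<And>g. g \<in> G \<Longrightarrow> g \<in> carrier R" using G by auto
  have mc: "?m \<in> ?I \<rightarrow> carrier R" using gc xc by auto
  have fin: "finite ?I" using G by simp
  have base: "c \<otimes> (g \<otimes> x [^] k) \<in> lin_span R C ?m ?I" if "c \<in> C" "g \<in> G" "k \<le> n" for c g k
    using C.span_base[OF mc fin _ that(1), of "(g, k)"] that by simp
  show ?thesis
  proof (rule integral_if_finite_module[OF fin mc])
    show "\<one> \<in> lin_span R C ?m ?I" using base[of \<one> \<one> 0] subringE(3)[OF C] G by simp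
    fix i assume "i \<in> ?I"
    then obtain g k where i: "i = (g, k)" "g \<in> G" "k \<le> n" by auto
    have g: "g \<in> carrier R" using i gc by auto
    show "x \<otimes> ?m i \<in> lin_span R C ?m ?I"
    proof (cases "k < n")
      case True
      then have "x \<otimes> ?m i = \<one> \<otimes> (g \<otimes> x [^] Suc k)"
        using g xc i by (simp add: m_ac)
      then show ?thesis using base[of \<one> g "Suc k"] True i subringE(3)[OF C] by simp
    next
      case False
      then have kn: "k = n" using i by simp
      let ?s = "\<Oplus>i\<in>{..<n}. c i \<otimes> x [^] i"
      have cc: "c j \<in> carrier R" if "j < n" for j using c D that by auto
      have summand: "x [^] Suc j \<otimes> (c j \<otimes> g) \<in> lin_span R C ?m ?I" if j: "j < n" for j
      proof -
        have "c j \<otimes> g \<in> lin_span R C (\<lambda>g. g) G" using DG c j i by auto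
        then show ?thesis
        proof (rule span_mult[OF C.coeffs_axioms C.coeffs_axioms Gc G(1) mc, rotated 2])
          fix d h assume "d \<in> C" "h \<in> G"
          moreover have "x [^] Suc j \<otimes> (d \<otimes> h) = d \<otimes> (h \<otimes> x [^] Suc j)"
            using C.sub calculation gc xc by (auto simp: subset_iff m_ac)
          ultimately show "x [^] Suc j \<otimes> (d \<otimes> h) \<in> lin_span R C ?m ?I"
            using base[of d h "Suc j"] j by (simp only: Suc_leI)
        qed (use xc in simp)
      qed
      have s: "?s \<in> carrier R" using cc xc by auto
      have "x [^] n = \<ominus> ?s" using eq s xc by (simp add: minus_equality)
      then have "x \<otimes> ?m i = \<ominus> \<one> \<otimes> ((x \<otimes> g) \<otimes> ?s)"
        using g xc s by (simp add: i kn m_ac r_minus l_minus)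
      also have "(x \<otimes> g) \<otimes> ?s = (\<Oplus>j\<in>{..<n}. (x \<otimes> g) \<otimes> (c j \<otimes> x [^] j))"
        using g xc cc by (intro finsum_rdistr) auto
      also have "\<dots> = (\<Oplus>j\<in>{..<n}. x [^] Suc j \<otimes> (c j \<otimes> g))"
        using g xc cc by (intro finsum_cong') (auto simp: m_ac)
      finally show ?thesis
        using span_scale[OF C mc fin, of "\<ominus> \<one>" "\<Oplus>j\<in>{..<n}. x [^] Suc j \<otimes> (c j \<otimes> g)"]
          C.span_finsum[OF mc, of "{..<n}" "\<lambda>j. x [^] Suc j \<otimes> (c j \<otimes> g)"] summand
          subringE(3,5)[OF C] by simp
    qed
  qed
qed

section \<open>Submodules over noetherian rings\<close>

text \<open>\<open>B\<close> is regarded as an \<open>S\<close>-module through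
  \<open>\<phi>\<close>; all modules that occur are submodules of it and can be treated as
  subsets.\<close>

locale noetherian_action = S: noetherian_ring S + B: cring B
  for S :: "('s, 'm) ring_scheme" and B :: "('b, 'n) ring_scheme" +
  fixes \<phi>
  assumes hom: "\<phi> \<in> ring_hom S B"
begin

definition submod :: "'b set \<Rightarrow> bool" where
  "submod X \<longleftrightarrow> X \<subseteq> carrier B \<and> \<zero>\<^bsub>B\<^esub> \<in> X \<and> (\<forall>x\<in>X. \<forall>y\<in>X. x \<oplus>\<^bsub>B\<^esub> y \<in> X) \<and>
     (\<forall>s\<in>carrier S. \<forall>x\<in>X. \<phi> s \<otimes>\<^bsub>B\<^esub> x \<in> X)"

abbreviation spn :: "'b set \<Rightarrow> 'b set" where
  "spn G \<equiv> lin_span B (\<phi> ` carrier S) (\<lambda>g. g) G"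

interpretation ring_hom_ring S B \<phi>
  using hom by (intro ring_hom_ringI2 S.ring_axioms B.ring_axioms)

lemma img_subring: "subring (\<phi> ` carrier S) B"
  using img_is_subring[OF S.carrier_is_subring] .

sublocale img: coeffs B "\<phi> ` carrier S"
  by (rule B.subring_coeffs[OF img_subring])

lemma submod_minus:
  assumes "submod X" "x \<in> X" "y \<in> X" shows "x \<ominus>\<^bsub>B\<^esub> y \<in> X"
proof -
  have "\<phi> (\<ominus>\<^bsub>S\<^esub> \<one>\<^bsub>S\<^esub>) \<otimes>\<^bsub>B\<^esub> y \<in> X"
    using assms S.a_inv_closed[OF S.one_closed] unfolding submod_def by blast
  moreover have "\<phi> (\<ominus>\<^bsub>S\<^esub> \<one>\<^bsub>S\<^esub>) \<otimes>\<^bsub>B\<^esub> y = \<ominus>\<^bsub>B\<^esub> y"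
    using assms by (auto simp: submod_def B.l_minus subset_iff)
  ultimately show ?thesis using assms by (auto simp: submod_def B.minus_eq)
qed

lemma submod_spn:
  assumes "finite G" "G \<subseteq> carrier B" shows "submod (spn G)"
  unfolding submod_def
proof (intro conjI ballI)
  have g: "(\<lambda>g. g) \<in> G \<rightarrow> carrier B" using assms by auto
  show "spn G \<subseteq> carrier B" "\<zero>\<^bsub>B\<^esub> \<in> spn G" using img.span_sub[OF g] img.span_zero[OF g] by auto
  show "x \<oplus>\<^bsub>B\<^esub> y \<in> spn G" if "x \<in> spn G" "y \<in> spn G" for x y
    using img.span_add[OF g that] .
  show "\<phi> s \<otimes>\<^bsub>B\<^esub> x \<in> spn G" if "s \<in> carrier S" "x \<in> spn G" for s x
    using B.span_scale[OF img_subring g assms(1) _ that(2)] that by auto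
qed

lemma spn_minimal:
  assumes "finite G" "G \<subseteq> X" "submod X" shows "spn G \<subseteq> X"
  using assms by (intro img.span_minimal) (auto simp: submod_def)

lemma spn_incl:
  assumes "finite G" "G \<subseteq> carrier B" "g \<in> G" shows "g \<in> spn G"
  using img.span_base[of "\<lambda>g. g" G g "\<one>\<^bsub>B\<^esub>"] assms subringE(3)[OF img_subring]
  by (auto simp: subset_iff)

text \<open>The analogue of an ideal of leading coefficients: the coefficients at \<open>b\<close>
  of elements of \<open>X\<close>, read modulo \<open>M\<close>. It is stated for arbitrary
  \<open>X\<close> because it is applied both to a given submodule and to the candidate generated by
  finitely many elements.\<close>

lemma leading_ideal:
  assumes X: "submod X" and M: "submod M" and b: "b \<in> carrier B"
  shows "ideal {s \<in> carrier S. \<exists>x\<in>X. x \<ominus>\<^bsub>B\<^esub> \<phi> s \<otimes>\<^bsub>B\<^esub> b \<in> M} S"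
    (is "ideal ?I S")
proof -
  have Xc: "X \<subseteq> carrier B" and Mc: "M \<subseteq> carrier B" using X M by (auto simp: submod_def)
  have mult: "r \<otimes>\<^bsub>S\<^esub> s \<in> ?I \<and> s \<otimes>\<^bsub>S\<^esub> r \<in> ?I" if sr: "s \<in> ?I" "r \<in> carrier S" for s r
  proof -
    obtain x where x: "x \<in> X" "x \<ominus>\<^bsub>B\<^esub> \<phi> s \<otimes>\<^bsub>B\<^esub> b \<in> M" "s \<in> carrier S" using sr by auto
    then have "\<phi> r \<otimes>\<^bsub>B\<^esub> x \<in> X" "\<phi> r \<otimes>\<^bsub>B\<^esub> (x \<ominus>\<^bsub>B\<^esub> \<phi> s \<otimes>\<^bsub>B\<^esub> b) \<in> M"
      using X M sr by (auto simp: submod_def)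
    moreover have "\<phi> r \<otimes>\<^bsub>B\<^esub> (x \<ominus>\<^bsub>B\<^esub> \<phi> s \<otimes>\<^bsub>B\<^esub> b) = \<phi> r \<otimes>\<^bsub>B\<^esub> x \<ominus>\<^bsub>B\<^esub> \<phi> (r \<otimes>\<^bsub>S\<^esub> s) \<otimes>\<^bsub>B\<^esub> b"
      using x sr b Xc by (auto simp: subset_iff B.minus_eq B.r_distr B.r_minus B.m_assoc)
    moreover have "\<phi> (s \<otimes>\<^bsub>S\<^esub> r) = \<phi> (r \<otimes>\<^bsub>S\<^esub> s)"
      using x sr by (simp add: B.m_comm)
    ultimately show ?thesis using x sr by auto
  qed
  show ?thesis
  proof (rule idealI[OF S.ring_axioms])
    show "subgroup ?I (add_monoid S)"
    proof (rule S.add.subgroupI)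
      have "\<zero>\<^bsub>S\<^esub> \<in> ?I" using X M b by (auto simp: submod_def B.minus_eq intro!: bexI[of _ "\<zero>\<^bsub>B\<^esub>"])
      then show "?I \<noteq> {}" by blast
      show "\<ominus>\<^bsub>S\<^esub> s \<in> ?I" if "s \<in> ?I" for s
      proof -
        have "s \<in> carrier S" using that by auto
        then have "\<ominus>\<^bsub>S\<^esub> s = (\<ominus>\<^bsub>S\<^esub> \<one>\<^bsub>S\<^esub>) \<otimes>\<^bsub>S\<^esub> s"
          by (simp add: S.l_minus)
        then show ?thesis using mult[OF that, of "\<ominus>\<^bsub>S\<^esub> \<one>\<^bsub>S\<^esub>"] by simp
      qed
      show "s \<oplus>\<^bsub>S\<^esub> s' \<in> ?I" if ss: "s \<in> ?I" "s' \<in> ?I" for s s'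
      proof -
        obtain x x' where x: "x \<in> X" "x \<ominus>\<^bsub>B\<^esub> \<phi> s \<otimes>\<^bsub>B\<^esub> b \<in> M" "s \<in> carrier S"
          and x': "x' \<in> X" "x' \<ominus>\<^bsub>B\<^esub> \<phi> s' \<otimes>\<^bsub>B\<^esub> b \<in> M" "s' \<in> carrier S" using ss by auto
        then have "x \<oplus>\<^bsub>B\<^esub> x' \<in> X" "(x \<ominus>\<^bsub>B\<^esub> \<phi> s \<otimes>\<^bsub>B\<^esub> b) \<oplus>\<^bsub>B\<^esub> (x' \<ominus>\<^bsub>B\<^esub> \<phi> s' \<otimes>\<^bsub>B\<^esub> b) \<in> M"
          using X M by (auto simp: submod_def)
        moreover have "(x \<ominus>\<^bsub>B\<^esub> \<phi> s \<otimes>\<^bsub>B\<^esub> b) \<oplus>\<^bsub>B\<^esub> (x' \<ominus>\<^bsub>B\<^esub> \<phi> s' \<otimes>\<^bsub>B\<^esub> b)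
            = (x \<oplus>\<^bsub>B\<^esub> x') \<ominus>\<^bsub>B\<^esub> \<phi> (s \<oplus>\<^bsub>S\<^esub> s') \<otimes>\<^bsub>B\<^esub> b"
          using x x' b Xc by (auto simp: subset_iff B.minus_eq B.l_distr B.minus_add B.a_ac)
        ultimately show ?thesis using x x' by auto
      qed
    qed auto
  qed (use mult in auto)
qed

text \<open>Induction on the generators: lifts of generators of the ideal of coefficients at
  \<open>b\<close> correct an element of \<open>X\<close> until it falls into the span of the other
  generators, where the induction hypothesis applies.\<close>

lemma submodule_finitely_generated:
  assumes "finite G" "G \<subseteq> carrier B" "submod X" "X \<subseteq> spn G"
  shows "\<exists>Y. finite Y \<and> Y \<subseteq> X \<and> X \<subseteq> spn Y"
  using assms
proof (induction G arbitrary: X)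
  case empty
  then show ?case by (intro exI[of _ "{}"]) auto
next
  case (insert b G)
  have b: "b \<in> carrier B" and Gc: "G \<subseteq> carrier B" using insert.prems by auto
  have Xc: "X \<subseteq> carrier B" using insert.prems by (simp add: submod_def)
  note MG = submod_spn[OF insert.hyps(1) Gc]
  have MGc: "spn G \<subseteq> carrier B" using MG by (simp add: submod_def)
  define I where "I = {s \<in> carrier S. \<exists>x\<in>X. x \<ominus>\<^bsub>B\<^esub> \<phi> s \<otimes>\<^bsub>B\<^esub> b \<in> spn G}"
  have "ideal I S" unfolding I_def by (rule leading_ideal[OF insert.prems(2) MG b])
  then obtain P where P: "P \<subseteq> carrier S" "finite P" "I = Idl\<^bsub>S\<^esub> P"
    using S.finetely_gen by blast
  have "P \<subseteq> I" using S.genideal_self[OF P(1)] P(3) by simp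
  then have "\<forall>s\<in>P. \<exists>x\<in>X. x \<ominus>\<^bsub>B\<^esub> \<phi> s \<otimes>\<^bsub>B\<^esub> b \<in> spn G" unfolding I_def by blast
  then obtain x where x: "\<And>s. s \<in> P \<Longrightarrow> x s \<in> X"
    "\<And>s. s \<in> P \<Longrightarrow> x s \<ominus>\<^bsub>B\<^esub> \<phi> s \<otimes>\<^bsub>B\<^esub> b \<in> spn G" by metis
  have "submod (X \<inter> spn G)" using insert.prems(2) MG by (auto simp: submod_def)
  then obtain Y where Y: "finite Y" "Y \<subseteq> X \<inter> spn G" "X \<inter> spn G \<subseteq> spn Y"
    using insert.IH[OF Gc, of "X \<inter> spn G"] by auto
  define Z where "Z = Y \<union> x ` P"
  have Z: "finite Z" "Z \<subseteq> X" using Y P x by (auto simp: Z_def)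
  then have Zc: "Z \<subseteq> carrier B" using Xc by auto
  note MZ = submod_spn[OF Z(1) Zc]
  \<comment> \<open>Comparing two ideals avoids writing elements of \<open>I\<close> as combinations
    of \<open>P\<close>: \<open>J\<close> is an ideal that contains \<open>P\<close>, hence contains
    \<open>I\<close>.\<close>
  define J where "J = {s \<in> carrier S. \<exists>x\<in>spn Z. x \<ominus>\<^bsub>B\<^esub> \<phi> s \<otimes>\<^bsub>B\<^esub> b \<in> spn G}"
  have J: "ideal J S" unfolding J_def by (rule leading_ideal[OF MZ MG b])
  have "P \<subseteq> J"
    using x P(1) spn_incl[OF Z(1) Zc] unfolding J_def Z_def by blast
  then have IJ: "I \<subseteq> J" using S.genideal_minimal[OF J] P(3) by simp
  have "z \<in> spn Z" if z: "z \<in> X" for z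
  proof -
    obtain c where c: "c \<in> insert b G \<rightarrow> \<phi> ` carrier S"
      "z = (\<Oplus>\<^bsub>B\<^esub>i\<in>insert b G. c i \<otimes>\<^bsub>B\<^esub> i)"
      using z insert.prems(3) spanE[of z B "\<phi> ` carrier S" "\<lambda>g. g" "insert b G"] by blast
    obtain s where s: "s \<in> carrier S" "c b = \<phi> s" using c(1) by auto
    let ?m = "\<Oplus>\<^bsub>B\<^esub>i\<in>G. c i \<otimes>\<^bsub>B\<^esub> i"
    have m: "?m \<in> spn G" using c(1) by (intro spanI) auto
    have "c i \<in> carrier B" if "i \<in> insert b G" for i using c(1) that img.sub by blast
    then have "z = \<phi> s \<otimes>\<^bsub>B\<^esub> b \<oplus>\<^bsub>B\<^esub> ?m"
      unfolding c(2) s(2)[symmetric] using insert.hyps Gc b by (intro B.finsum_insert) auto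
    then have zm: "z \<ominus>\<^bsub>B\<^esub> \<phi> s \<otimes>\<^bsub>B\<^esub> b = ?m"
      using s b m MGc by (auto simp: B.minus_eq B.a_ac B.r_neg1 B.r_neg2)
    then have "z \<ominus>\<^bsub>B\<^esub> \<phi> s \<otimes>\<^bsub>B\<^esub> b \<in> spn G" using m by simp
    then have "s \<in> I" using s(1) z unfolding I_def by blast
    then have "s \<in> J" using IJ by blast
    then obtain y where y: "y \<in> spn Z" "y \<ominus>\<^bsub>B\<^esub> \<phi> s \<otimes>\<^bsub>B\<^esub> b \<in> spn G" unfolding J_def by blast
    have yX: "y \<in> X" using spn_minimal[OF Z insert.prems(2)] y by blast
    have car: "y \<in> carrier B" "z \<in> carrier B" "\<phi> s \<otimes>\<^bsub>B\<^esub> b \<in> carrier B"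
      using yX z Xc s b by auto
    have "(z \<ominus>\<^bsub>B\<^esub> \<phi> s \<otimes>\<^bsub>B\<^esub> b) \<ominus>\<^bsub>B\<^esub> (y \<ominus>\<^bsub>B\<^esub> \<phi> s \<otimes>\<^bsub>B\<^esub> b) \<in> spn G"
      using submod_minus[OF MG] y m zm by simp
    moreover have "(z \<ominus>\<^bsub>B\<^esub> \<phi> s \<otimes>\<^bsub>B\<^esub> b) \<ominus>\<^bsub>B\<^esub> (y \<ominus>\<^bsub>B\<^esub> \<phi> s \<otimes>\<^bsub>B\<^esub> b) = z \<ominus>\<^bsub>B\<^esub> y"
      using car by (simp add: B.minus_eq B.minus_add B.a_ac B.r_neg B.r_neg1 B.r_neg2)
    ultimately have "z \<ominus>\<^bsub>B\<^esub> y \<in> spn Y"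
      using submod_minus[OF insert.prems(2) z yX] Y by auto
    moreover have "spn Y \<subseteq> spn Z"
      using Zc Z(1) by (intro img.span_index_mono) (auto simp: Z_def)
    ultimately have "(z \<ominus>\<^bsub>B\<^esub> y) \<oplus>\<^bsub>B\<^esub> y \<in> spn Z" using MZ y by (auto simp: submod_def)
    moreover have "(z \<ominus>\<^bsub>B\<^esub> y) \<oplus>\<^bsub>B\<^esub> y = z"
      using car by (simp add: B.minus_eq B.a_assoc B.l_neg)
    ultimately show ?thesis by simp
  qed
  then show ?case using Z by blast
qed

end

section \<open>Rings with a topologically nilpotent unit\<close>

text \<open>A Tate ring is described by an open bounded subring \<open>L\<close> and a topologically nilpotent unit
  \<open>t \<in> L\<close>: the sets \<open>t\<^sup>n L\<close> form a basis of the neighbourhoods of zero. This turns statements about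
  the topology into algebra.\<close>

locale tate_lattice = cring A for A (structure) +
  fixes L t
  assumes lattice: "subring L A" and t_lattice: "t \<in> L" and t_unit: "t \<in> Units A"
    and absorb: "a \<in> carrier A \<Longrightarrow> \<exists>k::nat. t [^] k \<otimes> a \<in> L"
begin

definition nbhd :: "nat \<Rightarrow> 'a set" where
  "nbhd n = (\<lambda>c. t [^] n \<otimes> c) ` L"

lemma L_sub: "L \<subseteq> carrier A" and L_zero: "\<zero> \<in> L" and L_one: "\<one> \<in> L"
  and L_neg: "x \<in> L \<Longrightarrow> \<ominus> x \<in> L" and L_mult: "x \<in> L \<Longrightarrow> y \<in> L \<Longrightarrow> x \<otimes> y \<in> L"
  and L_add: "x \<in> L \<Longrightarrow> y \<in> L \<Longrightarrow> x \<oplus> y \<in> L"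
  using subringE[OF lattice] by auto

lemma L_closed: "x \<in> L \<Longrightarrow> x \<in> carrier A"
  using L_sub by auto

lemma t_closed [simp]: "t \<in> carrier A"
  using t_unit by auto

lemma t_pow_lattice: "t [^] (n::nat) \<in> L"
  by (induction n) (auto simp: L_one L_mult t_lattice)

lemma nbhdI: "c \<in> L \<Longrightarrow> t [^] n \<otimes> c \<in> nbhd n"
  by (auto simp: nbhd_def)

lemma nbhdE:
  assumes "x \<in> nbhd n" obtains c where "c \<in> L" "x = t [^] n \<otimes> c"
  using assms by (auto simp: nbhd_def)

lemma nbhd_closed: "x \<in> nbhd n \<Longrightarrow> x \<in> carrier A"
  by (auto simp: nbhd_def L_closed)

lemma nbhd_zero: "\<zero> \<in> nbhd n"
  using nbhdI[OF L_zero] by simp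

lemma nbhd_add: "x \<in> nbhd n \<Longrightarrow> y \<in> nbhd n \<Longrightarrow> x \<oplus> y \<in> nbhd n"
  by (elim nbhdE) (simp add: r_distr[symmetric] L_closed nbhdI L_add)

lemma nbhd_neg: "x \<in> nbhd n \<Longrightarrow> \<ominus> x \<in> nbhd n"
  by (elim nbhdE) (simp add: r_minus[symmetric] L_closed nbhdI L_neg)

lemma nbhd_minus: "x \<in> nbhd n \<Longrightarrow> y \<in> nbhd n \<Longrightarrow> x \<ominus> y \<in> nbhd n"
  by (simp add: minus_eq nbhd_add nbhd_neg)

lemma nbhd_minus_swap:
  assumes "x \<ominus> y \<in> nbhd n" "x \<in> carrier A" "y \<in> carrier A" shows "y \<ominus> x \<in> nbhd n"
proof -
  have "y \<ominus> x = \<ominus> (x \<ominus> y)" using assms by (simp add: minus_eq minus_add a_comm)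
  then show ?thesis using nbhd_neg assms by simp
qed

lemma nbhd_minus_trans:
  assumes "x \<ominus> y \<in> nbhd n" "y \<ominus> z \<in> nbhd n" "x \<in> carrier A" "y \<in> carrier A" "z \<in> carrier A"
  shows "x \<ominus> z \<in> nbhd n"
proof -
  have "x \<ominus> z = (x \<ominus> y) \<oplus> (y \<ominus> z)"
    using assms(3-) by (simp add: minus_eq a_assoc r_neg1)
  then show ?thesis using nbhd_add assms by simp
qed

lemma nbhd_mult: "x \<in> nbhd m \<Longrightarrow> y \<in> nbhd n \<Longrightarrow> x \<otimes> y \<in> nbhd (m + n)"
proof (elim nbhdE)
  fix c d assume "c \<in> L" "d \<in> L" "x = t [^] m \<otimes> c" "y = t [^] n \<otimes> d"
  then have "x \<otimes> y = t [^] (m + n) \<otimes> (c \<otimes> d)"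
    by (simp add: L_closed nat_pow_mult[symmetric] m_ac)
  then show "x \<otimes> y \<in> nbhd (m + n)" using nbhdI L_mult \<open>c \<in> L\<close> \<open>d \<in> L\<close> by simp
qed

lemma nbhd_0: "nbhd 0 = L"
  by (auto simp: nbhd_def L_closed)

lemma nbhd_antimono: "m \<le> n \<Longrightarrow> nbhd n \<subseteq> nbhd m"
proof
  fix x assume "m \<le> n" "x \<in> nbhd n"
  then obtain c where c: "c \<in> L" "x = t [^] n \<otimes> c" by (auto elim: nbhdE)
  then have "x = t [^] m \<otimes> (t [^] (n - m) \<otimes> c)"
    using \<open>m \<le> n\<close> by (simp add: L_closed m_assoc[symmetric] nat_pow_mult)
  then show "x \<in> nbhd m" using nbhdI L_mult c t_pow_lattice by simp
qed

lemma nbhd_subset_L: "nbhd n \<subseteq> L"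
  using nbhd_antimono[of 0 n] by (simp add: nbhd_0)

lemma nbhd_scale: "c \<in> L \<Longrightarrow> x \<in> nbhd n \<Longrightarrow> c \<otimes> x \<in> nbhd n"
  using nbhd_mult[of c 0 x n] by (simp add: nbhd_0)

lemma t_pow_unit: "t [^] (n::nat) \<in> Units A"
  using t_unit by (induction n) auto

lemma t_pow_cancel:
  assumes "t [^] (n::nat) \<otimes> x = t [^] n \<otimes> y" "x \<in> carrier A" "y \<in> carrier A"
  shows "x = y"
  using assms t_pow_unit[of n] Units_l_cancel by blast

lemma nbhd_unshift:
  assumes "t [^] k \<otimes> x \<in> nbhd (k + n)" "x \<in> carrier A" shows "x \<in> nbhd n"
proof -
  obtain c where c: "c \<in> L" "t [^] k \<otimes> x = t [^] (k + n) \<otimes> c" using assms by (auto elim: nbhdE)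
  then have "t [^] k \<otimes> x = t [^] k \<otimes> (t [^] n \<otimes> c)"
    by (simp add: L_closed m_assoc nat_pow_mult[symmetric])
  then have "x = t [^] n \<otimes> c" using t_pow_cancel assms c L_closed by simp
  then show ?thesis using nbhdI c by simp
qed

text \<open>The shift \<open>k\<close> depends on \<open>a\<close> but not on \<open>n\<close>; this
  uniform continuity is what the density argument for evaluations requires.\<close>

lemma absorb_nbhd:
  assumes "a \<in> carrier A" shows "\<exists>k. \<forall>n. \<forall>x\<in>nbhd (k + n). a \<otimes> x \<in> nbhd n"
proof -
  obtain k :: nat where k: "t [^] k \<otimes> a \<in> L" using absorb assms by blast
  have "a \<otimes> x \<in> nbhd n" if x: "x \<in> nbhd (k + n)" for n x
  proof -
    obtain c where c: "c \<in> L" "x = t [^] (k + n) \<otimes> c" using x by (rule nbhdE)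
    then have "a \<otimes> x = t [^] n \<otimes> ((t [^] k \<otimes> a) \<otimes> c)"
      using assms L_closed by (simp add: nat_pow_mult[symmetric] m_ac)
    then show ?thesis using nbhdI L_mult k c by simp
  qed
  then show ?thesis by blast
qed

lemma finsum_nbhd:
  assumes "finite I" "\<And>i. i \<in> I \<Longrightarrow> x i \<in> nbhd n"
  shows "(\<Oplus>i\<in>I. x i) \<in> nbhd n"
  using assms
proof (induction I)
  case (insert j I)
  then have "(\<Oplus>i\<in>insert j I. x i) = x j \<oplus> (\<Oplus>i\<in>I. x i)"
    using nbhd_closed by (intro finsum_insert) auto
  then show ?case using insert nbhd_add by simp
qed (simp add: nbhd_zero)

end

text \<open>Completeness is asked only for sequences whose increments lie in \<open>nbhd n\<close>,
  and the limit approximates the \<open>n\<close>-th term to the same precision; nothing is lost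
  because \<open>nbhd n\<close> is an additive subgroup. No topology is mentioned, so the notion is
  purely algebraic.\<close>

locale complete_tate_lattice = tate_lattice +
  assumes separated: "a \<in> carrier A \<Longrightarrow> (\<And>n. a \<in> nbhd n) \<Longrightarrow> a = \<zero>"
    and complete: "(\<And>n::nat. s n \<in> carrier A) \<Longrightarrow> (\<And>n. s (Suc n) \<ominus> s n \<in> nbhd n) \<Longrightarrow>
      \<exists>y\<in>carrier A. \<forall>n. y \<ominus> s n \<in> nbhd n"
begin

lemma separated_eq:
  assumes "a \<in> carrier A" "b \<in> carrier A" "\<And>n. a \<ominus> b \<in> nbhd n" shows "a = b"
  using separated[of "a \<ominus> b"] assms by (simp add: r_right_minus_eq)

end

locale topological_tate_lattice = complete_tate_lattice A L t
  for A :: "'a huber_pair" (structure) and L t +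
  assumes open_iff: "openin (topo A) U \<longleftrightarrow>
    U \<subseteq> carrier A \<and> (\<forall>x\<in>U. \<exists>n. \<forall>y\<in>nbhd n. x \<oplus> y \<in> U)"
begin

lemma open_nbhd: "openin (topo A) (nbhd n)"
  unfolding open_iff using nbhd_closed nbhd_add by blast

lemma open_contains_nbhd:
  assumes "openin (topo A) U" "\<zero> \<in> U" shows "\<exists>n. nbhd n \<subseteq> U"
proof -
  obtain n where n: "\<forall>y\<in>nbhd n. \<zero> \<oplus> y \<in> U" using assms open_iff by blast
  have "y \<in> U" if "y \<in> nbhd n" for y
    using bspec[OF n that] nbhd_closed[OF that] by simp
  then show ?thesis by blast
qed

lemma restricted_series_iff:
  "f \<in> restricted_series n A \<longleftrightarrow> (\<forall>\<nu>. f \<nu> \<in> carrier A) \<and>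
     (\<forall>\<nu>. \<not> Poly_Mapping.keys \<nu> \<subseteq> {..<n} \<longrightarrow> f \<nu> = \<zero>) \<and>
     (\<forall>k. finite {\<nu>. f \<nu> \<notin> nbhd k})"
proof -
  have "(\<forall>U. openin (topo A) U \<and> \<zero> \<in> U \<longrightarrow> finite {\<nu>. f \<nu> \<notin> U}) \<longleftrightarrow>
      (\<forall>k. finite {\<nu>. f \<nu> \<notin> nbhd k})" (is "?l \<longleftrightarrow> ?r")
  proof
    assume ?l then show ?r using open_nbhd nbhd_zero by blast
  next
    assume r: ?r
    show ?l
    proof (intro allI impI)
      fix U assume "openin (topo A) U \<and> \<zero> \<in> U"
      then obtain k where "nbhd k \<subseteq> U" using open_contains_nbhd by blast
      then have "{\<nu>. f \<nu> \<notin> U} \<subseteq> {\<nu>. f \<nu> \<notin> nbhd k}" by blast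
      then show "finite {\<nu>. f \<nu> \<notin> U}" using r finite_subset by blast
    qed
  qed
  then show ?thesis unfolding restricted_series_def by (simp add: image_subset_iff)
qed

lemma series_open_iff:
  "series_open n A W \<longleftrightarrow> W \<subseteq> restricted_series n A \<and>
     (\<forall>f\<in>W. \<exists>k. \<forall>g\<in>restricted_series n A. range g \<subseteq> nbhd k \<longrightarrow> (\<lambda>\<nu>. f \<nu> \<oplus> g \<nu>) \<in> W)"
proof -
  have "(\<exists>U. openin (topo A) U \<and> \<zero> \<in> U \<and>
        (\<forall>g\<in>restricted_series n A. range g \<subseteq> U \<longrightarrow> (\<lambda>\<nu>. f \<nu> \<oplus> g \<nu>) \<in> W)) \<longleftrightarrow>
      (\<exists>k. \<forall>g\<in>restricted_series n A. range g \<subseteq> nbhd k \<longrightarrow> (\<lambda>\<nu>. f \<nu> \<oplus> g \<nu>) \<in> W)" (is "?l \<longleftrightarrow> ?r") for f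
  proof
    assume ?l
    then obtain U where U: "openin (topo A) U" "\<zero> \<in> U"
      "\<forall>g\<in>restricted_series n A. range g \<subseteq> U \<longrightarrow> (\<lambda>\<nu>. f \<nu> \<oplus> g \<nu>) \<in> W" by blast
    obtain k where "nbhd k \<subseteq> U" using open_contains_nbhd U by blast
    then show ?r using U(3) by (meson subset_trans)
  next
    assume ?r then show ?l using open_nbhd nbhd_zero by blast
  qed
  then show ?thesis unfolding series_open_def by simp
qed

end

section \<open>Restricted power series\<close>

text \<open>A summand of \<open>\<nu>\<close> vanishes outside the keys of \<open>\<nu>\<close> and
  is bounded by its total degree. The finiteness makes the coefficients of a product genuine finite
  sums.\<close>

lemma finite_antidiagonal: "finite {(\<mu>, \<kappa>). \<mu> + \<kappa> = (\<nu> :: nat \<Rightarrow>\<^sub>0 nat)}"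
proof -
  let ?K = "Poly_Mapping.keys \<nu>"
  let ?B = "{f. \<exists>M. (\<forall>i. i \<in> ?K \<longrightarrow> f i \<in> {..M}) \<and> (\<forall>i. i \<notin> ?K \<longrightarrow> f i = (0::nat)) \<and>
    M = (\<Sum>i\<in>?K. Poly_Mapping.lookup \<nu> i)}"
  have fin: "finite ?B"
    using finite_set_of_finite_funs[of ?K "{..(\<Sum>i\<in>?K. Poly_Mapping.lookup \<nu> i)}" 0]
    by (simp add: all_conj_distrib)
  have le: "Poly_Mapping.lookup \<mu> \<in> ?B" if le: "\<And>i. Poly_Mapping.lookup \<mu> i \<le> Poly_Mapping.lookup \<nu> i" for \<mu>
  proof -
    have "Poly_Mapping.lookup \<mu> i \<le> (\<Sum>i\<in>?K. Poly_Mapping.lookup \<nu> i)" if "i \<in> ?K" for i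
      using le[of i] member_le_sum[OF that, of "Poly_Mapping.lookup \<nu>"] by simp
    moreover have "Poly_Mapping.lookup \<mu> i = 0" if "i \<notin> ?K" for i
      using le[of i] that by (simp add: in_keys_iff)
    ultimately show ?thesis by auto
  qed
  define M where "M = {\<mu>. Poly_Mapping.lookup \<mu> \<in> ?B}"
  have "finite M" unfolding M_def
    using finite_vimageI[OF fin, of Poly_Mapping.lookup]
    by (simp add: vimage_def inj_on_def lookup_inject)
  moreover have "{(\<mu>, \<kappa>). \<mu> + \<kappa> = \<nu>} \<subseteq> M \<times> M"
  proof
    fix p assume "p \<in> {(\<mu>, \<kappa>). \<mu> + \<kappa> = \<nu>}"
    then obtain \<mu> \<kappa> where p: "p = (\<mu>, \<kappa>)" "\<nu> = \<mu> + \<kappa>" by auto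
    then have "\<And>i. Poly_Mapping.lookup \<mu> i \<le> Poly_Mapping.lookup \<nu> i"
      "\<And>i. Poly_Mapping.lookup \<kappa> i \<le> Poly_Mapping.lookup \<nu> i" by (simp_all add: lookup_add)
    then show "p \<in> M \<times> M" unfolding M_def p(1) by (intro SigmaI CollectI le)
  qed
  ultimately show ?thesis using finite_subset[OF _ finite_cartesian_product] by blast
qed

definition mono_series :: "('a, 'm) ring_scheme \<Rightarrow> (nat \<Rightarrow>\<^sub>0 nat) \<Rightarrow> 'a \<Rightarrow> (nat \<Rightarrow>\<^sub>0 nat) \<Rightarrow> 'a" where
  "mono_series A \<kappa> c = (\<lambda>\<nu>. if \<nu> = \<kappa> then c else \<zero>\<^bsub>A\<^esub>)"

lemma const_series_eq_mono: "const_series A c = mono_series A 0 c"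
  by (simp add: const_series_def mono_series_def)

text \<open>That the series form a ring is supplied by strong noetherianness and therefore appears
  as an assumption; commutativity and the lattice structure are derived.\<close>

locale tate_series = R: topological_tate_lattice R L t for R :: "'r huber_pair" (structure) and L t +
  fixes n :: nat
  assumes ring_series: "ring (tate_algebra n R)"
begin

abbreviation "S \<equiv> tate_algebra n R"

lemma carrier_S: "carrier S = restricted_series n R"
  and mult_S: "(f \<otimes>\<^bsub>S\<^esub> g) = (\<lambda>\<nu>. \<Oplus>p\<in>{(\<mu>, \<kappa>). \<mu> + \<kappa> = \<nu>}. f (fst p) \<otimes> g (snd p))"
  and one_S: "\<one>\<^bsub>S\<^esub> = const_series R \<one>"
  and zero_S: "\<zero>\<^bsub>S\<^esub> = (\<lambda>\<nu>. \<zero>)"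
  and add_S: "(f \<oplus>\<^bsub>S\<^esub> g) = (\<lambda>\<nu>. f \<nu> \<oplus> g \<nu>)"
  by (simp_all add: tate_algebra_def)

lemma coeff_closed: "f \<in> carrier S \<Longrightarrow> f \<nu> \<in> carrier R"
  by (simp add: carrier_S R.restricted_series_iff)

lemma cring_S: "cring S"
proof -
  interpret S: ring S by (rule ring_series)
  have "f \<otimes>\<^bsub>S\<^esub> g = g \<otimes>\<^bsub>S\<^esub> f" if f: "f \<in> carrier S" and g: "g \<in> carrier S" for f g
  proof
    fix \<nu> :: "nat \<Rightarrow>\<^sub>0 nat"
    let ?D = "{(\<mu>, \<kappa>). \<mu> + \<kappa> = \<nu>}"
    have D: "?D = prod.swap ` ?D" by (auto simp: image_iff) (simp_all add: add.commute)
    have "(f \<otimes>\<^bsub>S\<^esub> g) \<nu> = (\<Oplus>p\<in>prod.swap ` ?D. f (fst p) \<otimes> g (snd p))"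
      unfolding mult_S using D by simp
    also have "\<dots> = (\<Oplus>p\<in>?D. f (fst (prod.swap p)) \<otimes> g (snd (prod.swap p)))"
      using coeff_closed f g by (intro R.finsum_reindex) auto
    also have "\<dots> = (g \<otimes>\<^bsub>S\<^esub> f) \<nu>"
      unfolding mult_S using coeff_closed f g by (intro R.finsum_cong') (auto simp: R.m_comm)
    finally show "(f \<otimes>\<^bsub>S\<^esub> g) \<nu> = (g \<otimes>\<^bsub>S\<^esub> f) \<nu>" .
  qed
  then show ?thesis by unfold_locales
qed

sublocale S: cring S by (rule cring_S)

lemma uminus_S: "f \<in> carrier S \<Longrightarrow> \<ominus>\<^bsub>S\<^esub> f = (\<lambda>\<nu>. \<ominus> f \<nu>)"
proof (rule S.minus_equality)
  assume f: "f \<in> carrier S"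
  show "(\<lambda>\<nu>. \<ominus> f \<nu>) \<oplus>\<^bsub>S\<^esub> f = \<zero>\<^bsub>S\<^esub>"
    using coeff_closed[OF f] by (simp add: add_S zero_S R.l_neg)
  have "{\<nu>. \<ominus> f \<nu> \<notin> R.nbhd k} \<subseteq> {\<nu>. f \<nu> \<notin> R.nbhd k}" for k
    using R.nbhd_neg by auto
  then show "(\<lambda>\<nu>. \<ominus> f \<nu>) \<in> carrier S"
    using f unfolding carrier_S R.restricted_series_iff
    by (intro conjI allI impI) (simp, simp, blast intro: finite_subset)
qed

lemma minus_S: "f \<in> carrier S \<Longrightarrow> g \<in> carrier S \<Longrightarrow> f \<ominus>\<^bsub>S\<^esub> g = (\<lambda>\<nu>. f \<nu> \<ominus> g \<nu>)"
  by (simp add: S.minus_eq uminus_S add_S R.minus_eq)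

definition series_in :: "'r set \<Rightarrow> ((nat \<Rightarrow>\<^sub>0 nat) \<Rightarrow> 'r) set" where
  "series_in P = {f \<in> carrier S. range f \<subseteq> P}"

lemma const_closed: "c \<in> carrier R \<Longrightarrow> const_series R c \<in> carrier S"
  and mono_closed: "c \<in> carrier R \<Longrightarrow> Poly_Mapping.keys \<kappa> \<subseteq> {..<n} \<Longrightarrow> mono_series R \<kappa> c \<in> carrier S"
proof -
  show *: "mono_series R \<kappa> c \<in> carrier S"
    if "c \<in> carrier R" "Poly_Mapping.keys \<kappa> \<subseteq> {..<n}" for c \<kappa>
  proof -
    have "{\<nu>. mono_series R \<kappa> c \<nu> \<notin> R.nbhd k} \<subseteq> {\<kappa>}" for k
      using R.nbhd_zero by (auto simp: mono_series_def)
    then have "finite {\<nu>. mono_series R \<kappa> c \<nu> \<notin> R.nbhd k}" for k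
      by (rule finite_subset) simp
    then show ?thesis using that
      unfolding carrier_S R.restricted_series_iff by (auto simp: mono_series_def)
  qed
  show "const_series R c \<in> carrier S" if "c \<in> carrier R"
    using *[OF that, of 0] by (simp add: const_series_eq_mono)
qed

lemma subring_series_in:
  assumes P: "subring P R" shows "subring (series_in P) S"
proof (rule S.subringI)
  interpret P: coeffs R P by (rule R.subring_coeffs[OF P])
  show "series_in P \<subseteq> carrier S" by (auto simp: series_in_def)
  have "range (const_series R \<one>) \<subseteq> P"
    using subringE(2,3)[OF P] by (auto simp: const_series_def)
  then show "\<one>\<^bsub>S\<^esub> \<in> series_in P"
    using const_closed[OF R.one_closed] by (simp add: series_in_def one_S)
  show "\<ominus>\<^bsub>S\<^esub> f \<in> series_in P" if "f \<in> series_in P" for f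
    using that subringE(5)[OF P] S.a_inv_closed[of f] by (auto simp: series_in_def uminus_S)
  show "f \<oplus>\<^bsub>S\<^esub> g \<in> series_in P" if "f \<in> series_in P" "g \<in> series_in P" for f g
    using that subringE(7)[OF P] S.add.m_closed[of f g] unfolding series_in_def
    by (auto simp: add_S image_subset_iff)
  show "f \<otimes>\<^bsub>S\<^esub> g \<in> series_in P" if fg: "f \<in> series_in P" "g \<in> series_in P" for f g
  proof -
    have "(f \<otimes>\<^bsub>S\<^esub> g) \<nu> \<in> P" for \<nu>
    proof -
      have "(\<Oplus>p\<in>{(\<mu>, \<kappa>). \<mu> + \<kappa> = \<nu>}. f (fst p) \<otimes> g (snd p)) \<in> lin_span R P (\<lambda>p. g (snd p)) {(\<mu>, \<kappa>). \<mu> + \<kappa> = \<nu>}"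
        using fg by (intro spanI) (auto simp: series_in_def)
      moreover have "lin_span R P (\<lambda>p. g (snd p)) {(\<mu>, \<kappa>). \<mu> + \<kappa> = \<nu>} \<subseteq> P"
        using fg subringE[OF P] finite_antidiagonal
        by (intro P.span_minimal) (auto simp: series_in_def coeff_closed image_subset_iff)
      ultimately show ?thesis by (auto simp: mult_S)
    qed
    then show ?thesis using fg by (auto simp: series_in_def)
  qed
qed

lemma mono_mult_coeff:
  assumes "c \<in> carrier R" "f \<in> carrier S"
  shows "(mono_series R \<kappa> c \<otimes>\<^bsub>S\<^esub> f) (\<kappa> + \<rho>) = c \<otimes> f \<rho>"
    and "\<nexists>\<rho>. \<nu> = \<kappa> + \<rho> \<Longrightarrow> (mono_series R \<kappa> c \<otimes>\<^bsub>S\<^esub> f) \<nu> = \<zero>"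
proof -
  let ?D = "\<lambda>\<nu>. {(\<mu>, \<kappa>). \<mu> + \<kappa> = \<nu>}"
  have "(mono_series R \<kappa> c \<otimes>\<^bsub>S\<^esub> f) (\<kappa> + \<rho>)
      = (\<Oplus>p\<in>?D (\<kappa> + \<rho>). if (\<kappa>, \<rho>) = p then c \<otimes> f (snd p) else \<zero>)"
    unfolding mult_S using assms coeff_closed
    by (intro R.finsum_cong') (auto simp: mono_series_def)
  also have "\<dots> = c \<otimes> f \<rho>"
    using R.finsum_singleton[of "(\<kappa>, \<rho>)" "?D (\<kappa> + \<rho>)" "\<lambda>p. c \<otimes> f (snd p)"]
      assms coeff_closed finite_antidiagonal by auto
  finally show "(mono_series R \<kappa> c \<otimes>\<^bsub>S\<^esub> f) (\<kappa> + \<rho>) = c \<otimes> f \<rho>" .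
  assume "\<nexists>\<rho>. \<nu> = \<kappa> + \<rho>"
  then have "(mono_series R \<kappa> c \<otimes>\<^bsub>S\<^esub> f) \<nu> = (\<Oplus>p\<in>?D \<nu>. \<zero>)"
    unfolding mult_S using assms coeff_closed
    by (intro R.finsum_cong') (auto simp: mono_series_def)
  then show "(mono_series R \<kappa> c \<otimes>\<^bsub>S\<^esub> f) \<nu> = \<zero>" by simp
qed

lemma const_mult: "c \<in> carrier R \<Longrightarrow> f \<in> carrier S \<Longrightarrow> const_series R c \<otimes>\<^bsub>S\<^esub> f = (\<lambda>\<nu>. c \<otimes> f \<nu>)"
  using mono_mult_coeff(1)[of c f 0] by (auto simp: const_series_eq_mono)

lemma mono_mult:
  assumes "c \<in> carrier R" "d \<in> carrier R" "Poly_Mapping.keys \<rho> \<subseteq> {..<n}"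
  shows "mono_series R \<kappa> c \<otimes>\<^bsub>S\<^esub> mono_series R \<rho> d = mono_series R (\<kappa> + \<rho>) (c \<otimes> d)"
proof
  fix \<nu>
  show "(mono_series R \<kappa> c \<otimes>\<^bsub>S\<^esub> mono_series R \<rho> d) \<nu> = mono_series R (\<kappa> + \<rho>) (c \<otimes> d) \<nu>"
  proof (cases "\<exists>\<rho>'. \<nu> = \<kappa> + \<rho>'")
    case True
    then obtain \<rho>' where "\<nu> = \<kappa> + \<rho>'" by blast
    then show ?thesis
      using mono_mult_coeff(1)[OF assms(1) mono_closed[OF assms(2,3)], of \<kappa> \<rho>'] assms
      by (simp add: mono_series_def)
  next
    case False
    then show ?thesis
      using mono_mult_coeff(2)[OF assms(1) mono_closed[OF assms(2,3)], of \<nu> \<kappa>]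
      by (auto simp: mono_series_def)
  qed
qed

lemma const_hom: "const_series R \<in> ring_hom R S"
proof (rule ring_hom_memI)
  show "const_series R (x \<otimes> y) = const_series R x \<otimes>\<^bsub>S\<^esub> const_series R y"
    if "x \<in> carrier R" "y \<in> carrier R" for x y
    using mono_mult[OF that, of 0 0] by (simp add: const_series_eq_mono)
qed (auto simp: const_closed one_S add_S, auto simp: const_series_def)

lemma const_pow: "c \<in> carrier R \<Longrightarrow> const_series R c [^]\<^bsub>S\<^esub> (k::nat) = const_series R (c [^] k)"
proof -
  assume "c \<in> carrier R"
  interpret ring_hom_ring R S "const_series R"
    using const_hom by (intro ring_hom_ringI2 R.ring_axioms S.ring_axioms)
  show ?thesis using hom_nat_pow[OF \<open>c \<in> carrier R\<close>] by simp
qed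

lemma t_pow_mult: "f \<in> carrier S \<Longrightarrow> const_series R t [^]\<^bsub>S\<^esub> (k::nat) \<otimes>\<^bsub>S\<^esub> f = (\<lambda>\<nu>. t [^] k \<otimes> f \<nu>)"
  by (simp add: const_pow const_mult)

text \<open>Dividing all coefficients by \<open>t [^] k\<close> preserves convergence to zero,
  because it only shifts the precision by \<open>k\<close>. Hence the lattice neighbourhoods of the
  series ring are the ones that define its topology.\<close>

lemma series_nbhd:
  "(\<lambda>f. const_series R t [^]\<^bsub>S\<^esub> (k::nat) \<otimes>\<^bsub>S\<^esub> f) ` series_in L = series_in (R.nbhd k)" (is "?l = ?r")
proof
  show "?l \<subseteq> ?r"
  proof
    fix h assume "h \<in> ?l"
    then obtain f where f: "f \<in> carrier S" "range f \<subseteq> L" "h = const_series R t [^]\<^bsub>S\<^esub> k \<otimes>\<^bsub>S\<^esub> f"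
      by (auto simp: series_in_def)
    then have "h \<in> carrier S" by (simp add: const_closed)
    moreover have "range h \<subseteq> R.nbhd k" using f by (auto simp: t_pow_mult R.nbhdI)
    ultimately show "h \<in> ?r" by (simp add: series_in_def)
  qed
  show "?r \<subseteq> ?l"
  proof
    fix h assume h: "h \<in> ?r"
    then have "\<forall>\<nu>. \<exists>c\<in>L. h \<nu> = t [^] k \<otimes> c"
      unfolding series_in_def by (auto elim!: R.nbhdE dest!: subsetD[OF _ rangeI])
    then obtain f where f: "\<And>\<nu>. f \<nu> \<in> L" "\<And>\<nu>. h \<nu> = t [^] k \<otimes> f \<nu>" by metis
    have "f \<in> carrier S"
      unfolding carrier_S R.restricted_series_iff
    proof (intro conjI allI impI)
      show "f \<nu> \<in> carrier R" for \<nu> using f R.L_closed by blast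
      show "f \<nu> = \<zero>" if "\<not> Poly_Mapping.keys \<nu> \<subseteq> {..<n}" for \<nu>
      proof (rule R.t_pow_cancel[of k])
        have "h \<nu> = \<zero>" using h that by (auto simp: series_in_def carrier_S R.restricted_series_iff)
        then show "t [^] k \<otimes> f \<nu> = t [^] k \<otimes> \<zero>" using f by simp
      qed (use f R.L_closed in auto)
      fix j
      have "{\<nu>. f \<nu> \<notin> R.nbhd j} \<subseteq> {\<nu>. h \<nu> \<notin> R.nbhd (k + j)}"
        using f R.nbhd_unshift R.L_closed by auto
      moreover have "finite {\<nu>. h \<nu> \<notin> R.nbhd (k + j)}"
        using h by (auto simp: series_in_def carrier_S R.restricted_series_iff)
      ultimately show "finite {\<nu>. f \<nu> \<notin> R.nbhd j}" by (rule finite_subset)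
    qed
    moreover have "h = const_series R t [^]\<^bsub>S\<^esub> k \<otimes>\<^bsub>S\<^esub> f"
      using t_pow_mult[OF calculation] f by auto
    ultimately show "h \<in> ?l" using f by (auto simp: series_in_def)
  qed
qed

text \<open>Absorption is where restrictedness enters: all but finitely many coefficients already
  lie in \<open>L\<close>, and one power of \<open>t\<close> serves for the rest.\<close>

lemma tate_lattice_S: "tate_lattice S (series_in L) (const_series R t)"
proof (intro tate_lattice.intro tate_lattice_axioms.intro)
  show "cring S" by (rule cring_S)
  show "subring (series_in L) S" by (rule subring_series_in[OF R.lattice])
  show "const_series R t \<in> series_in L"
    using R.L_zero R.t_lattice const_closed[OF R.t_closed] by (auto simp: series_in_def const_series_def)
  have inv: "inv t \<in> carrier R" "inv t \<otimes> t = \<one>" using R.t_unit by auto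
  have "const_series R (inv t) \<otimes>\<^bsub>S\<^esub> const_series R t = \<one>\<^bsub>S\<^esub>"
    using mono_mult[OF inv(1) R.t_closed, of 0 0] inv(2) by (simp add: const_series_eq_mono one_S)
  then show "const_series R t \<in> Units S"
    using S.m_comm const_closed[OF inv(1)] const_closed[OF R.t_closed]
    unfolding Units_def by fastforce
  fix f assume f: "f \<in> carrier S"
  have fin: "finite {\<nu>. f \<nu> \<notin> R.nbhd 0}" using f by (auto simp: carrier_S R.restricted_series_iff)
  have ex: "\<exists>k::nat. \<forall>\<nu>\<in>F. t [^] k \<otimes> f \<nu> \<in> L" if "finite F" for F
    using that
  proof (induction F)
    case (insert \<nu> F)
    then obtain k l :: nat where k: "\<forall>\<nu>\<in>F. t [^] k \<otimes> f \<nu> \<in> L" and l: "t [^] l \<otimes> f \<nu> \<in> L"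
      using R.absorb[OF coeff_closed[OF f]] by blast
    have "t [^] (k + l) \<otimes> f \<mu> \<in> L" if "\<mu> \<in> insert \<nu> F" for \<mu>
    proof -
      have "t [^] (k + l) \<otimes> f \<mu> = t [^] l \<otimes> (t [^] k \<otimes> f \<mu>)"
        "t [^] (k + l) \<otimes> f \<mu> = t [^] k \<otimes> (t [^] l \<otimes> f \<mu>)"
        using coeff_closed[OF f] by (auto simp: R.nat_pow_mult[symmetric] R.m_ac)
      then show ?thesis using that k l R.L_mult R.t_pow_lattice by (metis insertE)
    qed
    then show ?case by blast
  qed auto
  obtain k :: nat where k: "\<forall>\<nu>\<in>{\<nu>. f \<nu> \<notin> L}. t [^] k \<otimes> f \<nu> \<in> L"
    using ex[OF fin] unfolding R.nbhd_0 by blast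
  have "t [^] k \<otimes> f \<nu> \<in> L" for \<nu>
    using k R.L_mult[OF R.t_pow_lattice] by blast
  then have "const_series R t [^]\<^bsub>S\<^esub> k \<otimes>\<^bsub>S\<^esub> f \<in> series_in L"
    using f S.m_closed[OF S.nat_pow_closed[OF const_closed[OF R.t_closed]] f, of k]
    unfolding series_in_def by (auto simp: t_pow_mult)
  then show "\<exists>k::nat. const_series R t [^]\<^bsub>S\<^esub> k \<otimes>\<^bsub>S\<^esub> f \<in> series_in L" by blast
qed

sublocale S: tate_lattice S "series_in L" "const_series R t" by (rule tate_lattice_S)

lemma S_nbhd: "S.nbhd k = series_in (R.nbhd k)"
  unfolding S.nbhd_def series_nbhd ..

text \<open>Limits are taken coefficientwise. The limit is again restricted: at precision
  \<open>k\<close> it agrees with the \<open>k\<close>-th series uniformly in the exponent, so its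
  large coefficients are among the finitely many large ones of that series.\<close>

sublocale S: topological_tate_lattice S "series_in L" "const_series R t"
proof
  fix f assume f: "f \<in> carrier S" "\<And>k. f \<in> S.nbhd k"
  have "f \<nu> \<in> R.nbhd k" for \<nu> k
    using f(2)[of k] unfolding S_nbhd by (auto simp: series_in_def)
  then have "f \<nu> = \<zero>" for \<nu>
    using R.separated[OF coeff_closed[OF f(1)]] by blast
  then show "f = \<zero>\<^bsub>S\<^esub>" by (auto simp: zero_S)
next
  fix s assume s: "\<And>k::nat. s k \<in> carrier S" "\<And>k. s (Suc k) \<ominus>\<^bsub>S\<^esub> s k \<in> S.nbhd k"
  have "\<exists>y\<in>carrier R. \<forall>k. y \<ominus> s k \<nu> \<in> R.nbhd k" for \<nu>
  proof (rule R.complete)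
    show "s (Suc k) \<nu> \<ominus> s k \<nu> \<in> R.nbhd k" for k
      using s(2)[of k] unfolding S_nbhd minus_S[OF s(1) s(1)] by (auto simp: series_in_def)
  qed (use s coeff_closed in auto)
  then obtain y where y: "\<And>\<nu>. y \<nu> \<in> carrier R" "\<And>\<nu> k. y \<nu> \<ominus> s k \<nu> \<in> R.nbhd k" by metis
  have sk: "y \<nu> \<in> R.nbhd k" if "s k \<nu> \<in> R.nbhd k" for \<nu> k
  proof -
    have "y \<nu> = (y \<nu> \<ominus> s k \<nu>) \<oplus> s k \<nu>"
      using y(1) coeff_closed[OF s(1)] by (simp add: R.minus_eq R.a_assoc R.l_neg)
    then show ?thesis using R.nbhd_add[OF y(2)[of \<nu> k] that] by simp
  qed
  have yS: "y \<in> carrier S"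
    unfolding carrier_S R.restricted_series_iff
  proof (intro conjI allI impI)
    show "y \<nu> = \<zero>" if "\<not> Poly_Mapping.keys \<nu> \<subseteq> {..<n}" for \<nu>
    proof (rule R.separated[OF y(1) sk])
      have "s k \<nu> = \<zero>" for k using s(1)[of k] that by (auto simp: carrier_S R.restricted_series_iff)
      then show "s k \<nu> \<in> R.nbhd k" for k using R.nbhd_zero by simp
    qed
    have "{\<nu>. y \<nu> \<notin> R.nbhd k} \<subseteq> {\<nu>. s k \<nu> \<notin> R.nbhd k}" for k using sk by blast
    moreover have "finite {\<nu>. s k \<nu> \<notin> R.nbhd k}" for k
      using s(1)[of k] by (auto simp: carrier_S R.restricted_series_iff)
    ultimately show "finite {\<nu>. y \<nu> \<notin> R.nbhd k}" for k using finite_subset by blast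
  qed (rule y)
  have "y \<ominus>\<^bsub>S\<^esub> s k \<in> S.nbhd k" for k
    using S.minus_closed[OF yS s(1)[of k]] y(2) unfolding S_nbhd
    by (auto simp: minus_S[OF yS s(1)] series_in_def)
  then show "\<exists>y\<in>carrier S. \<forall>k. y \<ominus>\<^bsub>S\<^esub> s k \<in> S.nbhd k" using yS by blast
next
  fix W
  show "openin (topo S) W \<longleftrightarrow> W \<subseteq> carrier S \<and> (\<forall>f\<in>W. \<exists>k. \<forall>g\<in>S.nbhd k. f \<oplus>\<^bsub>S\<^esub> g \<in> W)"
    unfolding openin_tate_algebra R.series_open_iff S_nbhd
    by (simp add: series_in_def carrier_S add_S Ball_def imp_conjL)
qed

end

context tate_series
begin

lemma mono_zero: "mono_series R \<kappa> \<zero> = \<zero>\<^bsub>S\<^esub>"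
  by (simp add: mono_series_def zero_S)

lemma finite_support_induct:
  assumes "finite F" "f \<in> carrier S" "\<And>\<nu>. \<nu> \<notin> F \<Longrightarrow> f \<nu> = \<zero>" "Q \<zero>\<^bsub>S\<^esub>"
    and add: "\<And>g h. g \<in> carrier S \<Longrightarrow> h \<in> carrier S \<Longrightarrow> Q g \<Longrightarrow> Q h \<Longrightarrow> Q (g \<oplus>\<^bsub>S\<^esub> h)"
    and "\<And>\<nu>. Poly_Mapping.keys \<nu> \<subseteq> {..<n} \<Longrightarrow> Q (mono_series R \<nu> (f \<nu>))"
  shows "Q f"
  using assms(1-3,6)
proof (induction F arbitrary: f)
  case empty
  then have "f = \<zero>\<^bsub>S\<^esub>" by (auto simp: zero_S)
  then show ?case using assms(4) by simp
next
  case (insert \<kappa> F)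
  show ?case
  proof (cases "Poly_Mapping.keys \<kappa> \<subseteq> {..<n}")
    case True
    let ?m = "mono_series R \<kappa> (f \<kappa>)" and ?g = "f(\<kappa> := \<zero>)"
    have m: "?m \<in> carrier S" using True insert.prems coeff_closed mono_closed by simp
    have "\<ominus> \<zero> = \<zero>" by simp
    then have g: "?g = f \<ominus>\<^bsub>S\<^esub> ?m"
      unfolding minus_S[OF insert.prems(1) m] using coeff_closed[OF insert.prems(1)]
      by (auto simp: mono_series_def fun_eq_iff R.minus_eq R.r_neg)
    have gS: "?g \<in> carrier S" unfolding g using S.minus_closed insert.prems m by simp
    have "Q ?g"
    proof (rule insert.IH[OF gS])
      show "Q (mono_series R \<nu> (?g \<nu>))" if "Poly_Mapping.keys \<nu> \<subseteq> {..<n}" for \<nu>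
        using insert.prems(3)[OF that] assms(4) by (auto simp: mono_zero)
    qed (use insert.prems in auto)
    then have "Q (?m \<oplus>\<^bsub>S\<^esub> ?g)" using add[OF m gS] insert.prems(3)[OF True] by simp
    moreover have "?m \<oplus>\<^bsub>S\<^esub> ?g = f"
      using coeff_closed[OF insert.prems(1)] by (auto simp: add_S mono_series_def fun_eq_iff)
    ultimately show ?thesis by simp
  next
    case False
    then have "f \<kappa> = \<zero>"
      using insert.prems(1) by (auto simp: carrier_S R.restricted_series_iff)
    then show ?thesis using insert.IH insert.prems by (metis insert_iff)
  qed
qed

text \<open>Only finitely many coefficients of \<open>f\<close> lie outside \<open>nbhd N\<close>;
  they form \<open>p\<close>. The property \<open>Q\<close> is asked only for the terms of
  \<open>f\<close> itself, so that it may depend on a subring containing the coefficients.\<close>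

lemma polynomial_approx:
  assumes f: "f \<in> carrier S" and "Q \<zero>\<^bsub>S\<^esub>"
    and "\<And>g h. g \<in> carrier S \<Longrightarrow> h \<in> carrier S \<Longrightarrow> Q g \<Longrightarrow> Q h \<Longrightarrow> Q (g \<oplus>\<^bsub>S\<^esub> h)"
    and "\<And>\<nu>. Poly_Mapping.keys \<nu> \<subseteq> {..<n} \<Longrightarrow> Q (mono_series R \<nu> (f \<nu>))"
  obtains p e where "p \<in> carrier S" "e \<in> S.nbhd N" "f = p \<oplus>\<^bsub>S\<^esub> e" "Q p"
proof -
  let ?p = "\<lambda>\<nu>. if f \<nu> \<in> R.nbhd N then \<zero> else f \<nu>"
  let ?e = "\<lambda>\<nu>. if f \<nu> \<in> R.nbhd N then f \<nu> else \<zero>"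
  have sub: "{\<nu>. ?p \<nu> \<notin> R.nbhd k} \<subseteq> {\<nu>. f \<nu> \<notin> R.nbhd k}" "{\<nu>. ?e \<nu> \<notin> R.nbhd k} \<subseteq> {\<nu>. f \<nu> \<notin> R.nbhd k}" for k
    using R.nbhd_zero by auto
  have fin: "finite {\<nu>. f \<nu> \<notin> R.nbhd k}" for k
    using f by (simp add: carrier_S R.restricted_series_iff)
  note sub[THEN finite_subset[OF _ fin]]
  then have p: "?p \<in> carrier S" and e: "?e \<in> carrier S"
    using f unfolding carrier_S R.restricted_series_iff by auto
  have "Q ?p"
  proof (rule finite_support_induct[of "{\<nu>. f \<nu> \<notin> R.nbhd N}"])
    show "finite {\<nu>. f \<nu> \<notin> R.nbhd N}" using f by (simp add: carrier_S R.restricted_series_iff)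
    show "Q (mono_series R \<nu> (?p \<nu>))" if "Poly_Mapping.keys \<nu> \<subseteq> {..<n}" for \<nu>
      using assms(2) assms(4)[OF that] by (simp add: mono_zero)
  qed (use assms p in auto)
  moreover have "?e \<in> S.nbhd N"
    using e R.nbhd_zero unfolding S_nbhd by (auto simp: series_in_def)
  moreover have "f = ?p \<oplus>\<^bsub>S\<^esub> ?e" using coeff_closed[OF f] by (auto simp: add_S)
  ultimately show ?thesis using p that by blast
qed

end

section \<open>Homomorphisms of lattices: successive approximation and open mapping\<close>

locale lattice_hom = D: complete_tate_lattice D L s + C: complete_tate_lattice C M t
  for D :: "('d, 'm) ring_scheme" and L s and C :: "('c, 'n) ring_scheme" (structure) and M t +
  fixes \<phi>
  assumes hom: "\<phi> \<in> ring_hom D C" and hom_unit: "\<phi> s = t" and hom_lattice: "\<phi> ` L \<subseteq> M"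
begin

sublocale H: ring_hom_cring D C \<phi>
  using hom by unfold_locales

lemma hom_pow: "x \<in> carrier D \<Longrightarrow> \<phi> (x [^]\<^bsub>D\<^esub> (k::nat)) = \<phi> x [^] k"
  by (induction k) auto

lemma hom_nbhd: "x \<in> D.nbhd k \<Longrightarrow> \<phi> x \<in> C.nbhd k"
  using hom_lattice by (elim D.nbhdE) (auto simp: hom_pow hom_unit D.L_closed intro!: C.nbhdI)

lemma img_lattice: "subring (\<phi> ` L) C"
proof -
  have "ring_hom_ring D C \<phi>" using hom by (intro ring_hom_ringI2 D.ring_axioms C.ring_axioms)
  then show ?thesis using ring_hom_ring.img_is_subring D.lattice by blast
qed

text \<open>Successive approximation: a remainder that is divisible by \<open>t\<close> can be expanded again.\<close>

lemma successive_approximation: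
  assumes G: "finite G" "G \<subseteq> M" and F: "F \<subseteq> carrier C"
    and bounded: "\<And>v. v \<in> F \<Longrightarrow> t [^] (k::nat) \<otimes> v \<in> M"
    and step: "\<And>v. v \<in> F \<Longrightarrow> \<exists>m\<in>lin_span C (\<phi> ` L) (\<lambda>g. g) G. \<exists>w\<in>F. v = m \<oplus> t \<otimes> w"
  shows "F \<subseteq> lin_span C (\<phi> ` L) (\<lambda>g. g) G"
proof
  fix v assume v: "v \<in> F"
  define \<theta> where "\<theta> c = (\<Oplus>g\<in>G. \<phi> (c g) \<otimes> g)" for c
  have Gc: "g \<in> carrier C" if "g \<in> G" for g using that G C.L_closed by auto
  have \<theta>_closed: "\<theta> c \<in> carrier C" if "\<And>g. g \<in> G \<Longrightarrow> c g \<in> carrier D" for c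
    unfolding \<theta>_def using that Gc by (intro C.finsum_closed) auto
  have \<theta>_add: "\<theta> (\<lambda>g. c g \<oplus>\<^bsub>D\<^esub> d g) = \<theta> c \<oplus> \<theta> d"
    if "\<And>g. g \<in> G \<Longrightarrow> c g \<in> carrier D" "\<And>g. g \<in> G \<Longrightarrow> d g \<in> carrier D" for c d
  proof -
    have "\<theta> (\<lambda>g. c g \<oplus>\<^bsub>D\<^esub> d g) = (\<Oplus>g\<in>G. \<phi> (c g) \<otimes> g \<oplus> \<phi> (d g) \<otimes> g)"
      unfolding \<theta>_def using that Gc by (intro C.finsum_cong') (auto simp: C.l_distr)
    also have "\<dots> = \<theta> c \<oplus> \<theta> d"
      unfolding \<theta>_def using that Gc by (intro C.finsum_addf) auto
    finally show ?thesis .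
  qed
  have \<theta>_scale: "\<theta> (\<lambda>g. s [^]\<^bsub>D\<^esub> (j::nat) \<otimes>\<^bsub>D\<^esub> c g) = t [^] j \<otimes> \<theta> c"
    if "\<And>g. g \<in> G \<Longrightarrow> c g \<in> carrier D" for c j
  proof -
    have "t [^] j \<otimes> \<theta> c = (\<Oplus>g\<in>G. t [^] j \<otimes> (\<phi> (c g) \<otimes> g))"
      unfolding \<theta>_def using that Gc G by (intro C.finsum_rdistr) auto
    also have "\<dots> = \<theta> (\<lambda>g. s [^]\<^bsub>D\<^esub> j \<otimes>\<^bsub>D\<^esub> c g)"
      unfolding \<theta>_def using that Gc
      by (intro C.finsum_cong') (auto simp: hom_pow hom_unit C.m_assoc)
    finally show ?thesis by simp
  qed
  have \<theta>_nbhd: "\<theta> c \<in> C.nbhd j" if "\<And>g. g \<in> G \<Longrightarrow> c g \<in> D.nbhd j" for c j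
    unfolding \<theta>_def
  proof (rule C.finsum_nbhd[OF G(1)])
    fix g assume "g \<in> G"
    then show "\<phi> (c g) \<otimes> g \<in> C.nbhd j"
      using C.nbhd_mult[OF hom_nbhd[OF that], of g g 0] G by (auto simp: C.nbhd_0)
  qed
  \<comment> \<open>The state consists of the coefficients found so far and the remainder. Starting
    from zero coefficients places the limits of the coefficients in \<open>D.nbhd 0\<close>, which
    is \<open>L\<close>.\<close>
  define P where "P j = (\<lambda>(c, w). (\<forall>g\<in>G. c g \<in> carrier D) \<and> (\<forall>g\<in>G. j = 0 \<longrightarrow> c g = \<zero>\<^bsub>D\<^esub>) \<and>
      w \<in> F \<and> v = \<theta> c \<oplus> t [^] j \<otimes> w)" for j :: nat
  have "\<exists>f. \<forall>j. P j (f j) \<and> (\<forall>g\<in>G. fst (f (Suc j)) g \<ominus>\<^bsub>D\<^esub> fst (f j) g \<in> D.nbhd j)"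
  proof (rule dependent_nat_choice)
    have "\<theta> (\<lambda>_. \<zero>\<^bsub>D\<^esub>) = (\<Oplus>g\<in>G. \<zero>)"
      unfolding \<theta>_def using Gc by (intro C.finsum_cong') auto
    then have "P 0 (\<lambda>_. \<zero>\<^bsub>D\<^esub>, v)" using v F by (auto simp: P_def)
    then show "\<exists>x. P 0 x" by blast
    fix x j assume "P j x"
    then obtain c w where x: "x = (c, w)" and c: "\<And>g. g \<in> G \<Longrightarrow> c g \<in> carrier D"
      and w: "w \<in> F" "v = \<theta> c \<oplus> t [^] j \<otimes> w" by (auto simp: P_def)
    obtain m w' where m: "m \<in> lin_span C (\<phi> ` L) (\<lambda>g. g) G" "w' \<in> F" "w = m \<oplus> t \<otimes> w'"
      using step[OF w(1)] by blast
    obtain b where b: "b \<in> G \<rightarrow> \<phi> ` L" "m = (\<Oplus>g\<in>G. b g \<otimes> g)"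
      using m(1) by (rule spanE)
    then have "\<forall>g\<in>G. \<exists>d\<in>L. b g = \<phi> d" by auto
    then obtain d where d: "\<And>g. g \<in> G \<Longrightarrow> d g \<in> L" "\<And>g. g \<in> G \<Longrightarrow> b g = \<phi> (d g)" by metis
    have dc: "\<And>g. g \<in> G \<Longrightarrow> d g \<in> carrier D" using d D.L_closed by blast
    have md: "m = \<theta> d" unfolding b(2) \<theta>_def using d dc Gc by (intro C.finsum_cong') auto
    define c' where "c' g = c g \<oplus>\<^bsub>D\<^esub> s [^]\<^bsub>D\<^esub> j \<otimes>\<^bsub>D\<^esub> d g" for g
    have c': "\<And>g. g \<in> G \<Longrightarrow> c' g \<in> carrier D" using c dc by (simp add: c'_def)
    have w'c: "w' \<in> carrier C" using m F by auto
    have "\<theta> c' = \<theta> c \<oplus> t [^] j \<otimes> m"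
      unfolding c'_def md using c dc by (simp add: \<theta>_add \<theta>_scale)
    then have "v = \<theta> c' \<oplus> t [^] Suc j \<otimes> w'"
      using w(2) m(3) w'c \<theta>_closed[OF c] \<theta>_closed[OF dc] md
      by (simp add: C.r_distr C.a_assoc C.m_assoc)
    moreover have "c' g \<ominus>\<^bsub>D\<^esub> c g \<in> D.nbhd j" if "g \<in> G" for g
    proof -
      have "c' g \<ominus>\<^bsub>D\<^esub> c g = s [^]\<^bsub>D\<^esub> j \<otimes>\<^bsub>D\<^esub> d g"
        using c[OF that] dc[OF that] by (simp add: c'_def D.minus_eq D.a_ac D.r_neg D.r_neg1 D.r_neg2)
      then show ?thesis using D.nbhdI d that by simp
    qed
    ultimately show "\<exists>y. P (Suc j) y \<and> (\<forall>g\<in>G. fst y g \<ominus>\<^bsub>D\<^esub> fst x g \<in> D.nbhd j)"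
      using c' m(2) x by (intro exI[of _ "(c', w')"]) (auto simp: P_def)
  qed
  then obtain f where f: "\<And>j. P j (f j)"
    "\<And>j g. g \<in> G \<Longrightarrow> fst (f (Suc j)) g \<ominus>\<^bsub>D\<^esub> fst (f j) g \<in> D.nbhd j" by blast
  define c where "c j = fst (f j)" for j
  define w where "w j = snd (f j)" for j
  have c: "\<And>j g. g \<in> G \<Longrightarrow> c j g \<in> carrier D" "\<And>g. g \<in> G \<Longrightarrow> c 0 g = \<zero>\<^bsub>D\<^esub>"
    and w: "\<And>j. w j \<in> F" and eq: "\<And>j. v = \<theta> (c j) \<oplus> t [^] j \<otimes> w j"
    using f(1) unfolding P_def c_def w_def by (auto simp: case_prod_beta)
  have "\<forall>g\<in>G. \<exists>y\<in>carrier D. \<forall>j. y \<ominus>\<^bsub>D\<^esub> c j g \<in> D.nbhd j"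
    using c f(2) unfolding c_def by (intro ballI D.complete) auto
  then obtain y where y: "\<And>g. g \<in> G \<Longrightarrow> y g \<in> carrier D"
    "\<And>g j. g \<in> G \<Longrightarrow> y g \<ominus>\<^bsub>D\<^esub> c j g \<in> D.nbhd j" by metis
  have yL: "y g \<in> L" if "g \<in> G" for g
    using y(2)[OF that, where j = 0] y(1)[OF that] c(2)[OF that] by (simp add: D.nbhd_0 D.minus_eq)
  have "v = \<theta> y"
  proof (rule C.separated_eq)
    show vc: "v \<in> carrier C" using v F by auto
    show yc: "\<theta> y \<in> carrier C" using \<theta>_closed y by simp
    fix N
    \<comment> \<open>The common denominator \<open>t [^] k\<close> of the remainders costs
      \<open>k\<close> steps of precision.\<close>
    let ?j = "k + N"
    let ?d = "\<lambda>g. y g \<ominus>\<^bsub>D\<^esub> c ?j g"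
    have dc: "\<And>g. g \<in> G \<Longrightarrow> ?d g \<in> carrier D" using y c by simp
    have "\<theta> y = \<theta> (\<lambda>g. c ?j g \<oplus>\<^bsub>D\<^esub> ?d g)"
      unfolding \<theta>_def using y c Gc
      by (intro C.finsum_cong') (auto simp: D.minus_eq D.a_ac D.r_neg D.r_neg1 D.r_neg2)
    also have "\<dots> = \<theta> (c ?j) \<oplus> \<theta> ?d" using c dc by (intro \<theta>_add) auto
    finally have ty: "\<theta> y = \<theta> (c ?j) \<oplus> \<theta> ?d" .
    have "t [^] ?j \<otimes> w ?j = t [^] N \<otimes> (t [^] k \<otimes> w ?j)"
      using w[of ?j] F by (auto simp: C.nat_pow_mult[symmetric] C.m_ac subset_iff)
    then have tw: "t [^] ?j \<otimes> w ?j \<in> C.nbhd N"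
      using C.nbhdI[OF bounded[OF w]] by simp
    have td: "\<theta> ?d \<in> C.nbhd N"
      using \<theta>_nbhd[of ?d ?j] y(2) C.nbhd_antimono[of N ?j] by auto
    have "v \<ominus> \<theta> y = t [^] ?j \<otimes> w ?j \<ominus> \<theta> ?d"
      unfolding ty eq[of ?j] using \<theta>_closed[of "c ?j", OF c(1)] \<theta>_closed[of ?d, OF dc] C.nbhd_closed[OF tw]
      by (simp add: C.minus_eq C.minus_add C.a_ac C.r_neg C.r_neg1 C.r_neg2)
    then show "v \<ominus> \<theta> y \<in> C.nbhd N" using C.nbhd_minus[OF tw td] by simp
  qed
  then show "v \<in> lin_span C (\<phi> ` L) (\<lambda>g. g) G"
    using yL spanI[of "\<lambda>g. \<phi> (y g)" G "\<phi> ` L" C "\<lambda>g. g"] unfolding \<theta>_def by auto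
qed

text \<open>Banach's open mapping theorem. If no neighbourhood of zero were contained in the closure \<open>W\<close> of
  the image of the lattice, a nested sequence of balls would avoid all the sets \<open>t\<^sup>-\<^sup>n W\<close>, which
  cover the ring.\<close>

lemma open_mapping:
  assumes surj: "\<phi> ` carrier D = carrier C"
  shows "\<exists>k. C.nbhd k \<subseteq> \<phi> ` L"
proof -
  let ?G = "\<phi> ` L"
  note G = subringE[OF img_lattice]
  define W where "W = {w \<in> carrier C. \<forall>N. \<exists>g\<in>?G. w \<ominus> g \<in> C.nbhd N}"
  have W_minus: "x \<ominus> y \<in> W" if x: "x \<in> W" and y: "y \<in> W" for x y
  proof -
    have "\<exists>g\<in>?G. (x \<ominus> y) \<ominus> g \<in> C.nbhd N" for N
    proof -
      obtain g h where gh: "g \<in> ?G" "x \<ominus> g \<in> C.nbhd N" "h \<in> ?G" "y \<ominus> h \<in> C.nbhd N"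
        using x y unfolding W_def by blast
      then have car: "x \<in> carrier C" "y \<in> carrier C" "g \<in> carrier C" "h \<in> carrier C"
        using x y G(1) by (auto simp: W_def)
      have "(x \<ominus> y) \<ominus> (g \<ominus> h) = (x \<ominus> g) \<ominus> (y \<ominus> h)"
        using car by (simp add: C.minus_eq C.minus_add C.a_ac)
      moreover have "g \<ominus> h \<in> ?G" using G(5,7) gh by (simp add: C.minus_eq)
      ultimately show ?thesis using C.nbhd_minus gh by metis
    qed
    then show ?thesis using x y by (auto simp: W_def)
  qed
  have "\<exists>k. C.nbhd k \<subseteq> W"
  proof (rule ccontr)
    assume no: "\<nexists>k. C.nbhd k \<subseteq> W"
    \<comment> \<open>The state is a ball with centre \<open>x\<close> and radius index
      \<open>k\<close>. At stage \<open>j + 1\<close> the ball avoids the elements that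
      \<open>t [^] j\<close> moves into \<open>W\<close>; stage 0 avoids nothing, which accounts for
      the shift by one.\<close>
    define P where "P j = (\<lambda>(x, k). x \<in> carrier C \<and> j \<le> k \<and>
      (\<forall>y\<in>C.nbhd k. t [^] (j - 1) \<otimes> (x \<oplus> y) \<notin> W \<or> j = 0))" for j :: nat
    have "\<exists>f. \<forall>j. P j (f j) \<and> (snd (f j) \<le> snd (f (Suc j)) \<and>
        fst (f (Suc j)) \<ominus> fst (f j) \<in> C.nbhd (snd (f j)))"
    proof (rule dependent_nat_choice)
      show "\<exists>x. P 0 x" by (intro exI[of _ "(\<zero>, 0)"]) (simp add: P_def)
      fix z j assume "P j z"
      then obtain x k where z: "z = (x, k)" and x: "x \<in> carrier C" "j \<le> k" by (auto simp: P_def)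
      \<comment> \<open>Otherwise \<open>t [^] j\<close> would move a whole ball into
        \<open>W\<close>, and differences of its elements would give a neighbourhood of zero inside
        \<open>W\<close>.\<close>
      have "\<exists>y\<in>C.nbhd k. t [^] j \<otimes> (x \<oplus> y) \<notin> W"
      proof (rule ccontr)
        assume *: "\<not> ?thesis"
        have "C.nbhd (j + k) \<subseteq> W"
        proof
          fix v assume "v \<in> C.nbhd (j + k)"
          then obtain c where c: "c \<in> M" "v = t [^] (j + k) \<otimes> c" by (rule C.nbhdE)
          let ?y = "t [^] k \<otimes> c"
          have y: "?y \<in> C.nbhd k" using c C.nbhdI by simp
          have "t [^] j \<otimes> (x \<oplus> ?y) \<ominus> t [^] j \<otimes> (x \<oplus> \<zero>) \<in> W"
            using * y C.nbhd_zero by (intro W_minus) blast+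
          moreover have "t [^] j \<otimes> (x \<oplus> ?y) \<ominus> t [^] j \<otimes> (x \<oplus> \<zero>) = t [^] j \<otimes> ?y"
            using x c C.L_closed
            by (simp add: C.minus_eq C.r_distr C.a_ac C.r_neg C.r_neg1 C.r_neg2)
          moreover have "t [^] j \<otimes> ?y = v"
            using c C.L_closed by (simp add: C.nat_pow_mult[symmetric] C.m_assoc)
          ultimately show "v \<in> W" by simp
        qed
        then show False using no by blast
      qed
      then obtain y where y: "y \<in> C.nbhd k" "t [^] j \<otimes> (x \<oplus> y) \<notin> W" by blast
      let ?x = "x \<oplus> y"
      have yc: "y \<in> carrier C" using C.nbhd_closed y by blast
      have xc: "?x \<in> carrier C" using x yc by simp
      obtain N where N: "\<And>g. g \<in> ?G \<Longrightarrow> t [^] j \<otimes> ?x \<ominus> g \<notin> C.nbhd N"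
        using y(2) xc unfolding W_def by auto
      \<comment> \<open>\<open>N\<close> is the precision at which the scaled new centre is seen to
        lie outside the closure \<open>W\<close>, so the smaller ball stays outside; the successor
        keeps the radius index at least as large as the stage.\<close>
      let ?k = "Suc (k + N)"
      have "t [^] j \<otimes> (?x \<oplus> v) \<notin> W" if v: "v \<in> C.nbhd ?k" for v
      proof
        assume "t [^] j \<otimes> (?x \<oplus> v) \<in> W"
        then obtain g where g: "g \<in> ?G" "t [^] j \<otimes> (?x \<oplus> v) \<ominus> g \<in> C.nbhd N"
          unfolding W_def by blast
        have vc: "v \<in> carrier C" using C.nbhd_closed v by blast
        have gc: "g \<in> carrier C" using G(1) g by auto
        have "t [^] j \<otimes> v \<in> C.nbhd N"
          using C.nbhd_scale[OF C.t_pow_lattice v] C.nbhd_antimono[of N ?k] by auto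
        then have "(t [^] j \<otimes> (?x \<oplus> v) \<ominus> g) \<ominus> t [^] j \<otimes> v \<in> C.nbhd N"
          using C.nbhd_minus g by blast
        moreover have "(t [^] j \<otimes> (?x \<oplus> v) \<ominus> g) \<ominus> t [^] j \<otimes> v = t [^] j \<otimes> ?x \<ominus> g"
          using C.m_closed[OF C.nat_pow_closed[OF C.t_closed, of j] xc] vc gc
          unfolding C.r_distr[OF xc vc C.nat_pow_closed[OF C.t_closed]]
          by (simp add: C.minus_eq C.a_assoc C.r_neg C.r_neg1 C.r_neg2
              C.a_comm[of "t [^] j \<otimes> v"] C.l_neg del: C.r_distr)
        ultimately show False using N g by simp
      qed
      moreover have "?x \<ominus> x = y"
        using x yc by (simp add: C.minus_eq C.a_comm[of x y] C.a_assoc C.r_neg)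
      ultimately show "\<exists>z'. P (Suc j) z' \<and> (snd z \<le> snd z' \<and> fst z' \<ominus> fst z \<in> C.nbhd (snd z))"
        using x xc y z by (intro exI[of _ "(?x, ?k)"]) (auto simp: P_def)
    qed
    then obtain f where f: "\<And>j. P j (f j)" "\<And>j. snd (f j) \<le> snd (f (Suc j))"
      "\<And>j. fst (f (Suc j)) \<ominus> fst (f j) \<in> C.nbhd (snd (f j))" by blast
    define x where "x j = fst (f j)" for j
    define k where "k j = snd (f j)" for j
    have xc: "\<And>j. x j \<in> carrier C" and kj: "\<And>j. j \<le> k j"
      and out: "\<And>j y. y \<in> C.nbhd (k (Suc j)) \<Longrightarrow> t [^] j \<otimes> (x (Suc j) \<oplus> y) \<notin> W"
      using f(1) unfolding P_def x_def k_def by (force simp: case_prod_beta)+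
    have kmono: "k i \<le> k j" if "i \<le> j" for i j
      using that f(2) unfolding k_def by (rule lift_Suc_mono_le[rotated])
    have far: "x j \<ominus> x i \<in> C.nbhd (k i)" if "i \<le> j" for i j
      using that
    proof (induction j rule: dec_induct)
      case base then show ?case using xc C.nbhd_zero by (simp add: C.minus_eq C.r_neg)
    next
      case (step j)
      have "x (Suc j) \<ominus> x j \<in> C.nbhd (k i)"
        using f(3)[of j] C.nbhd_antimono[OF kmono[of i j]] step by (auto simp: x_def k_def)
      then show ?case using C.nbhd_minus_trans[OF _ step.IH] xc by blast
    qed
    have "\<exists>y\<in>carrier C. \<forall>j. y \<ominus> x j \<in> C.nbhd j"
    proof (rule C.complete)
      show "x (Suc j) \<ominus> x j \<in> C.nbhd j" for j
        using f(3)[of j] C.nbhd_antimono[OF kj[of j]] by (auto simp: x_def k_def)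
    qed (rule xc)
    then obtain y where y: "y \<in> carrier C" "\<And>j. y \<ominus> x j \<in> C.nbhd j" by blast
    have yk: "y \<ominus> x j \<in> C.nbhd (k j)" for j
    proof (rule C.nbhd_minus_trans)
      let ?i = "max j (k j)"
      show "y \<ominus> x ?i \<in> C.nbhd (k j)" using y(2)[of ?i] C.nbhd_antimono[of "k j" ?i] by auto
      show "x ?i \<ominus> x j \<in> C.nbhd (k j)" using far by simp
    qed (use y xc in auto)
    \<comment> \<open>The limit lies in all the balls, yet by surjectivity and absorption some power
      of \<open>t\<close> moves it into the image of the lattice.\<close>
    obtain d where d: "d \<in> carrier D" "y = \<phi> d" using surj y by blast
    obtain j :: nat where j: "s [^]\<^bsub>D\<^esub> j \<otimes>\<^bsub>D\<^esub> d \<in> L" using D.absorb d by blast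
    have "t [^] j \<otimes> y = \<phi> (s [^]\<^bsub>D\<^esub> j \<otimes>\<^bsub>D\<^esub> d)" using d by (simp add: hom_pow hom_unit)
    then have tyG: "t [^] j \<otimes> y \<in> ?G" using j by blast
    have "t [^] j \<otimes> y \<ominus> t [^] j \<otimes> y \<in> C.nbhd N" for N
      using y C.nbhd_zero by (simp add: C.minus_eq C.r_neg)
    then have "t [^] j \<otimes> y \<in> W"
      using tyG y(1) C.m_closed[OF C.nat_pow_closed[OF C.t_closed] y(1)] unfolding W_def by blast
    moreover have "x (Suc j) \<oplus> (y \<ominus> x (Suc j)) = y"
      using y xc[of "Suc j"] by (simp add: C.minus_eq C.a_ac C.r_neg C.r_neg1 C.r_neg2)
    ultimately show False using out[OF yk[of "Suc j"]] by simp
  qed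
  then obtain k where k: "C.nbhd k \<subseteq> W" by blast
  \<comment> \<open>Each element of \<open>C.nbhd k\<close> equals an element of the image up to
    \<open>t\<close> times another such element, so successive approximation with the single
    generator one removes the closure.\<close>
  have "C.nbhd k \<subseteq> lin_span C ?G (\<lambda>g. g) {\<one>}"
  proof (rule successive_approximation)
    show "{\<one>} \<subseteq> M" using C.L_one by simp
    show "C.nbhd k \<subseteq> carrier C" using C.nbhd_closed by blast
    show "t [^] (0::nat) \<otimes> v \<in> M" if "v \<in> C.nbhd k" for v
      using that C.nbhd_subset_L C.nbhd_closed[OF that] by auto
    fix v assume v: "v \<in> C.nbhd k"
    then obtain g where g: "g \<in> ?G" "v \<ominus> g \<in> C.nbhd (Suc k)" using k unfolding W_def by blast
    obtain c where c: "c \<in> M" "v \<ominus> g = t [^] Suc k \<otimes> c" using g(2) by (rule C.nbhdE)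
    have gc: "g \<in> carrier C" and vc: "v \<in> carrier C" using G(1) g v C.nbhd_closed by auto
    have "t [^] k \<otimes> c \<in> C.nbhd k" using C.nbhdI c by simp
    moreover have "v = g \<oplus> (v \<ominus> g)"
      using gc vc by (simp add: C.minus_eq C.a_lcomm[of g v] C.r_neg)
    then have "v = g \<oplus> t \<otimes> (t [^] k \<otimes> c)"
      using c C.L_closed by (simp add: C.m_ac)
    moreover have "g \<in> lin_span C ?G (\<lambda>g. g) {\<one>}"
      using spanI[of "\<lambda>_. g" "{\<one>}" ?G C "\<lambda>g. g"] g gc by simp
    ultimately show "\<exists>m\<in>lin_span C ?G (\<lambda>g. g) {\<one>}. \<exists>w\<in>C.nbhd k. v = m \<oplus> t \<otimes> w" by blast
  qed simp
  moreover have "lin_span C ?G (\<lambda>g. g) {\<one>} \<subseteq> ?G"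
  proof
    fix x assume "x \<in> lin_span C ?G (\<lambda>g. g) {\<one>}"
    then obtain c where "c \<in> {\<one>} \<rightarrow> ?G" "x = (\<Oplus>i\<in>{\<one>}. c i \<otimes> i)" by (rule spanE)
    moreover have "c \<one> \<in> ?G" "c \<one> \<in> carrier C" using calculation G(1) by auto
    ultimately show "x \<in> ?G" by simp
  qed
  ultimately show ?thesis by blast
qed

end

section \<open>Evaluation of restricted power series\<close>

text \<open>Polynomials are dense, and \<open>bounded\<close> is continuity at zero with a fixed
  loss \<open>k\<close> of precision. Applied to a difference of two expressions, this reduces an
  identity of continuous additive maps to single terms.\<close>

lemma (in tate_series) density:
  assumes C: "complete_tate_lattice C M u"
    and closed: "\<And>h. h \<in> carrier S \<Longrightarrow> \<delta> h \<in> carrier C"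
    and add: "\<And>g h. g \<in> carrier S \<Longrightarrow> h \<in> carrier S \<Longrightarrow> \<delta> (g \<oplus>\<^bsub>S\<^esub> h) = \<delta> g \<oplus>\<^bsub>C\<^esub> \<delta> h"
    and bounded: "\<And>N h. h \<in> S.nbhd (k + N) \<Longrightarrow> \<delta> h \<in> tate_lattice.nbhd C M u N"
    and mono: "\<And>\<nu> c. c \<in> carrier R \<Longrightarrow> Poly_Mapping.keys \<nu> \<subseteq> {..<n} \<Longrightarrow> \<delta> (mono_series R \<nu> c) = \<zero>\<^bsub>C\<^esub>"
    and h: "h \<in> carrier S"
  shows "\<delta> h = \<zero>\<^bsub>C\<^esub>"
proof -
  interpret C: complete_tate_lattice C M u by fact
  show ?thesis
  proof (rule C.separated[OF closed[OF h]])
    fix N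
    obtain p e where pe: "p \<in> carrier S" "e \<in> S.nbhd (k + N)" "h = p \<oplus>\<^bsub>S\<^esub> e" "\<delta> p = \<zero>\<^bsub>C\<^esub>"
    proof (rule polynomial_approx[OF h, of "\<lambda>p. \<delta> p = \<zero>\<^bsub>C\<^esub>"])
      show "\<delta> \<zero>\<^bsub>S\<^esub> = \<zero>\<^bsub>C\<^esub>" using mono[of "\<zero>\<^bsub>R\<^esub>" 0] by (simp add: mono_zero)
      show "\<delta> (mono_series R \<nu> (h \<nu>)) = \<zero>\<^bsub>C\<^esub>" if "Poly_Mapping.keys \<nu> \<subseteq> {..<n}" for \<nu>
        using mono coeff_closed[OF h] that by simp
    qed (auto simp: add)
    then have "\<delta> h = \<delta> e" using add[OF pe(1)] S.nbhd_closed[OF pe(2)] closed by simp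
    then show "\<delta> h \<in> C.nbhd N" using bounded[OF pe(2)] by simp
  qed
qed

primrec monomial :: "('a, 'm) ring_scheme \<Rightarrow> (nat \<Rightarrow> 'a) \<Rightarrow> nat \<Rightarrow> (nat \<Rightarrow>\<^sub>0 nat) \<Rightarrow> 'a" where
  "monomial A a 0 \<nu> = \<one>\<^bsub>A\<^esub>"
| "monomial A a (Suc n) \<nu> = monomial A a n \<nu> \<otimes>\<^bsub>A\<^esub> a n [^]\<^bsub>A\<^esub> Poly_Mapping.lookup \<nu> n"

lemma (in cring) monomial_props:
  assumes "\<And>j. j < n \<Longrightarrow> a j \<in> carrier R"
  shows monomial_closed: "monomial R a n \<nu> \<in> carrier R"
    and monomial_add: "monomial R a n (\<mu> + \<nu>) = monomial R a n \<mu> \<otimes> monomial R a n \<nu>"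
    and monomial_0: "monomial R a n 0 = \<one>"
proof -
  have "monomial R a n \<nu> \<in> carrier R \<and> monomial R a n \<mu> \<in> carrier R \<and>
     monomial R a n (\<mu> + \<nu>) = monomial R a n \<mu> \<otimes> monomial R a n \<nu> \<and> monomial R a n 0 = \<one>"
    using assms by (induction n) (auto simp: lookup_add nat_pow_mult[symmetric] m_ac)
  then show "monomial R a n \<nu> \<in> carrier R"
    "monomial R a n (\<mu> + \<nu>) = monomial R a n \<mu> \<otimes> monomial R a n \<nu>" "monomial R a n 0 = \<one>" by auto
qed

lemma (in cring) monomial_single:
  assumes "\<And>j. j < n \<Longrightarrow> a j \<in> carrier R" "j < n"
  shows "monomial R a n (Poly_Mapping.single j 1) = a j"
proof -
  have "monomial R a n (Poly_Mapping.single j 1) = (if j < n then a j else \<one>)"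
    using assms(1)
  proof (induction n)
    case (Suc n)
    then show ?case by (cases "j = n") (auto simp: lookup_single_not_eq)
  qed simp
  then show ?thesis using assms by simp
qed

lemma (in cring) monomial_cong:
  assumes "m \<le> n" "\<And>j. j < m \<Longrightarrow> a j \<in> carrier R" "\<And>j. j < m \<Longrightarrow> b j = a j"
    and "\<And>j. j < n \<Longrightarrow> b j \<in> carrier R" "Poly_Mapping.keys \<nu> \<subseteq> {..<m}"
  shows "monomial R b n \<nu> = monomial R a m \<nu>"
proof -
  have "monomial R b m \<nu> = monomial R a m \<nu>" using assms(3) by (induction m) auto
  moreover have "monomial R b (m + k) \<nu> = monomial R b m \<nu>" if "m + k \<le> n" for k
    using that
  proof (induction k)
    case (Suc k)
    have "m + k \<notin> Poly_Mapping.keys \<nu>" using assms(5) by auto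
    then have "Poly_Mapping.lookup \<nu> (m + k) = 0" by (simp add: in_keys_iff)
    then show ?case using Suc monomial_closed[of m b \<nu>] assms(4) by simp
  qed simp
  from this[of "n - m"] have "monomial R b n \<nu> = monomial R b m \<nu>" using assms(1) by simp
  ultimately show ?thesis by simp
qed

text \<open>The point has its coordinates in the lattice \<open>M\<close>, hence all monomials at it
  lie there too. This makes the series converge and evaluation a homomorphism of lattices.\<close>

locale tate_eval = tate_series R L t n + H: lattice_hom R L t A M u \<rho>
  for R :: "'r huber_pair" and L t and n :: nat and A :: "('a, 'm) ring_scheme" (structure) and M u \<rho> +
  fixes a :: "nat \<Rightarrow> 'a"
  assumes point: "\<And>j. j < n \<Longrightarrow> a j \<in> M"
begin

abbreviation "pmon \<equiv> monomial A a n"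

definition partial_sum :: "(nat \<Rightarrow>\<^sub>0 nat) set \<Rightarrow> ((nat \<Rightarrow>\<^sub>0 nat) \<Rightarrow> 'r) \<Rightarrow> 'a" where
  "partial_sum F h = (\<Oplus>\<nu>\<in>F. \<rho> (h \<nu>) \<otimes> pmon \<nu>)"

text \<open>Summation along the net of finite sets of exponents, so that no enumeration of the
  exponents has to be chosen.\<close>

definition has_value :: "((nat \<Rightarrow>\<^sub>0 nat) \<Rightarrow> 'r) \<Rightarrow> 'a \<Rightarrow> bool" where
  "has_value h y \<longleftrightarrow> y \<in> carrier A \<and> (\<forall>N. \<exists>F0. finite F0 \<and>
     (\<forall>F. finite F \<longrightarrow> F0 \<subseteq> F \<longrightarrow> y \<ominus> partial_sum F h \<in> H.C.nbhd N))"

definition ev :: "((nat \<Rightarrow>\<^sub>0 nat) \<Rightarrow> 'r) \<Rightarrow> 'a" where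
  "ev h = (SOME y. has_value h y)"

lemma mon_lattice: "pmon \<nu> \<in> M"
proof -
  have pow: "x [^] (k::nat) \<in> M" if "x \<in> M" for x k
    using that by (induction k) (auto intro: H.C.L_one H.C.L_mult)
  show ?thesis using point
  proof (induction n)
    case (Suc n)
    then show ?case using pow[of "a n"] H.C.L_mult by simp
  qed (simp add: H.C.L_one)
qed

lemma mon_closed [simp]: "pmon \<nu> \<in> carrier A"
  using mon_lattice H.C.L_closed by blast

lemma coeff_hom_closed: "h \<in> carrier S \<Longrightarrow> \<rho> (h \<nu>) \<in> carrier A"
  using coeff_closed by simp

lemma partial_sum_closed: "h \<in> carrier S \<Longrightarrow> partial_sum F h \<in> carrier A"
  unfolding partial_sum_def by (intro H.C.finsum_closed) (simp add: coeff_hom_closed)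

lemma partial_sum_diff:
  assumes h: "h \<in> carrier S" and F: "finite F" "F0 \<subseteq> F" and N: "{\<nu>. h \<nu> \<notin> R.nbhd N} \<subseteq> F0"
  shows "partial_sum F h \<ominus> partial_sum F0 h \<in> H.C.nbhd N"
proof -
  have "partial_sum (F0 \<union> (F - F0)) h = partial_sum F0 h \<oplus> partial_sum (F - F0) h"
    unfolding partial_sum_def using F finite_subset[OF F(2,1)] coeff_hom_closed[OF h]
    by (intro H.C.finsum_Un_disjoint) auto
  moreover have "F0 \<union> (F - F0) = F" using F by blast
  ultimately have "partial_sum F h \<ominus> partial_sum F0 h = partial_sum (F - F0) h"
    using partial_sum_closed[OF h] by (simp add: H.C.minus_eq H.C.a_lcomm[of "partial_sum F0 h"] H.C.a_assoc H.C.r_neg)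
  also have "\<dots> \<in> H.C.nbhd N"
    unfolding partial_sum_def
  proof (rule H.C.finsum_nbhd)
    fix \<nu> assume "\<nu> \<in> F - F0"
    then have "\<rho> (h \<nu>) \<in> H.C.nbhd N" using N H.hom_nbhd by blast
    then show "\<rho> (h \<nu>) \<otimes> pmon \<nu> \<in> H.C.nbhd N"
      using H.C.nbhd_mult[of _ N "pmon \<nu>" 0] mon_lattice by (simp add: H.C.nbhd_0)
  qed (use F in simp)
  finally show ?thesis .
qed

lemma has_value_exists:
  assumes h: "h \<in> carrier S" shows "\<exists>y. has_value h y"
proof -
  define F where "F N = {\<nu>. h \<nu> \<notin> R.nbhd N}" for N
  have fin: "finite (F N)" for N using h by (simp add: F_def carrier_S R.restricted_series_iff)
  have "\<exists>y\<in>carrier A. \<forall>N. y \<ominus> partial_sum (F N) h \<in> H.C.nbhd N"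
  proof (rule H.C.complete)
    show "partial_sum (F (Suc N)) h \<ominus> partial_sum (F N) h \<in> H.C.nbhd N" for N
      using R.nbhd_antimono[of N "Suc N"] by (intro partial_sum_diff h fin) (auto simp: F_def)
  qed (rule partial_sum_closed[OF h])
  then obtain y where y: "y \<in> carrier A" "\<And>N. y \<ominus> partial_sum (F N) h \<in> H.C.nbhd N" by blast
  have "y \<ominus> partial_sum E h \<in> H.C.nbhd N" if "finite E" "F N \<subseteq> E" for E N
  proof (rule H.C.nbhd_minus_trans[OF y(2)])
    show "partial_sum (F N) h \<ominus> partial_sum E h \<in> H.C.nbhd N"
      using partial_sum_diff[OF h that] partial_sum_closed[OF h] H.C.nbhd_minus_swap
      by (simp add: F_def)
  qed (use y partial_sum_closed[OF h] in auto)
  then have "has_value h y" unfolding has_value_def using y fin by blast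
  then show ?thesis by blast
qed

lemma has_value_unique:
  assumes h: "h \<in> carrier S" and y: "has_value h y" and z: "has_value h z"
  shows "y = z"
proof (rule H.C.separated_eq)
  show yc: "y \<in> carrier A" and zc: "z \<in> carrier A" using y z by (auto simp: has_value_def)
  fix N
  obtain E F where "finite E" "\<And>F. finite F \<Longrightarrow> E \<subseteq> F \<Longrightarrow> y \<ominus> partial_sum F h \<in> H.C.nbhd N"
    "finite F" "\<And>E. finite E \<Longrightarrow> F \<subseteq> E \<Longrightarrow> z \<ominus> partial_sum E h \<in> H.C.nbhd N"
    using y z unfolding has_value_def by metis
  then have *: "y \<ominus> partial_sum (E \<union> F) h \<in> H.C.nbhd N" "z \<ominus> partial_sum (E \<union> F) h \<in> H.C.nbhd N"
    by auto
  show "y \<ominus> z \<in> H.C.nbhd N"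
    using H.C.nbhd_minus_trans[OF *(1) H.C.nbhd_minus_swap[OF *(2)]] yc zc partial_sum_closed[OF h]
    by simp
qed

lemma has_value_ev: "h \<in> carrier S \<Longrightarrow> has_value h (ev h)"
  unfolding ev_def using has_value_exists by (rule someI_ex)

lemma ev_eq: "h \<in> carrier S \<Longrightarrow> has_value h y \<Longrightarrow> ev h = y"
  using has_value_unique has_value_ev by blast

lemma ev_closed: "h \<in> carrier S \<Longrightarrow> ev h \<in> carrier A"
  using has_value_ev by (simp add: has_value_def)

lemma ev_add:
  assumes g: "g \<in> carrier S" and h: "h \<in> carrier S"
  shows "ev (g \<oplus>\<^bsub>S\<^esub> h) = ev g \<oplus> ev h"
proof (rule ev_eq)
  show "g \<oplus>\<^bsub>S\<^esub> h \<in> carrier S" using g h by simp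
  have sum: "partial_sum F (g \<oplus>\<^bsub>S\<^esub> h) = partial_sum F g \<oplus> partial_sum F h" for F
  proof -
    have "partial_sum F (g \<oplus>\<^bsub>S\<^esub> h) = (\<Oplus>\<nu>\<in>F. \<rho> (g \<nu>) \<otimes> pmon \<nu> \<oplus> \<rho> (h \<nu>) \<otimes> pmon \<nu>)"
      unfolding partial_sum_def using coeff_closed g h
      by (intro H.C.finsum_cong') (auto simp: add_S H.C.l_distr)
    also have "\<dots> = partial_sum F g \<oplus> partial_sum F h"
      unfolding partial_sum_def using coeff_closed g h by (intro H.C.finsum_addf) auto
    finally show ?thesis .
  qed
  show "has_value (g \<oplus>\<^bsub>S\<^esub> h) (ev g \<oplus> ev h)"
    unfolding has_value_def
  proof (intro conjI allI)
    show "ev g \<oplus> ev h \<in> carrier A" using g h ev_closed by simp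
    fix N
    obtain E where E: "finite E" "\<And>F. finite F \<Longrightarrow> E \<subseteq> F \<Longrightarrow> ev g \<ominus> partial_sum F g \<in> H.C.nbhd N"
      using has_value_ev[OF g] unfolding has_value_def by metis
    obtain E' where E': "finite E'" "\<And>F. finite F \<Longrightarrow> E' \<subseteq> F \<Longrightarrow> ev h \<ominus> partial_sum F h \<in> H.C.nbhd N"
      using has_value_ev[OF h] unfolding has_value_def by metis
    have "(ev g \<oplus> ev h) \<ominus> partial_sum F (g \<oplus>\<^bsub>S\<^esub> h) \<in> H.C.nbhd N"
      if "finite F" "E \<union> E' \<subseteq> F" for F
    proof -
      have "(ev g \<oplus> ev h) \<ominus> partial_sum F (g \<oplus>\<^bsub>S\<^esub> h)
          = (ev g \<ominus> partial_sum F g) \<oplus> (ev h \<ominus> partial_sum F h)"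
        using ev_closed partial_sum_closed g h
        by (simp add: sum H.C.minus_eq H.C.minus_add H.C.a_ac)
      then show ?thesis using E(2) E'(2) that H.C.nbhd_add by simp
    qed
    then show "\<exists>F0. finite F0 \<and> (\<forall>F. finite F \<longrightarrow> F0 \<subseteq> F \<longrightarrow>
        (ev g \<oplus> ev h) \<ominus> partial_sum F (g \<oplus>\<^bsub>S\<^esub> h) \<in> H.C.nbhd N)"
      using E(1) E'(1) by (intro exI[of _ "E \<union> E'"]) auto
  qed
qed

lemma ev_nbhd:
  assumes h: "h \<in> S.nbhd N" shows "ev h \<in> H.C.nbhd N"
proof -
  have hc: "h \<in> carrier S" using h S.nbhd_closed by blast
  have hN: "{\<nu>. h \<nu> \<notin> R.nbhd N} \<subseteq> {}" using h unfolding S_nbhd by (auto simp: series_in_def)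
  obtain F where F: "finite F" "ev h \<ominus> partial_sum F h \<in> H.C.nbhd N"
    using has_value_ev[OF hc] unfolding has_value_def by blast
  have "partial_sum F h \<in> H.C.nbhd N"
    using partial_sum_diff[OF hc F(1) _ hN] partial_sum_closed[OF hc]
    by (simp add: H.C.minus_eq partial_sum_def)
  then have "(ev h \<ominus> partial_sum F h) \<oplus> partial_sum F h \<in> H.C.nbhd N"
    using F H.C.nbhd_add by blast
  then show ?thesis using ev_closed[OF hc] partial_sum_closed[OF hc]
    by (simp add: H.C.minus_eq H.C.a_assoc H.C.l_neg)
qed

lemma ev_mono:
  assumes c: "c \<in> carrier R" and \<nu>: "Poly_Mapping.keys \<nu> \<subseteq> {..<n}"
  shows "ev (mono_series R \<nu> c) = \<rho> c \<otimes> pmon \<nu>"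
proof (rule ev_eq[OF mono_closed[OF c \<nu>]])
  have "partial_sum F (mono_series R \<nu> c) = \<rho> c \<otimes> pmon \<nu>" if "finite F" "\<nu> \<in> F" for F
  proof -
    have "partial_sum F (mono_series R \<nu> c) = (\<Oplus>\<mu>\<in>F. if \<nu> = \<mu> then \<rho> c \<otimes> pmon \<mu> else \<zero>)"
      unfolding partial_sum_def using c
      by (intro H.C.finsum_cong') (auto simp: mono_series_def)
    also have "\<dots> = \<rho> c \<otimes> pmon \<nu>"
      using that c by (intro H.C.finsum_singleton) auto
    finally show ?thesis .
  qed
  then show "has_value (mono_series R \<nu> c) (\<rho> c \<otimes> pmon \<nu>)"
    unfolding has_value_def using c H.C.nbhd_zero
    by (auto intro!: exI[of _ "{\<nu>}"] simp: H.C.minus_eq H.C.r_neg)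
qed

text \<open>Density in the second factor reduces the claim to multiplication by a term; after
  exchanging the factors, density reduces it further to two terms, whose exponents add.\<close>

lemma ev_mult:
  assumes g: "g \<in> carrier S" and h: "h \<in> carrier S"
  shows "ev (g \<otimes>\<^bsub>S\<^esub> h) = ev g \<otimes> ev h"
proof -
  have eq0: "x = y" if "x \<ominus> y = \<zero>" "x \<in> carrier A" "y \<in> carrier A" for x y
    using that by (simp add: H.C.r_right_minus_eq)
  have step: "ev (g \<otimes>\<^bsub>S\<^esub> h) = ev g \<otimes> ev h"
    if g: "g \<in> carrier S" and h: "h \<in> carrier S"
      and mono: "\<And>\<nu> c. c \<in> carrier R \<Longrightarrow> Poly_Mapping.keys \<nu> \<subseteq> {..<n} \<Longrightarrow>
        ev (g \<otimes>\<^bsub>S\<^esub> mono_series R \<nu> c) = ev g \<otimes> ev (mono_series R \<nu> c)" for g h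
  proof -
    let ?\<delta> = "\<lambda>h. ev (g \<otimes>\<^bsub>S\<^esub> h) \<ominus> ev g \<otimes> ev h"
    obtain k where k: "\<And>N x. x \<in> S.nbhd (k + N) \<Longrightarrow> g \<otimes>\<^bsub>S\<^esub> x \<in> S.nbhd N"
      using S.absorb_nbhd[OF g] by blast
    obtain l where l: "\<And>N x. x \<in> H.C.nbhd (l + N) \<Longrightarrow> ev g \<otimes> x \<in> H.C.nbhd N"
      using H.C.absorb_nbhd[OF ev_closed[OF g]] by blast
    have "?\<delta> h = \<zero>"
    proof (rule density[OF H.C.complete_tate_lattice_axioms, of ?\<delta> "k + l"])
      fix N x assume x: "x \<in> S.nbhd (k + l + N)"
      have "x \<in> S.nbhd (k + N)" "x \<in> S.nbhd (l + N)"
        using x S.nbhd_antimono[of "k + N" "k + l + N"] S.nbhd_antimono[of "l + N" "k + l + N"] by auto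
      then show "?\<delta> x \<in> H.C.nbhd N"
        using k l ev_nbhd by (intro H.C.nbhd_minus) auto
    next
      fix x y assume xy: "x \<in> carrier S" "y \<in> carrier S"
      then have "g \<otimes>\<^bsub>S\<^esub> (x \<oplus>\<^bsub>S\<^esub> y) = g \<otimes>\<^bsub>S\<^esub> x \<oplus>\<^bsub>S\<^esub> g \<otimes>\<^bsub>S\<^esub> y" using g by (simp add: S.r_distr)
      then show "?\<delta> (x \<oplus>\<^bsub>S\<^esub> y) = ?\<delta> x \<oplus> ?\<delta> y"
        using g xy ev_closed
        by (simp add: ev_add H.C.r_distr H.C.minus_eq H.C.minus_add H.C.a_ac)
    next
      fix \<nu> :: "nat \<Rightarrow>\<^sub>0 nat" and c assume c: "c \<in> carrier R" "Poly_Mapping.keys \<nu> \<subseteq> {..<n}"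
      show "?\<delta> (mono_series R \<nu> c) = \<zero>"
        unfolding mono[OF c] H.C.minus_eq
        by (intro H.C.r_neg H.C.m_closed ev_closed g mono_closed c)
    next
      show "?\<delta> x \<in> carrier A" if "x \<in> carrier S" for x
        using that by (intro H.C.minus_closed H.C.m_closed ev_closed S.m_closed g)
    qed (rule h)
    then show ?thesis by (rule eq0) (intro H.C.m_closed ev_closed S.m_closed g h)+
  qed
  show ?thesis
  proof (rule step[OF g h])
    fix \<nu> :: "nat \<Rightarrow>\<^sub>0 nat" and c assume c: "c \<in> carrier R" and \<nu>: "Poly_Mapping.keys \<nu> \<subseteq> {..<n}"
    let ?m = "mono_series R \<nu> c"
    have m: "?m \<in> carrier S" using mono_closed c \<nu> by simp
    have "ev (?m \<otimes>\<^bsub>S\<^esub> g) = ev ?m \<otimes> ev g"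
    proof (rule step[OF m g])
      fix \<mu> :: "nat \<Rightarrow>\<^sub>0 nat" and d assume d: "d \<in> carrier R" and \<mu>: "Poly_Mapping.keys \<mu> \<subseteq> {..<n}"
      have "Poly_Mapping.keys (\<nu> + \<mu>) \<subseteq> {..<n}" using \<mu> \<nu> keys_add by fastforce
      moreover have "pmon (\<nu> + \<mu>) = pmon \<nu> \<otimes> pmon \<mu>"
        using point H.C.L_closed by (intro H.C.monomial_add) auto
      ultimately show "ev (?m \<otimes>\<^bsub>S\<^esub> mono_series R \<mu> d) = ev ?m \<otimes> ev (mono_series R \<mu> d)"
        using c d \<mu> \<nu> by (simp add: mono_mult ev_mono H.C.m_ac)
    qed
    then show "ev (g \<otimes>\<^bsub>S\<^esub> ?m) = ev g \<otimes> ev ?m"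
      using S.m_comm[OF g m] H.C.m_comm[OF ev_closed[OF g] ev_closed[OF m]] by simp
  qed
qed

lemma ev_const: "c \<in> carrier R \<Longrightarrow> ev (const_series R c) = \<rho> c"
  using ev_mono[of c 0] H.C.monomial_0[of n a] point H.C.L_closed
  by (simp add: const_series_eq_mono)

lemma ev_var: "j < n \<Longrightarrow> ev (mono_series R (Poly_Mapping.single j 1) \<one>\<^bsub>R\<^esub>) = a j"
  using ev_mono[of "\<one>\<^bsub>R\<^esub>" "Poly_Mapping.single j 1"] H.C.monomial_single[of n a j] point H.C.L_closed
  by simp

lemma ev_hom: "ev \<in> ring_hom S A"
proof (rule ring_hom_memI)
  show "ev \<one>\<^bsub>S\<^esub> = \<one>" using ev_const[of "\<one>\<^bsub>R\<^esub>"] by (simp add: one_S)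
qed (auto simp: ev_closed ev_mult ev_add)

sublocale E: lattice_hom S "series_in L" "const_series R t" A M u ev
proof
  show "ev \<in> ring_hom S A" by (rule ev_hom)
  show "ev (const_series R t) = u" by (simp add: ev_const H.hom_unit)
  show "ev ` series_in L \<subseteq> M" using ev_nbhd[of _ 0] by (auto simp: S.nbhd_0 H.C.nbhd_0)
qed

text \<open>The tail of the series falls into the neighbourhood of zero inside \<open>Q\<close>, and
  the remaining polynomial is evaluated term by term. So \<open>Q\<close> may be unbounded, as
  \<open>A\<^sup>+\<close> can be.\<close>

lemma ev_series_in:
  assumes P: "\<rho> ` P \<subseteq> Q" "subring P R" and Q: "subring Q A" "H.C.nbhd k \<subseteq> Q"
    and aQ: "\<And>j. j < n \<Longrightarrow> a j \<in> Q" and h: "h \<in> series_in P"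
  shows "ev h \<in> Q"
proof -
  have hc: "h \<in> carrier S" using h by (simp add: series_in_def)
  note Q' = subringE[OF Q(1)]
  have pow: "x [^] (k::nat) \<in> Q" if "x \<in> Q" for x k
    using that Q' by (induction k) auto
  have pmon: "pmon \<nu> \<in> Q" for \<nu> using aQ
  proof (induction n)
    case (Suc n)
    then show ?case using pow[of "a n"] Q'(6) by simp
  qed (simp add: Q'(3))
  obtain p e where pe: "p \<in> carrier S" "e \<in> S.nbhd k" "h = p \<oplus>\<^bsub>S\<^esub> e" "ev p \<in> Q"
  proof (rule polynomial_approx[OF hc, of "\<lambda>p. ev p \<in> Q"])
    show "ev \<zero>\<^bsub>S\<^esub> \<in> Q" using Q'(2) by simp
    show "ev (mono_series R \<nu> (h \<nu>)) \<in> Q" if "Poly_Mapping.keys \<nu> \<subseteq> {..<n}" for \<nu>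
    proof -
      have "\<rho> (h \<nu>) \<in> Q" using h P(1) unfolding series_in_def by blast
      then show ?thesis using ev_mono[OF coeff_closed[OF hc] that] Q'(6) pmon by simp
    qed
  qed (auto simp: ev_add Q'(7))
  then show ?thesis using ev_add[OF pe(1) S.nbhd_closed[OF pe(2)]] ev_nbhd[OF pe(2)] Q(2) Q'(7) by auto
qed

text \<open>Exponents are finitely supported on all natural numbers, so a series in fewer variables
  is literally one in more variables. This includes the series in \<open>X\<close> among those in
  \<open>X\<close> and \<open>Y\<close> without an embedding map.\<close>

lemma ev_cong:
  assumes "tate_eval R L t m A M u \<rho> b" "m \<le> n" "\<And>j. j < m \<Longrightarrow> a j = b j"
    and h: "h \<in> carrier (tate_algebra m R)"
  shows "h \<in> carrier S" "tate_eval.ev m A M u \<rho> b h = ev h"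
proof -
  interpret E': tate_eval R L t m A M u \<rho> b by fact
  show hS: "h \<in> carrier S"
    using h assms(2) unfolding E'.carrier_S carrier_S R.restricted_series_iff by fastforce
  have "partial_sum F h = E'.partial_sum F h" for F
    unfolding partial_sum_def E'.partial_sum_def
  proof (rule H.C.finsum_cong')
    fix \<nu>
    show "\<rho> (h \<nu>) \<otimes> pmon \<nu> = \<rho> (h \<nu>) \<otimes> E'.pmon \<nu>"
    proof (cases "Poly_Mapping.keys \<nu> \<subseteq> {..<m}")
      case True
      then show ?thesis
        using H.C.monomial_cong[of m n b a \<nu>] assms(2,3) point E'.point H.C.L_closed by simp
    next
      case False
      then have "h \<nu> = \<zero>\<^bsub>R\<^esub>" using h by (simp add: E'.carrier_S R.restricted_series_iff)
      then show ?thesis by simp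
    qed
  qed (auto simp: E'.coeff_hom_closed[OF h])
  then have "has_value h = E'.has_value h"
    by (simp add: has_value_def E'.has_value_def fun_eq_iff)
  then show "E'.ev h = ev h" by (simp add: ev_def E'.ev_def)
qed

end

section \<open>From the topology to lattices\<close>

context topological_cring
begin

lemma open_preimage:
  assumes "continuous_map (topo R) (topo R) f" "openin (topo R) U"
  shows "openin (topo R) {x \<in> carrier R. f x \<in> U}"
  using openin_continuous_map_preimage[OF assms] by (simp add: topspace_topo)

lemma continuous_translation: "x \<in> carrier R \<Longrightarrow> continuous_map (topo R) (topo R) (\<lambda>y. x \<oplus> y)"
  using continuous_map_compose[OF _ continuous_add, of "topo R" "\<lambda>y. (x, y)"]
  by (simp add: continuous_map_pairedI topspace_topo o_def)

lemma continuous_scaling: "x \<in> carrier R \<Longrightarrow> continuous_map (topo R) (topo R) (\<lambda>y. x \<otimes> y)"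
  using continuous_map_compose[OF _ continuous_mult, of "topo R" "\<lambda>y. (x, y)"]
  by (simp add: continuous_map_pairedI topspace_topo o_def)

lemma open_translate:
  assumes "x \<in> carrier R" "openin (topo R) U" shows "openin (topo R) ((\<lambda>y. x \<oplus> y) ` U)"
proof -
  have U: "U \<subseteq> carrier R" using openin_subset[OF assms(2)] by (simp add: topspace_topo)
  have "(\<lambda>y. x \<oplus> y) ` U = {y \<in> carrier R. \<ominus> x \<oplus> y \<in> U}"
  proof (intro equalityI subsetI)
    fix y assume "y \<in> {y \<in> carrier R. \<ominus> x \<oplus> y \<in> U}"
    moreover from this have "y = x \<oplus> (\<ominus> x \<oplus> y)" using assms(1) by (simp add: r_neg2)
    ultimately show "y \<in> (\<lambda>y. x \<oplus> y) ` U" by blast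
  qed (use U assms(1) in \<open>auto simp: r_neg1\<close>)
  then show ?thesis using open_preimage[OF continuous_translation assms(2), of "\<ominus> x"] assms(1) by simp
qed

lemma open_unit_scale:
  assumes "u \<in> Units R" "openin (topo R) U" shows "openin (topo R) ((\<lambda>y. u \<otimes> y) ` U)"
proof -
  have u: "u \<in> carrier R" "inv u \<in> carrier R" "u \<otimes> inv u = \<one>" "inv u \<otimes> u = \<one>"
    using assms(1) by auto
  have U: "U \<subseteq> carrier R" using openin_subset[OF assms(2)] by (simp add: topspace_topo)
  have "(\<lambda>y. u \<otimes> y) ` U = {y \<in> carrier R. inv u \<otimes> y \<in> U}"
  proof (intro equalityI subsetI)
    fix y assume y: "y \<in> {y \<in> carrier R. inv u \<otimes> y \<in> U}"
    then have "y = u \<otimes> (inv u \<otimes> y)" using u by (simp add: m_assoc[symmetric])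
    then show "y \<in> (\<lambda>y. u \<otimes> y) ` U" using y by blast
  next
    fix y assume "y \<in> (\<lambda>y. u \<otimes> y) ` U"
    then obtain z where z: "z \<in> U" "y = u \<otimes> z" by blast
    then have "inv u \<otimes> y = z" using u U by (simp add: m_assoc[symmetric] subset_iff)
    then show "y \<in> {y \<in> carrier R. inv u \<otimes> y \<in> U}" using z u U by auto
  qed
  then show ?thesis using open_preimage[OF continuous_scaling assms(2)] u by simp
qed

lemma top_nilpotent_power_mem:
  assumes "topologically_nilpotent R u" "openin (topo R) U" "\<zero> \<in> U"
  shows "\<exists>N. \<forall>n\<ge>N. u [^] (n::nat) \<in> U"
  using assms unfolding topologically_nilpotent_def limitin_sequentially by blast

end

definition bounded_lattice :: "('a, 'm) top_ring_scheme \<Rightarrow> 'a \<Rightarrow> 'a set \<Rightarrow> bool" where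
  "bounded_lattice A u L \<longleftrightarrow> subring L A \<and> openin (topo A) L \<and>
     (\<forall>U. openin (topo A) U \<and> \<zero>\<^bsub>A\<^esub> \<in> U \<longrightarrow> (\<exists>j::nat. \<forall>c\<in>L. u [^]\<^bsub>A\<^esub> j \<otimes>\<^bsub>A\<^esub> c \<in> U))"

lemma (in topological_cring) bounded_lattice_subset:
  assumes "bounded_lattice R u L" "subring K R" "openin (topo R) K"
  shows "bounded_lattice R u (L \<inter> K)"
  unfolding bounded_lattice_def
proof (intro conjI allI impI)
  show "subring (L \<inter> K) R" "openin (topo R) (L \<inter> K)"
    using assms by (auto simp: bounded_lattice_def intro: subring_inter openin_Int)
  fix U assume "openin (topo R) U \<and> \<zero> \<in> U"
  then obtain j :: nat where "\<forall>c\<in>L. u [^] j \<otimes> c \<in> U"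
    using assms(1) unfolding bounded_lattice_def by blast
  then show "\<exists>j::nat. \<forall>c\<in>L \<inter> K. u [^] j \<otimes> c \<in> U" by blast
qed

text \<open>A ring of definition works: the powers of its ideal are open and form a basis at zero,
  and once a power of \<open>u\<close> lies in one of them, so do its multiples by
  \<open>L\<close>.\<close>

lemma (in huber_ring) bounded_lattice_exists:
  assumes u: "topologically_nilpotent R u"
  shows "\<exists>L. bounded_lattice R u L"
proof -
  obtain L S where L: "subring L R" "openin (topo R) L" and S: "S \<subseteq> L"
    and adic: "adic (subspace_ring R L) (Idl\<^bsub>subspace_ring R L\<^esub> S)"
    using pair_of_definition by blast
  let ?L = "subspace_ring R L"
  let ?I = "Idl\<^bsub>?L\<^esub> S"
  note L' = subringE[OF L(1)]
  have sel: "carrier ?L = L" "mult ?L = mult R" "one ?L = \<one>" "zero ?L = \<zero>" "add ?L = add R"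
    "topo ?L = subtopology (topo R) L"
    by (simp_all add: subspace_ring_def)
  interpret L: cring ?L
  proof (intro cringI abelian_groupI comm_monoidI)
    fix x assume "x \<in> carrier ?L"
    then show "\<exists>y\<in>carrier ?L. y \<oplus>\<^bsub>?L\<^esub> x = \<zero>\<^bsub>?L\<^esub>"
      using L'(1,5) by (intro bexI[of _ "\<ominus> x"]) (auto simp: sel l_neg subset_iff)
  qed (use L' in \<open>auto simp: sel a_ac m_ac l_distr r_distr subset_iff\<close>)
  have ideal_I: "ideal ?I ?L" using S by (intro L.genideal_ideal) (simp add: sel)
  interpret ideals: comm_monoid "ideals_set ?L" by (rule L.ideals_set_is_comm_monoid)
  define P where "P n = ?I [^]\<^bsub>ideals_set ?L\<^esub> n" for n :: nat
  have ideal_P: "ideal (P n) ?L" for n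
    using ideals.nat_pow_closed[of ?I n] ideal_I by (simp add: P_def ideals_set_def)
  have open_L: "openin (topo R) U \<longleftrightarrow> U \<subseteq> L \<and> (\<forall>x\<in>U. \<exists>n. x <+\<^bsub>?L\<^esub> P n \<subseteq> U)" if "U \<subseteq> L" for U
  proof -
    have "openin (subtopology (topo R) L) U \<longleftrightarrow> U \<subseteq> L \<and> (\<forall>x\<in>U. \<exists>n. x <+\<^bsub>?L\<^esub> P n \<subseteq> U)"
      using adic[unfolded adic_def, rule_format, of U] by (simp only: sel P_def)
    then show ?thesis using that openin_open_subtopology[OF L(2), of U] by blast
  qed
  have coset: "x <+\<^bsub>?L\<^esub> J = (\<lambda>y. x \<oplus> y) ` J" for x J
    by (auto simp: a_l_coset_def l_coset_def sel)
  have PL: "P n \<subseteq> L" and P_zero: "\<zero> \<in> P n" for n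
    using additive_subgroup.a_subset[OF ideal.axioms(1)[OF ideal_P]]
      additive_subgroup.zero_closed[OF ideal.axioms(1)[OF ideal_P]] by (auto simp: sel)
  have P_open: "openin (topo R) (P n)" for n
    unfolding open_L[OF PL] coset
    using PL additive_subgroup.a_closed[OF ideal.axioms(1)[OF ideal_P]] by (fastforce simp: sel)
  have "\<exists>j::nat. \<forall>c\<in>L. u [^] j \<otimes> c \<in> U" if U: "openin (topo R) U" "\<zero> \<in> U" for U
  proof -
    have "openin (topo R) (U \<inter> L)" "\<zero> \<in> U \<inter> L" using U L L' by auto
    then obtain n where n: "\<zero> <+\<^bsub>?L\<^esub> P n \<subseteq> U" using open_L[of "U \<inter> L"] by blast
    obtain j :: nat where j: "u [^] j \<in> P n"
      using top_nilpotent_power_mem[OF u P_open P_zero] by blast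
    have "u [^] j \<otimes> c \<in> U" if "c \<in> L" for c
    proof -
      have "u [^] j \<otimes> c \<in> P n" using ideal.I_r_closed[OF ideal_P j] that by (simp add: sel)
      moreover from this have "u [^] j \<otimes> c \<in> carrier R" using PL L'(1) by blast
      then have "u [^] j \<otimes> c = \<zero> \<oplus> (u [^] j \<otimes> c)" by simp
      ultimately show ?thesis using n unfolding coset by blast
    qed
    then show ?thesis by blast
  qed
  then show ?thesis using L unfolding bounded_lattice_def by blast
qed

text \<open>The new ring is \<open>L\<close> with \<open>e\<close> adjoined. One power of
  \<open>u\<close> carries all powers of the power-bounded \<open>e\<close> into \<open>L\<close>,
  hence also their combinations over \<open>L\<close>; so boundedness is inherited.\<close>

lemma (in topological_cring) bounded_lattice_adjoin:
  assumes L: "bounded_lattice R u L" and u: "u \<in> carrier R" and e: "e \<in> power_bounded R"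
  shows "\<exists>K. bounded_lattice R u K \<and> L \<subseteq> K \<and> e \<in> K"
proof -
  have Ls: "subring L R" and Lo: "openin (topo R) L" using L by (auto simp: bounded_lattice_def)
  have ec: "e \<in> carrier R" using e by (simp add: power_bounded_def)
  interpret over_subring R L e
    by (intro over_subring.intro over_subring_axioms.intro cring_axioms Ls ec)
  note L' = subringE[OF Ls]
  define K where "K = (\<Union>n. low n)"
  have KI: "x \<in> low n \<Longrightarrow> x \<in> K" for x n by (auto simp: K_def)
  have common: "\<exists>m. x \<in> low m \<and> y \<in> low m" if xy: "x \<in> K" "y \<in> K" for x y
  proof -
    obtain m n where "x \<in> low m" "y \<in> low n" using xy by (auto simp: K_def)
    then show ?thesis using low_mono[of m "max m n"] low_mono[of n "max m n"] by auto
  qed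
  have K: "subring K R"
  proof (rule subringI)
    show "K \<subseteq> carrier R" using low.sub by (auto simp: K_def)
    show "\<one> \<in> K" using pow_low[of 0 1] by (auto intro: KI)
    show "\<ominus> x \<in> K" if "x \<in> K" for x using that low_neg by (auto simp: K_def)
    show "x \<otimes> y \<in> K" if xy: "x \<in> K" "y \<in> K" for x y
      using common[OF xy] low_mult KI by blast
    show "x \<oplus> y \<in> K" if xy: "x \<in> K" "y \<in> K" for x y
      using common[OF xy] low.add KI by blast
  qed
  have eK: "e \<in> K" using pow_low[of 1 2] ec by (auto intro: KI)
  have LK: "L \<subseteq> K"
  proof
    fix c assume "c \<in> L"
    then show "c \<in> K" using low_base[of c 0 1] L'(1) by (intro KI[of _ 1]) auto
  qed
  have Ko: "openin (topo R) K"
    unfolding openin_subopen[of _ K]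
  proof
    fix x assume x: "x \<in> K"
    have "x \<in> (\<lambda>y. x \<oplus> y) ` L" using x subringE(1)[OF K] L'(2) by (intro image_eqI[of _ _ \<zero>]) auto
    moreover have "(\<lambda>y. x \<oplus> y) ` L \<subseteq> K" using x LK subringE(7)[OF K] by auto
    moreover have "openin (topo R) ((\<lambda>y. x \<oplus> y) ` L)"
      using open_translate Lo x subringE(1)[OF K] by auto
    ultimately show "\<exists>T. openin (topo R) T \<and> x \<in> T \<and> T \<subseteq> K" by blast
  qed
  have "bounded_subset R (range (\<lambda>n::nat. e [^] n))" using e by (simp add: power_bounded_def)
  then obtain V where V: "openin (topo R) V" "\<zero> \<in> V" "\<forall>v\<in>V. \<forall>s\<in>range (\<lambda>n::nat. e [^] n). v \<otimes> s \<in> L"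
    unfolding bounded_subset_def using Lo L'(2) by blast
  obtain j :: nat where "\<forall>c\<in>L. u [^] j \<otimes> c \<in> V" using L V unfolding bounded_lattice_def by blast
  then have "u [^] j \<otimes> \<one> \<in> V" using L'(3) by blast
  then have j: "u [^] j \<otimes> e [^] n \<in> L" for n :: nat using V(3) u by auto
  have jK: "u [^] j \<otimes> c \<in> L" if c: "c \<in> K" for c
  proof -
    obtain n where n: "c \<in> low n" using c by (auto simp: K_def)
    have "low n \<subseteq> {c \<in> carrier R. u [^] j \<otimes> c \<in> L}"
    proof (rule low_minimal)
      show "d \<otimes> e [^] k \<in> {c \<in> carrier R. u [^] j \<otimes> c \<in> L}" if "d \<in> L" for d and k :: nat
      proof -
        have dc: "d \<in> carrier R" using that L'(1) by auto
        then have "u [^] j \<otimes> (d \<otimes> e [^] k) = d \<otimes> (u [^] j \<otimes> e [^] k)"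
          using u ec by (intro m_lcomm) auto
        then show ?thesis using L'(6)[OF that j] dc ec by simp
      qed
    qed (use u L' in \<open>auto simp: r_distr\<close>)
    then show ?thesis using n by blast
  qed
  have "\<exists>j::nat. \<forall>c\<in>K. u [^] j \<otimes> c \<in> U" if U: "openin (topo R) U" "\<zero> \<in> U" for U
  proof -
    obtain i :: nat where i: "\<forall>c\<in>L. u [^] i \<otimes> c \<in> U" using L U unfolding bounded_lattice_def by blast
    have "u [^] (i + j) \<otimes> c \<in> U" if "c \<in> K" for c
    proof -
      have "u [^] (i + j) \<otimes> c = u [^] i \<otimes> (u [^] j \<otimes> c)"
        using u that subringE(1)[OF K] by (auto simp: nat_pow_mult[symmetric] m_assoc)
      then show ?thesis using i jK[OF that] by simp
    qed
    then show ?thesis by blast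
  qed
  then show ?thesis using K Ko LK eK unfolding bounded_lattice_def by blast
qed

lemma (in huber_ring) bounded_lattice_containing:
  assumes u: "topologically_nilpotent R u" and "finite E" "E \<subseteq> power_bounded R"
  shows "\<exists>L. bounded_lattice R u L \<and> E \<subseteq> L"
  using assms(2,3)
proof (induction E)
  case empty
  then show ?case using bounded_lattice_exists[OF u] by auto
next
  case (insert e E)
  then obtain L where L: "bounded_lattice R u L" "E \<subseteq> L" by auto
  have "u \<in> carrier R" using u by (simp add: topologically_nilpotent_def)
  then obtain K where "bounded_lattice R u K \<and> L \<subseteq> K \<and> e \<in> K"
    using bounded_lattice_adjoin[OF L(1), of e] insert.prems by auto
  then show ?case using L(2) by blast
qed

text \<open>Some power \<open>u [^] n\<close> lies in the open subring, and \<open>u\<close> is a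
  root of the monic polynomial of degree \<open>n\<close> whose only lower term is the constant
  \<open>\<ominus> (u [^] n)\<close>.\<close>

lemma (in tate_huber_pair) top_nilpotent_in_plus:
  assumes u: "topologically_nilpotent A u" shows "u \<in> plus_ring A"
proof (rule plus_integrally_closed)
  note P = subringE[OF plus_subring]
  have uc: "u \<in> carrier A" using u by (simp add: topologically_nilpotent_def)
  obtain N where N: "\<forall>n\<ge>N. u [^] (n::nat) \<in> plus_ring A"
    using top_nilpotent_power_mem[OF u plus_open P(2)] by blast
  \<comment> \<open>A successor ensures that the index 0 of the constant coefficient is below the
    degree.\<close>
  let ?n = "Suc N"
  let ?c = "\<lambda>i::nat. if 0 = i then \<ominus> (u [^] ?n) else \<zero>"
  have un: "u [^] ?n \<in> plus_ring A" using N by (metis le_SucI order_refl)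
  have "(\<Oplus>i\<in>{..<?n}. ?c i \<otimes> u [^] i) = (\<Oplus>i\<in>{..<?n}. if 0 = i then \<ominus> (u [^] ?n) else \<zero>)"
    using uc by (intro finsum_cong') auto
  also have "\<dots> = \<ominus> (u [^] ?n)"
    using uc finsum_singleton[of 0 "{..<?n}" "\<lambda>_. \<ominus> (u [^] ?n)"] by simp
  finally have "u [^] ?n \<oplus> (\<Oplus>i\<in>{..<?n}. ?c i \<otimes> u [^] i) = \<zero>"
    using uc by (simp add: r_neg del: nat_pow_Suc)
  moreover have "?c \<in> {..<?n} \<rightarrow> plus_ring A" using P(2,5) un by auto
  ultimately show "integral_elem A (plus_ring A) u"
    using uc unfolding integral_elem_def by blast
qed

text \<open>The sets \<open>nbhd n\<close> are open since \<open>u\<close> is a unit, and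
  arbitrarily small since \<open>L\<close> is bounded; so they form a basis at zero. Separatedness
  then comes from the Hausdorff property, and limits of sequences come from completeness applied to
  the filter of their tails.\<close>

lemma (in complete_tate_huber_pair) topological_tate_lattice:
  assumes L: "bounded_lattice A u L" and uL: "u \<in> L" and unit: "u \<in> Units A"
  shows "topological_tate_lattice A L u"
proof -
  have Ls: "subring L A" and Lo: "openin (topo A) L"
    and small: "\<And>U. openin (topo A) U \<Longrightarrow> \<zero> \<in> U \<Longrightarrow> \<exists>j::nat. \<forall>c\<in>L. u [^] j \<otimes> c \<in> U"
    using L by (auto simp: bounded_lattice_def)
  note L' = subringE[OF Ls]
  have uc: "u \<in> carrier A" using unit by auto
  have "tate_lattice A L u"
  proof (intro tate_lattice.intro tate_lattice_axioms.intro Ls uL unit cring_axioms)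
    fix a assume a: "a \<in> carrier A"
    obtain j :: nat where j: "\<forall>c\<in>L. u [^] j \<otimes> c \<in> {x \<in> carrier A. a \<otimes> x \<in> L}"
      using small[OF open_preimage[OF continuous_scaling[OF a] Lo]] L'(2) a by auto
    then have "a \<otimes> (u [^] j \<otimes> \<one>) \<in> L" using L'(3) by blast
    then have "u [^] j \<otimes> a \<in> L" using a uc by (simp add: m_comm)
    then show "\<exists>k::nat. u [^] k \<otimes> a \<in> L" by blast
  qed
  then interpret tate_lattice A L u .
  have nbhd_open: "openin (topo A) (nbhd n)" for n
    unfolding nbhd_def using open_unit_scale[OF t_pow_unit Lo] .
  have nbhd_small: "\<exists>n. nbhd n \<subseteq> U" if "openin (topo A) U" "\<zero> \<in> U" for U
    using small[OF that] unfolding nbhd_def by blast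
  have open_iff: "openin (topo A) U \<longleftrightarrow> U \<subseteq> carrier A \<and> (\<forall>x\<in>U. \<exists>n. \<forall>y\<in>nbhd n. x \<oplus> y \<in> U)" for U
  proof (intro iffI conjI ballI)
    assume U: "openin (topo A) U"
    show Uc: "U \<subseteq> carrier A" using openin_subset[OF U] by (simp add: topspace_topo)
    fix x assume x: "x \<in> U"
    then have xc: "x \<in> carrier A" using Uc by blast
    obtain n where "nbhd n \<subseteq> {y \<in> carrier A. x \<oplus> y \<in> U}"
      using nbhd_small[OF open_preimage[OF continuous_translation[OF xc] U]] x xc by auto
    then show "\<exists>n. \<forall>y\<in>nbhd n. x \<oplus> y \<in> U" by blast
  next
    assume U: "U \<subseteq> carrier A \<and> (\<forall>x\<in>U. \<exists>n. \<forall>y\<in>nbhd n. x \<oplus> y \<in> U)"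
    show "openin (topo A) U"
      unfolding openin_subopen[of _ U]
    proof
      fix x assume x: "x \<in> U"
      then obtain n where n: "\<forall>y\<in>nbhd n. x \<oplus> y \<in> U" using U by blast
      have "x \<in> (\<lambda>y. x \<oplus> y) ` nbhd n" using x U nbhd_zero by (intro image_eqI[of _ _ \<zero>]) auto
      then show "\<exists>T. openin (topo A) T \<and> x \<in> T \<and> T \<subseteq> U"
        using n open_translate[OF _ nbhd_open] x U by (intro exI[of _ "(\<lambda>y. x \<oplus> y) ` nbhd n"]) auto
    qed
  qed
  have sep: "a = \<zero>" if a: "a \<in> carrier A" "\<And>n. a \<in> nbhd n" for a
  proof (rule ccontr)
    assume "a \<noteq> \<zero>"
    then obtain U where "openin (topo A) U" "\<zero> \<in> U" "a \<notin> U"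
      using Hausdorff a(1) unfolding Hausdorff_space_def topspace_topo disjnt_def by blast
    then show False using nbhd_small a(2) by blast
  qed
  have compl: "\<exists>y\<in>carrier A. \<forall>n. y \<ominus> s n \<in> nbhd n"
    if s: "\<And>n::nat. s n \<in> carrier A" "\<And>n. s (Suc n) \<ominus> s n \<in> nbhd n" for s
  proof -
    have far: "s m \<ominus> s n \<in> nbhd n" if "n \<le> m" for m n
      using that
    proof (induction m rule: dec_induct)
      case base then show ?case using s(1) nbhd_zero by (simp add: minus_eq r_neg)
    next
      case (step m)
      have "s (Suc m) \<ominus> s m \<in> nbhd n" using s(2)[of m] nbhd_antimono[of n m] step by auto
      then show ?case using nbhd_minus_trans[OF _ step.IH] s(1) by blast
    qed
    let ?F = "filtermap s sequentially"
    have "cauchy_in A ?F"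
      unfolding cauchy_in_def
    proof (intro allI impI)
      fix U assume "openin (topo A) U \<and> \<zero> \<in> U"
      then obtain n where n: "nbhd n \<subseteq> U" using nbhd_small by blast
      have "x \<ominus> y \<in> U" if "x \<in> s ` {n..}" "y \<in> s ` {n..}" for x y
      proof -
        have xy: "x \<ominus> s n \<in> nbhd n" "y \<ominus> s n \<in> nbhd n" "x \<in> carrier A" "y \<in> carrier A"
          using that far s(1) by auto
        then show ?thesis using nbhd_minus_trans[OF xy(1) nbhd_minus_swap[OF xy(2)]] s(1) n by auto
      qed
      moreover have "eventually (\<lambda>x. x \<in> s ` {n..}) ?F"
        unfolding eventually_filtermap eventually_sequentially by auto
      ultimately show "\<exists>S\<subseteq>carrier A. (\<forall>\<^sub>F x in ?F. x \<in> S) \<and> (\<forall>x\<in>S. \<forall>y\<in>S. x \<ominus> y \<in> U)"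
        using s(1) by (intro exI[of _ "s ` {n..}"]) auto
    qed
    moreover have "?F \<noteq> bot" by (simp add: filtermap_bot_iff)
    ultimately obtain l where l: "limitin (topo A) (\<lambda>x. x) l ?F"
      using complete unfolding complete_ring_def by blast
    then have lc: "l \<in> carrier A" by (simp add: limitin_def topspace_topo)
    have "l \<ominus> s n \<in> nbhd n" for n
    proof -
      let ?U = "(\<lambda>y. l \<oplus> y) ` nbhd n"
      have "l \<in> ?U" using lc nbhd_zero by (intro image_eqI[of _ _ \<zero>]) auto
      then have "eventually (\<lambda>m. s m \<in> ?U) sequentially"
        using l open_translate[OF lc nbhd_open] unfolding limitin_def eventually_filtermap by blast
      then obtain m where m: "m \<ge> n" "s m \<in> ?U"
        unfolding eventually_sequentially by (meson linorder_le_cases order_refl)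
      then obtain y where y: "y \<in> nbhd n" "s m = l \<oplus> y" by blast
      then have "s m \<ominus> l = y" using lc nbhd_closed[OF y(1)] by (simp add: minus_eq a_ac r_neg1 r_neg2 r_neg a_lcomm[of l y])
      then have "s m \<ominus> l \<in> nbhd n" using y by simp
      then show ?thesis using nbhd_minus_trans[OF nbhd_minus_swap far[OF m(1)]] lc s(1) by blast
    qed
    then show ?thesis using lc by blast
  qed
  show ?thesis
    by unfold_locales (use open_iff sep compl in auto)
qed

context topological_tate_lattice
begin

lemma topspace_eq: "topspace (topo A) = carrier A"
proof -
  have "openin (topo A) (carrier A)" using nbhd_closed by (auto simp: open_iff)
  then show ?thesis using open_iff[of "topspace (topo A)"] openin_subset by blast
qed

end

text \<open>Open mapping yields one neighbourhood inside the image of the lattice; scaling by powers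
  of the unit yields one inside the image of each neighbourhood, and translation moves this to every
  point.\<close>

lemma quotient_map_if_surj:
  fixes D :: "'d huber_pair" and C :: "'c huber_pair"
  assumes hom: "lattice_hom D L s C M t \<phi>"
    and D: "topological_tate_lattice D L s" and C: "topological_tate_lattice C M t"
    and surj: "\<phi> ` carrier D = carrier C"
  shows "quotient_map (topo D) (topo C) \<phi>"
proof -
  interpret lattice_hom D L s C M t \<phi> by fact
  interpret D: topological_tate_lattice D L s by fact
  interpret C: topological_tate_lattice C M t by fact
  obtain k where k: "C.nbhd k \<subseteq> \<phi> ` L" using open_mapping[OF surj] by blast
  have "openin (topo D) {x \<in> carrier D. \<phi> x \<in> U} \<longleftrightarrow> openin (topo C) U" if U: "U \<subseteq> carrier C" for U
  proof
    assume pre: "openin (topo D) {x \<in> carrier D. \<phi> x \<in> U}"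
    show "openin (topo C) U"
      unfolding C.open_iff
    proof (intro conjI ballI U)
      fix y assume y: "y \<in> U"
      then obtain x where x: "x \<in> carrier D" "y = \<phi> x" using U surj by blast
      then obtain n where n: "\<forall>z\<in>D.nbhd n. x \<oplus>\<^bsub>D\<^esub> z \<in> {x \<in> carrier D. \<phi> x \<in> U}"
        using pre y unfolding D.open_iff by blast
      have "y \<oplus>\<^bsub>C\<^esub> z \<in> U" if z: "z \<in> C.nbhd (n + k)" for z
      proof -
        obtain c where c: "c \<in> M" "z = t [^]\<^bsub>C\<^esub> (n + k) \<otimes>\<^bsub>C\<^esub> c" using z by (rule C.nbhdE)
        have "t [^]\<^bsub>C\<^esub> k \<otimes>\<^bsub>C\<^esub> c \<in> \<phi> ` L" using k C.nbhdI[OF c(1)] by blast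
        then obtain l where l: "l \<in> L" "t [^]\<^bsub>C\<^esub> k \<otimes>\<^bsub>C\<^esub> c = \<phi> l" by blast
        have lc: "l \<in> carrier D" using l D.L_closed by blast
        have "z = \<phi> (s [^]\<^bsub>D\<^esub> n \<otimes>\<^bsub>D\<^esub> l)"
          using c lc C.L_closed[OF c(1)]
          by (simp add: hom_pow hom_unit l(2)[symmetric] C.nat_pow_mult[symmetric] C.m_assoc)
        then have "y \<oplus>\<^bsub>C\<^esub> z = \<phi> (x \<oplus>\<^bsub>D\<^esub> s [^]\<^bsub>D\<^esub> n \<otimes>\<^bsub>D\<^esub> l)" using x lc by simp
        then show ?thesis using n D.nbhdI[OF l(1), of n] by auto
      qed
      then show "\<exists>n. \<forall>z\<in>C.nbhd n. y \<oplus>\<^bsub>C\<^esub> z \<in> U" by blast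
    qed
  next
    assume op: "openin (topo C) U"
    show "openin (topo D) {x \<in> carrier D. \<phi> x \<in> U}"
      unfolding D.open_iff
    proof (intro conjI ballI)
      fix x assume x: "x \<in> {x \<in> carrier D. \<phi> x \<in> U}"
      then obtain n where n: "\<forall>z\<in>C.nbhd n. \<phi> x \<oplus>\<^bsub>C\<^esub> z \<in> U" using op unfolding C.open_iff by blast
      have "x \<oplus>\<^bsub>D\<^esub> z \<in> {x \<in> carrier D. \<phi> x \<in> U}" if "z \<in> D.nbhd n" for z
        using x n hom_nbhd[OF that] D.nbhd_closed[OF that] by simp
      then show "\<exists>n. \<forall>z\<in>D.nbhd n. x \<oplus>\<^bsub>D\<^esub> z \<in> {x \<in> carrier D. \<phi> x \<in> U}" by blast
    qed auto
  qed
  then show ?thesis unfolding quotient_map_def C.topspace_eq D.topspace_eq using surj by simp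
qed

lemma lattice_hom_compose:
  assumes f: "lattice_hom A L s B M t f" and g: "lattice_hom B M t C N u g"
  shows "lattice_hom A L s C N u (g \<circ> f)"
proof -
  interpret f: lattice_hom A L s B M t f by fact
  interpret g: lattice_hom B M t C N u g by fact
  show ?thesis
  proof
    show "g \<circ> f \<in> ring_hom A C" using ring_hom_trans[OF f.hom g.hom] .
    show "(g \<circ> f) s = u" by (simp add: f.hom_unit g.hom_unit)
    show "(g \<circ> f) ` L \<subseteq> N" using f.hom_lattice g.hom_lattice by auto
  qed
qed

section \<open>Transfer along homomorphisms\<close>

lemma ring_hom_pow:
  assumes "f \<in> ring_hom A B" "ring A" "ring B" "x \<in> carrier A"
  shows "f (x [^]\<^bsub>A\<^esub> (k::nat)) = f x [^]\<^bsub>B\<^esub> k"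
  using ring_hom_ring.hom_nat_pow[OF ring_hom_ringI2[OF assms(2,3,1)] assms(4)] .

lemma hom_Units:
  assumes f: "f \<in> ring_hom A B" and A: "ring A" and x: "x \<in> Units A"
  shows "f x \<in> Units B"
proof -
  interpret A: ring A by fact
  have "x \<in> carrier A" "inv\<^bsub>A\<^esub> x \<in> carrier A" "x \<otimes>\<^bsub>A\<^esub> inv\<^bsub>A\<^esub> x = \<one>\<^bsub>A\<^esub>" "inv\<^bsub>A\<^esub> x \<otimes>\<^bsub>A\<^esub> x = \<one>\<^bsub>A\<^esub>"
    using x by auto
  then have "f x \<in> carrier B" "f (inv\<^bsub>A\<^esub> x) \<in> carrier B"
    "f x \<otimes>\<^bsub>B\<^esub> f (inv\<^bsub>A\<^esub> x) = \<one>\<^bsub>B\<^esub>" "f (inv\<^bsub>A\<^esub> x) \<otimes>\<^bsub>B\<^esub> f x = \<one>\<^bsub>B\<^esub>"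
    using ring_hom_mult[OF f] ring_hom_one[OF f] ring_hom_closed[OF f] by metis+
  then show ?thesis unfolding Units_def by blast
qed

lemma subring_preimage:
  assumes f: "f \<in> ring_hom A B" and "ring A" "ring B" and K: "subring K B"
  shows "subring {x \<in> carrier A. f x \<in> K} A"
proof -
  interpret ring_hom_ring A B f using ring_hom_ringI2 assms by blast
  show ?thesis using subringE[OF K] by (intro R.subringI) auto
qed

lemma top_nilpotent_hom:
  assumes "topological_cring A" "topological_cring B" and f: "f \<in> ring_hom A B"
    and cont: "continuous_map (topo A) (topo B) f" and x: "topologically_nilpotent A x"
  shows "topologically_nilpotent B (f x)"
proof -
  interpret A: topological_cring A by fact
  interpret B: topological_cring B by fact
  interpret ring_hom_ring A B f using ring_hom_ringI2 f A.ring_axioms B.ring_axioms by blast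
  have xc: "x \<in> carrier A" using x by (simp add: topologically_nilpotent_def)
  have "limitin (topo B) (f \<circ> (\<lambda>n::nat. x [^]\<^bsub>A\<^esub> n)) (f \<zero>\<^bsub>A\<^esub>) sequentially"
    using continuous_map_limit[OF cont] x unfolding topologically_nilpotent_def by blast
  moreover have "f \<circ> (\<lambda>n::nat. x [^]\<^bsub>A\<^esub> n) = (\<lambda>n. f x [^]\<^bsub>B\<^esub> n)"
    using hom_nat_pow[OF xc] by auto
  ultimately show ?thesis using xc by (simp add: topologically_nilpotent_def)
qed

lemma integral_elem_mono:
  assumes "integral_elem R C x" "C \<subseteq> D" shows "integral_elem R D x"
proof -
  obtain n :: nat and c where c: "c \<in> {..<n} \<rightarrow> C"
    "x [^]\<^bsub>R\<^esub> n \<oplus>\<^bsub>R\<^esub> (\<Oplus>\<^bsub>R\<^esub>i\<in>{..<n}. c i \<otimes>\<^bsub>R\<^esub> x [^]\<^bsub>R\<^esub> i) = \<zero>\<^bsub>R\<^esub>" "x \<in> carrier R"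
    using assms(1) unfolding integral_elem_def by blast
  moreover have "c \<in> {..<n} \<rightarrow> D" using c(1) assms(2) by auto
  ultimately show ?thesis unfolding integral_elem_def by blast
qed

lemma integral_elem_finite:
  assumes "integral_elem R C x" shows "\<exists>E\<subseteq>C. finite E \<and> integral_elem R E x"
proof -
  obtain n :: nat and c where c: "c \<in> {..<n} \<rightarrow> C"
    "x [^]\<^bsub>R\<^esub> n \<oplus>\<^bsub>R\<^esub> (\<Oplus>\<^bsub>R\<^esub>i\<in>{..<n}. c i \<otimes>\<^bsub>R\<^esub> x [^]\<^bsub>R\<^esub> i) = \<zero>\<^bsub>R\<^esub>" "x \<in> carrier R"
    using assms unfolding integral_elem_def by blast
  then have "integral_elem R (c ` {..<n}) x" unfolding integral_elem_def by blast
  moreover have "c ` {..<n} \<subseteq> C" using c(1) by auto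
  ultimately show ?thesis by blast
qed

text \<open>The coefficients are lifted along \<open>f\<close>, and injectivity reflects the
  vanishing of the equation from \<open>B\<close> to \<open>A\<close>.\<close>

lemma integral_elem_inj:
  assumes A: "cring A" and B: "cring B" and f: "f \<in> ring_hom A B" and inj: "inj_on f (carrier A)"
    and Q: "Q \<subseteq> carrier A" and a: "a \<in> carrier A" and int: "integral_elem B (f ` Q) (f a)"
  shows "integral_elem A Q a"
proof -
  interpret A: cring A by fact
  interpret B: cring B by fact
  interpret ring_hom_cring A B f using f by unfold_locales
  note pow = ring_hom_pow[OF f A.ring_axioms B.ring_axioms]
  obtain n :: nat and c where c: "c \<in> {..<n} \<rightarrow> f ` Q"
    "f a [^]\<^bsub>B\<^esub> n \<oplus>\<^bsub>B\<^esub> (\<Oplus>\<^bsub>B\<^esub>i\<in>{..<n}. c i \<otimes>\<^bsub>B\<^esub> f a [^]\<^bsub>B\<^esub> i) = \<zero>\<^bsub>B\<^esub>"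
    using int unfolding integral_elem_def by blast
  have "\<forall>i\<in>{..<n}. \<exists>d\<in>Q. c i = f d" using c(1) by auto
  then obtain d where d: "\<And>i. i < n \<Longrightarrow> d i \<in> Q" "\<And>i. i < n \<Longrightarrow> c i = f (d i)" by (metis lessThan_iff)
  have dc: "d i \<in> carrier A" if "i < n" for i using d(1)[OF that] Q by blast
  let ?s = "\<Oplus>\<^bsub>A\<^esub>i\<in>{..<n}. d i \<otimes>\<^bsub>A\<^esub> a [^]\<^bsub>A\<^esub> i"
  have s: "?s \<in> carrier A" using dc a by (intro A.finsum_closed) auto
  have "f ?s = (\<Oplus>\<^bsub>B\<^esub>i\<in>{..<n}. (f \<circ> (\<lambda>i. d i \<otimes>\<^bsub>A\<^esub> a [^]\<^bsub>A\<^esub> i)) i)"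
    using dc a by (intro hom_finsum) auto
  also have "\<dots> = (\<Oplus>\<^bsub>B\<^esub>i\<in>{..<n}. c i \<otimes>\<^bsub>B\<^esub> f a [^]\<^bsub>B\<^esub> i)"
    using dc a d by (intro B.finsum_cong') (auto simp: pow)
  finally have "f (a [^]\<^bsub>A\<^esub> n \<oplus>\<^bsub>A\<^esub> ?s) = f \<zero>\<^bsub>A\<^esub>" using c(2) a s by (simp add: pow)
  then have "a [^]\<^bsub>A\<^esub> n \<oplus>\<^bsub>A\<^esub> ?s = \<zero>\<^bsub>A\<^esub>" using a s by (intro inj_onD[OF inj]) auto
  then show ?thesis using d a unfolding integral_elem_def by blast
qed

lemma exponent_induct [consumes 1, case_names zero add]:
  fixes \<nu> :: "nat \<Rightarrow>\<^sub>0 nat"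
  assumes "Poly_Mapping.keys \<nu> \<subseteq> {..<n}" "P 0"
    and step: "\<And>\<nu> j. j < n \<Longrightarrow> Poly_Mapping.keys \<nu> \<subseteq> {..<n} \<Longrightarrow> P \<nu> \<Longrightarrow>
      P (Poly_Mapping.single j 1 + \<nu>)"
  shows "P \<nu>"
  using assms(1)
proof (induction "\<Sum>k<n. Poly_Mapping.lookup \<nu> k" arbitrary: \<nu> rule: less_induct)
  case less
  show ?case
  proof (cases "\<nu> = 0")
    case True then show ?thesis using assms(2) by simp
  next
    case False
    then have "Poly_Mapping.keys \<nu> \<noteq> {}" by simp
    then obtain j where j: "j \<in> Poly_Mapping.keys \<nu>" by blast
    then have jn: "j < n" using less.prems by auto
    define \<mu> where "\<mu> = \<nu> - Poly_Mapping.single j 1"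
    have lk: "Poly_Mapping.lookup \<mu> k = Poly_Mapping.lookup \<nu> k - (if k = j then 1 else 0)" for k
      by (auto simp: \<mu>_def lookup_minus lookup_single when_def)
    have pos: "Poly_Mapping.lookup \<nu> j > 0" using j by (simp add: in_keys_iff)
    have eq: "\<nu> = Poly_Mapping.single j 1 + \<mu>"
      using pos by (intro poly_mapping_eqI) (auto simp: lookup_add lk lookup_single when_def)
    have "Poly_Mapping.keys \<mu> \<subseteq> {..<n}"
      using less.prems lk by (auto simp: in_keys_iff subset_iff)
    moreover have "(\<Sum>k<n. Poly_Mapping.lookup \<mu> k) < (\<Sum>k<n. Poly_Mapping.lookup \<nu> k)"
      using jn pos by (intro sum_strict_mono_ex1) (auto simp: lk)
    ultimately have "P \<mu>" using less.hyps by blast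
    then show ?thesis using step[OF jn \<open>Poly_Mapping.keys \<mu> \<subseteq> {..<n}\<close>] eq by simp
  qed
qed

section \<open>The descent of topological finiteness\<close>

text \<open>The map \<open>f\<close> presents \<open>B\<close>, and \<open>\<phi>\<close> will be an evaluation that factors through \<open>A\<close>. Stability of the
  span of \<open>G\<close> under the images of the variables passes to polynomials and then, by successive
  approximation, to restricted series.\<close>

locale finite_evaluation =
  T: tate_series R L u n + X: tate_series R L u m + E: lattice_hom "tate_algebra m R" "X.series_in L" "const_series R u" B M v \<phi>
  for R :: "'r huber_pair" and L u n m and B :: "('b, 'k) ring_scheme" (structure) and M v \<phi> +
  fixes f G
  assumes f_hom: "f \<in> ring_hom (tate_algebra n R) B"
    and f_const: "\<And>r. r \<in> carrier R \<Longrightarrow> f (const_series R r) = \<phi> (const_series R r)"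
    and G: "finite G" "G \<subseteq> M" "\<one> \<in> G"
    and G_stable: "\<And>j g. j < n \<Longrightarrow> g \<in> G \<Longrightarrow>
      f (mono_series R (Poly_Mapping.single j 1) \<one>\<^bsub>R\<^esub>) \<otimes> g \<in> lin_span B (\<phi> ` X.series_in L) (\<lambda>g. g) G"
begin

abbreviation "spn K \<equiv> lin_span B (\<phi> ` X.series_in K) (\<lambda>g. g) G"

lemma G_carrier: "(\<lambda>g. g) \<in> G \<rightarrow> carrier B"
  using G E.C.L_closed by auto

sublocale f: ring_hom_ring "tate_algebra n R" B f
  using f_hom by (intro ring_hom_ringI2 T.S.ring_axioms E.C.ring_axioms)

lemma const_in: "subring K R \<Longrightarrow> c \<in> K \<Longrightarrow> const_series R c \<in> X.series_in K"
  using subringE(1,2)[of K R] X.const_closed by (auto simp: X.series_in_def const_series_def)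

lemma series_in_mono: "K \<subseteq> K' \<Longrightarrow> X.series_in K \<subseteq> X.series_in K'"
  by (auto simp: X.series_in_def)

lemma spn_mono: "K \<subseteq> K' \<Longrightarrow> spn K \<subseteq> spn K'"
  using series_in_mono by (intro span_mono image_mono)

lemma img_subring: "subring K R \<Longrightarrow> subring (\<phi> ` X.series_in K) B"
  using ring_hom_ring.img_is_subring[OF ring_hom_ringI2[OF X.S.ring_axioms E.C.ring_axioms E.hom]
      X.subring_series_in] .

text \<open>One in \<open>G\<close> starts the induction with constants, and stability under the
  variables carries it on. Stability over \<open>L\<close> is enough, since coefficients from the
  larger \<open>K\<close> can be multiplied in afterwards.\<close>

lemma f_mono_in:
  assumes K: "subring K R" "L \<subseteq> K" and \<nu>: "Poly_Mapping.keys \<nu> \<subseteq> {..<n}" and c: "c \<in> K"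
  shows "f (mono_series R \<nu> c) \<in> spn K"
  using \<nu>
proof (induction rule: exponent_induct)
  note CK = E.C.subring_coeffs[OF img_subring[OF K(1)]]
  interpret CK: coeffs B "\<phi> ` X.series_in K" by (rule CK)
  have cR: "c \<in> carrier R" using c subringE(1)[OF K(1)] by auto
  {
    case zero
    have "f (mono_series R 0 c) = \<phi> (const_series R c)"
      using f_const[OF cR] by (simp add: const_series_eq_mono)
    moreover have "\<phi> (const_series R c) \<otimes> \<one> \<in> spn K"
      using CK.span_base[OF G_carrier G(1,3)] const_in[OF K(1) c] by blast
    ultimately show ?case using X.const_closed[OF cR] by simp
  next
    case (add \<nu> j)
    let ?x = "mono_series R (Poly_Mapping.single j 1) \<one>\<^bsub>R\<^esub>"
    have x: "?x \<in> carrier (tate_algebra n R)" using add.hyps by (intro T.mono_closed) auto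
    have m: "mono_series R \<nu> c \<in> carrier (tate_algebra n R)" using add.hyps cR by (intro T.mono_closed)
    have "mono_series R (Poly_Mapping.single j 1 + \<nu>) c = ?x \<otimes>\<^bsub>tate_algebra n R\<^esub> mono_series R \<nu> c"
      using T.mono_mult[OF T.R.one_closed cR, of \<nu> "Poly_Mapping.single j 1"] add.hyps cR by simp
    then have "f (mono_series R (Poly_Mapping.single j 1 + \<nu>) c) = f ?x \<otimes> f (mono_series R \<nu> c)"
      using x m by simp
    also have "\<dots> \<in> spn K"
    proof (rule E.C.span_mult[OF CK CK G_carrier G(1) G_carrier _ _ add.IH])
      show "f ?x \<in> carrier B" using x by simp
      fix d g assume d: "d \<in> \<phi> ` X.series_in K" and g: "g \<in> G"
      have "f ?x \<otimes> g \<in> spn K" using G_stable[OF add.hyps(1) g] spn_mono[OF K(2)] by blast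
      then have "d \<otimes> (f ?x \<otimes> g) \<in> spn K"
        by (rule E.C.span_scale[OF img_subring[OF K(1)] G_carrier G(1) d])
      moreover have "d \<otimes> (f ?x \<otimes> g) = f ?x \<otimes> (d \<otimes> g)"
        using d g CK.sub G_carrier x by (intro E.C.m_lcomm) auto
      ultimately show "f ?x \<otimes> (d \<otimes> g) \<in> spn K" by simp
    qed
    finally show ?case .
  }
qed

text \<open>\<open>K\<close> may be unbounded, yet the remainder has coefficients in the bounded
  \<open>L\<close>: a series in the first neighbourhood is \<open>u\<close> times a series over
  \<open>L\<close>. This is the passage from \<open>R\<^sup>+\<close> to
  \<open>R\<^sub>0\<close>.\<close>

lemma f_series_step:
  assumes K: "subring K R" "L \<subseteq> K" and h: "h \<in> T.series_in K"
  shows "\<exists>q\<in>spn K. \<exists>h'\<in>T.series_in L. f h = q \<oplus> v \<otimes> f h'"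
proof -
  interpret CK: coeffs B "\<phi> ` X.series_in K" by (rule E.C.subring_coeffs[OF img_subring[OF K(1)]])
  have hc: "h \<in> carrier (tate_algebra n R)" using h by (simp add: T.series_in_def)
  obtain p e where pe: "p \<in> carrier (tate_algebra n R)" "e \<in> T.S.nbhd 1"
    "h = p \<oplus>\<^bsub>tate_algebra n R\<^esub> e" "f p \<in> spn K"
  proof (rule T.polynomial_approx[OF hc, of "\<lambda>p. f p \<in> spn K"])
    show "f \<zero>\<^bsub>tate_algebra n R\<^esub> \<in> spn K" using CK.span_zero[OF G_carrier] by simp
    show "f (mono_series R \<nu> (h \<nu>)) \<in> spn K" if "Poly_Mapping.keys \<nu> \<subseteq> {..<n}" for \<nu>
      using h by (intro f_mono_in[OF K that]) (auto simp: T.series_in_def)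
  qed (auto intro: CK.span_add[OF G_carrier])
  obtain h' where h': "h' \<in> T.series_in L"
    "e = const_series R u [^]\<^bsub>tate_algebra n R\<^esub> (1::nat) \<otimes>\<^bsub>tate_algebra n R\<^esub> h'"
    using pe(2) by (rule T.S.nbhdE)
  have h'c: "h' \<in> carrier (tate_algebra n R)" using h' by (simp add: T.series_in_def)
  have uc: "const_series R u \<in> carrier (tate_algebra n R)" using T.const_closed by simp
  have "f h = f p \<oplus> f (const_series R u) \<otimes> f h'"
    using pe(1,3) h'(2) h'c uc by simp
  then have "f h = f p \<oplus> v \<otimes> f h'"
    using f_const[OF T.R.t_closed] E.hom_unit by simp
  then show ?thesis using pe(4) h'(1) by blast
qed

text \<open>\<open>bounded\<close> is the continuity of \<open>f\<close> at zero; it provides the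
  common denominator that successive approximation demands of the remainders.\<close>

lemma f_lattice_in:
  assumes bounded: "\<And>h. h \<in> T.S.nbhd k \<Longrightarrow> f h \<in> M"
  shows "f ` T.series_in L \<subseteq> spn L"
proof (rule E.successive_approximation[OF G(1,2)])
  show "f ` T.series_in L \<subseteq> carrier B" by (auto simp: T.series_in_def)
  have uc: "const_series R u \<in> carrier (tate_algebra n R)" using T.const_closed by simp
  show "v [^] k \<otimes> y \<in> M" if y: "y \<in> f ` T.series_in L" for y
  proof -
    obtain h where h: "h \<in> T.series_in L" "y = f h" using y by blast
    then have hc: "h \<in> carrier (tate_algebra n R)" by (simp add: T.series_in_def)
    have "f (const_series R u [^]\<^bsub>tate_algebra n R\<^esub> k \<otimes>\<^bsub>tate_algebra n R\<^esub> h) = f (const_series R u) [^] k \<otimes> y"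
      using h(2) hc uc f.hom_nat_pow[OF uc] by simp
    then show ?thesis
      using bounded[OF T.S.nbhdI[OF h(1)]] f_const[OF T.R.t_closed] E.hom_unit by simp
  qed
  show "\<exists>q\<in>spn L. \<exists>w\<in>f ` T.series_in L. y = q \<oplus> v \<otimes> w" if "y \<in> f ` T.series_in L" for y
    using that f_series_step[OF T.R.lattice order_refl] by blast
qed

text \<open>A single step over \<open>K\<close> is followed by the complete expansion over
  \<open>L\<close>. Multiplying the latter by \<open>v\<close>, the image of a constant, does not
  leave the span.\<close>

lemma f_series_in:
  assumes bounded: "\<And>h. h \<in> T.S.nbhd k \<Longrightarrow> f h \<in> M" and K: "subring K R" "L \<subseteq> K"
  shows "f ` T.series_in K \<subseteq> spn K"
proof
  fix y assume "y \<in> f ` T.series_in K"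
  then obtain q h' where q: "q \<in> spn K" "h' \<in> T.series_in L" "y = q \<oplus> v \<otimes> f h'"
    using f_series_step[OF K] by blast
  interpret CK: coeffs B "\<phi> ` X.series_in K" by (rule E.C.subring_coeffs[OF img_subring[OF K(1)]])
  have "f h' \<in> spn K" using f_lattice_in[OF bounded] q(2) spn_mono[OF K(2)] by blast
  moreover have "v \<in> \<phi> ` X.series_in K"
    using const_in[OF K(1), of u] T.R.t_lattice K(2) E.hom_unit by force
  ultimately have "v \<otimes> f h' \<in> spn K"
    using E.C.span_scale[OF img_subring[OF K(1)] G_carrier G(1)] by blast
  then show "y \<in> spn K" using q CK.span_add[OF G_carrier] by simp
qed

lemma f_image_in:
  assumes bounded: "\<And>h. h \<in> T.S.nbhd k \<Longrightarrow> f h \<in> M"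
  shows "f ` carrier (tate_algebra n R) \<subseteq> lin_span B (\<phi> ` carrier (tate_algebra m R)) (\<lambda>g. g) G"
proof -
  have "X.series_in (carrier R) = carrier (tate_algebra m R)" "T.series_in (carrier R) = carrier (tate_algebra n R)"
    using X.coeff_closed T.coeff_closed by (auto simp: X.series_in_def T.series_in_def)
  then show ?thesis
    using f_series_in[of k, OF bounded T.R.carrier_is_subring T.R.L_sub] by simp
qed

end

lemma enumerate_finite:
  assumes "finite E" obtains m :: nat and e where "E = e ` {..<m}"
  using ex_bij_betw_nat_finite[OF assms] by (auto simp: bij_betw_def lessThan_atLeast0)

lemma pair_homD:
  assumes "f \<in> pair_hom A B"
  shows "f \<in> ring_hom A B" "continuous_map (topo A) (topo B) f" "f ` plus_ring A \<subseteq> plus_ring B"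
  using assms by (auto simp: pair_hom_def)

lemma topologically_finite_typeE:
  assumes "topologically_finite_type A B \<phi>"
  obtains n f where "f \<in> ring_hom (tate_algebra n A) B"
    and "\<And>a. a \<in> carrier A \<Longrightarrow> f (const_series A a) = \<phi> a"
    and "f ` carrier (tate_algebra n A) = carrier B"
    and "quotient_map (topo (tate_algebra n A)) (topo B) f"
    and "f ` plus_ring (tate_algebra n A) \<subseteq> plus_ring B"
    and "\<And>b. b \<in> plus_ring B \<Longrightarrow> integral_elem B (f ` plus_ring (tate_algebra n A)) b"
  using assms unfolding topologically_finite_type_def
  by (elim conjE exE) (rule that; (assumption | (drule (1) bspec, assumption)))

theorem lemma4p2p4:
  fixes R :: "'r huber_pair" and A :: "'a huber_pair" and B :: "'b huber_pair"
    and \<rho>\<^sub>A :: "'r \<Rightarrow> 'a" and \<rho>\<^sub>B :: "'r \<Rightarrow> 'b" and i :: "'a \<Rightarrow> 'b"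
  assumes "complete_tate_huber_pair R" and "strongly_noetherian R"
    and "complete_tate_huber_pair A" and "\<rho>\<^sub>A \<in> pair_hom R A"
    and "complete_tate_huber_pair B" and "\<rho>\<^sub>B \<in> pair_hom R B"
    and "i \<in> pair_hom A B" and "\<forall>r\<in>carrier R. i (\<rho>\<^sub>A r) = \<rho>\<^sub>B r"
    and "finite_pair_hom A B i" and "inj_on i (carrier A)"
    and "topologically_finite_type R B \<rho>\<^sub>B"
  shows "topologically_finite_type R A \<rho>\<^sub>A"
proof -
  interpret R: complete_tate_huber_pair R by fact
  interpret A: complete_tate_huber_pair A by fact
  interpret B: complete_tate_huber_pair B by fact
  note rA = pair_homD[OF assms(4)] and rB = pair_homD[OF assms(6)] and ii = pair_homD[OF assms(7)]
  interpret i: ring_hom_ring A B i using ii(1) by (intro ring_hom_ringI2 A.ring_axioms B.ring_axioms)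
  interpret \<rho>: ring_hom_ring R A \<rho>\<^sub>A using rA(1) by (intro ring_hom_ringI2 R.ring_axioms A.ring_axioms)
  have noeth: "noetherian_ring (tate_algebra k R)" for k
    using assms(2) by (simp add: strongly_noetherian_def)
  have ring_T: "ring (tate_algebra k R)" for k
    using noeth[of k] by (simp add: noetherian_ring_def)
  note Rp = subringE[OF R.plus_subring] and Ap = subringE[OF A.plus_subring] and Bp = subringE[OF B.plus_subring]

  \<comment> \<open>Corresponding topologically nilpotent units\<close>
  obtain u where u: "u \<in> Units R" "topologically_nilpotent R u" using R.top_nilpotent_unit by blast
  have uc: "u \<in> carrier R" using u by auto
  define v where "v = \<rho>\<^sub>A u"
  define w where "w = i v"
  have v: "v \<in> Units A" "topologically_nilpotent A v"
    using hom_Units[OF rA(1) R.ring_axioms u(1)] u(2)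
      top_nilpotent_hom[OF R.topological_cring_axioms A.topological_cring_axioms rA(1,2)]
    by (auto simp: v_def)
  have w: "w \<in> Units B" "topologically_nilpotent B w"
    using hom_Units[OF ii(1) A.ring_axioms v(1)] v(2)
      top_nilpotent_hom[OF A.topological_cring_axioms B.topological_cring_axioms ii(1,2)]
    by (auto simp: w_def)

  \<comment> \<open>Integral equations for the images of the variables\<close>
  obtain n f where f: "f \<in> ring_hom (tate_algebra n R) B"
    and f_const: "\<And>r. r \<in> carrier R \<Longrightarrow> f (const_series R r) = \<rho>\<^sub>B r"
    and f_surj: "f ` carrier (tate_algebra n R) = carrier B"
    and f_quot: "quotient_map (topo (tate_algebra n R)) (topo B) f"
    and f_plus: "f ` plus_ring (tate_algebra n R) \<subseteq> plus_ring B"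
    and f_int: "\<And>b. b \<in> plus_ring B \<Longrightarrow> integral_elem B (f ` plus_ring (tate_algebra n R)) b"
    by (rule topologically_finite_typeE[OF assms(11)]) (rule that; assumption)
  define b where "b j = f (mono_series R (Poly_Mapping.single j 1) \<one>\<^bsub>R\<^esub>)" for j
  have var_plus: "mono_series R (Poly_Mapping.single j 1) \<one>\<^bsub>R\<^esub> \<in> plus_ring (tate_algebra k R)" if jk: "j < k" for j k
  proof -
    have "{\<nu>. mono_series R (Poly_Mapping.single j 1) \<one>\<^bsub>R\<^esub> \<nu> \<notin> U} \<subseteq> {Poly_Mapping.single j 1}"
      if "\<zero>\<^bsub>R\<^esub> \<in> U" for U
      using that by (auto simp: mono_series_def)
    then have "finite {\<nu>. mono_series R (Poly_Mapping.single j 1) \<one>\<^bsub>R\<^esub> \<nu> \<notin> U}" if "\<zero>\<^bsub>R\<^esub> \<in> U" for U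
      using that by (auto intro: finite_subset[OF _ finite.insertI[OF finite.emptyI]])
    moreover have "range (mono_series R (Poly_Mapping.single j 1) \<one>\<^bsub>R\<^esub>) \<subseteq> plus_ring R"
      "\<And>\<nu>. \<not> Poly_Mapping.keys \<nu> \<subseteq> {..<k} \<Longrightarrow> mono_series R (Poly_Mapping.single j 1) \<one>\<^bsub>R\<^esub> \<nu> = \<zero>\<^bsub>R\<^esub>"
      using jk Rp(2,3) by (auto simp: mono_series_def)
    ultimately show ?thesis
      using order_trans[OF _ Rp(1)] by (simp add: tate_algebra_def restricted_series_def)
  qed
  have b_plus: "b j \<in> plus_ring B" if "j < n" for j
    using var_plus[OF that] f_plus by (auto simp: b_def)

  \<comment> \<open>Each \<open>b j\<close> is integral over the image of \<open>A\<^sup>+\<close>,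
    and its equation has finitely many coefficients; their preimages in \<open>A\<^sup>+\<close>
    will be the values of the variables \<open>X\<close>.\<close>
  have "\<exists>E\<subseteq>plus_ring A. finite E \<and> integral_elem B (i ` E) (b j)" if j: "j < n" for j
  proof -
    have "integral_elem B (i ` plus_ring A) (b j)"
      using assms(9) b_plus[OF j] by (simp add: finite_pair_hom_def)
    from integral_elem_finite[OF this]
    obtain E where E: "E \<subseteq> i ` plus_ring A" "finite E" "integral_elem B E (b j)"
      by (elim exE conjE)
    obtain E' where "E' \<subseteq> plus_ring A" "finite E'" "E = i ` E'"
      using finite_subset_image[OF E(2,1)] by (elim exE conjE)
    then show ?thesis using E(3) by (intro exI[of _ E']) simp
  qed
  then obtain E' where E': "\<And>j. j < n \<Longrightarrow> E' j \<subseteq> plus_ring A" "\<And>j. j < n \<Longrightarrow> finite (E' j)"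
    "\<And>j. j < n \<Longrightarrow> integral_elem B (i ` E' j) (b j)" by metis
  define E where "E = (\<Union>j<n. E' j)"
  have E: "finite E" "E \<subseteq> plus_ring A" using E' by (auto simp: E_def)
  have b_int: "integral_elem B (i ` E) (b j)" if "j < n" for j
    by (rule integral_elem_mono[OF E'(3)[OF that]]) (use that in \<open>auto simp: E_def\<close>)
  obtain m :: nat and e where Ee: "E = e ` {..<m}" using enumerate_finite[OF E(1)] by blast

  \<comment> \<open>Compatible lattices\<close>
  obtain N where N: "bounded_lattice B w N" "insert w (b ` {..<n} \<union> i ` E) \<subseteq> N"
  proof -
    have "insert w (b ` {..<n} \<union> i ` E) \<subseteq> power_bounded B"
      using B.top_nilpotent_in_plus[OF w(2)] b_plus E(2) ii(3) B.plus_power_bounded by blast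
    then show ?thesis using B.bounded_lattice_containing[OF w(2)] E(1) that by (metis finite.insertI finite_UnI finite_imageI finite_lessThan)
  qed
  obtain M where M: "bounded_lattice A v M" "insert v E \<subseteq> M" "i ` M \<subseteq> N"
  proof -
    have "insert v E \<subseteq> power_bounded A"
      using A.top_nilpotent_in_plus[OF v(2)] E(2) A.plus_power_bounded by blast
    then obtain M' where M': "bounded_lattice A v M'" "insert v E \<subseteq> M'"
      using A.bounded_lattice_containing[OF v(2)] E(1) by (metis finite.insertI)
    \<comment> \<open>Intersecting with the preimage of \<open>N\<close> keeps the lattice bounded
      and lets \<open>i\<close> map it into \<open>N\<close>. This forces the lattices to be chosen
      in the order \<open>B\<close>, \<open>A\<close>, \<open>R\<close>.\<close>
    let ?K = "{x \<in> carrier A. i x \<in> N}"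
    have "subring ?K A" "openin (topo A) ?K"
      using subring_preimage[OF ii(1) A.ring_axioms B.ring_axioms] N(1)
        openin_continuous_map_preimage[OF ii(2)]
      by (auto simp: bounded_lattice_def A.topspace_topo)
    then have "bounded_lattice A v (M' \<inter> ?K)" using A.bounded_lattice_subset M'(1) by blast
    moreover have "insert v E \<subseteq> M' \<inter> ?K"
      using M'(2) N(2) E(2) Ap(1) v(1) by (auto simp: w_def)
    ultimately show ?thesis using that by blast
  qed
  obtain L where L: "bounded_lattice R u L" "u \<in> L" "L \<subseteq> plus_ring R" "\<rho>\<^sub>A ` L \<subseteq> M"
  proof -
    have "{u} \<subseteq> power_bounded R"
      using R.top_nilpotent_in_plus[OF u(2)] R.plus_power_bounded by blast
    then obtain L' where L': "bounded_lattice R u L'" "{u} \<subseteq> L'"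
      using R.bounded_lattice_containing[OF u(2)] by (metis finite.emptyI finite.insertI)
    let ?K = "{x \<in> carrier R. \<rho>\<^sub>A x \<in> M}"
    have "subring ?K R" "openin (topo R) ?K"
      using subring_preimage[OF rA(1) R.ring_axioms A.ring_axioms] M(1)
        openin_continuous_map_preimage[OF rA(2)]
      by (auto simp: bounded_lattice_def R.topspace_topo)
    \<comment> \<open>The lattice of \<open>R\<close> is also cut down to \<open>R\<^sup>+\<close>,
      so that an expansion over it is in particular one over \<open>R\<^sup>+\<close>.\<close>
    then have "bounded_lattice R u (L' \<inter> ?K \<inter> plus_ring R)"
      using R.bounded_lattice_subset L'(1) R.plus_subring R.plus_open by blast
    moreover have "u \<in> L' \<inter> ?K \<inter> plus_ring R"
      using L'(2) M(2) uc R.top_nilpotent_in_plus[OF u(2)] by (auto simp: v_def)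
    ultimately show ?thesis using that by blast
  qed
  interpret B': topological_tate_lattice B N w
    using B.topological_tate_lattice N w(1) by blast
  interpret A': topological_tate_lattice A M v
    using A.topological_tate_lattice M v(1) by blast
  interpret R': topological_tate_lattice R L u
    using R.topological_tate_lattice L u(1) by blast
  have lat_\<rho>: "lattice_hom R L u A M v \<rho>\<^sub>A"
    by unfold_locales (use rA(1) L(4) in \<open>auto simp: v_def\<close>)
  have lat_i: "lattice_hom A M v B N w i"
    by unfold_locales (use ii(1) M(3) in \<open>auto simp: w_def\<close>)
  have series: "tate_series R L u k" for k
    by (intro tate_series.intro tate_series_axioms.intro ring_T R'.topological_tate_lattice_axioms)
  have eM: "e j \<in> M" if "j < m" for j using M(2) that by (auto simp: Ee)

  \<comment> \<open>Finite generation of \<open>B\<close> over the series in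
    \<open>X\<close>\<close>
  interpret T: tate_series R L u n by (rule series)
  interpret X: tate_eval R L u m A M v \<rho>\<^sub>A e
    using series[of m] lat_\<rho> eM by (intro tate_eval.intro tate_eval_axioms.intro)
  define \<phi> where "\<phi> = i \<circ> X.ev"
  have lat_\<phi>: "lattice_hom (tate_algebra m R) (X.series_in L) (const_series R u) B N w \<phi>"
    unfolding \<phi>_def by (rule lattice_hom_compose[OF X.E.lattice_hom_axioms lat_i])
  interpret \<phi>: lattice_hom "tate_algebra m R" "X.series_in L" "const_series R u" B N w \<phi> by (rule lat_\<phi>)

  have plus_series: "plus_ring (tate_algebra k R) = {h \<in> carrier (tate_algebra k R). range h \<subseteq> plus_ring R}" for k
    by (simp add: tate_algebra_def)
  have T_plus: "T.series_in (plus_ring R) = plus_ring (tate_algebra n R)"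
    by (simp add: T.series_in_def plus_series)
  have X_plus: "X.series_in (plus_ring R) = plus_ring (tate_algebra m R)"
    by (simp add: X.series_in_def plus_series)
  have f_ring: "ring_hom_ring (tate_algebra n R) B f"
    using f by (intro ring_hom_ringI2 ring_T B.ring_axioms)
  let ?D = "f ` plus_ring (tate_algebra n R)"
  have D: "subring ?D B"
    using ring_hom_ring.img_is_subring[OF f_ring T.subring_series_in[OF R.plus_subring]]
    by (simp add: T_plus)

  have iE: "i ` E \<subseteq> \<phi> ` X.series_in L"
  proof
    fix y assume "y \<in> i ` E"
    then obtain j where j: "j < m" "y = i (e j)" by (auto simp: Ee)
    let ?x = "mono_series R (Poly_Mapping.single j 1) \<one>\<^bsub>R\<^esub>"
    have "?x \<in> carrier (tate_algebra m R)" using j(1) by (intro X.mono_closed) auto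
    then have "?x \<in> X.series_in L"
      using R'.L_zero R'.L_one by (auto simp: X.series_in_def mono_series_def)
    moreover have "\<phi> ?x = y" using X.ev_var[OF j(1)] j(2) by (simp add: \<phi>_def)
    ultimately show "y \<in> \<phi> ` X.series_in L" by blast
  qed
  \<comment> \<open>Membership in \<open>N\<close> is needed for convergence of the expansions,
    membership in \<open>?D\<close> for the integrality at the end: \<open>?D\<close> is a ring, so
    its products with \<open>G\<close> stay in it.\<close>
  have "\<exists>G. finite G \<and> G \<subseteq> N \<inter> ?D \<and> \<one>\<^bsub>B\<^esub> \<in> G \<and>
      (\<forall>y\<in>b ` {..<n}. \<forall>g\<in>G. y \<otimes>\<^bsub>B\<^esub> g \<in> lin_span B (\<phi> ` X.series_in L) (\<lambda>g. g) G)"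
  proof (rule B.finite_module_of_integrals)
    show "subring (\<phi> ` X.series_in L) B" by (rule \<phi>.img_lattice)
    show "subring (N \<inter> ?D) B" using B.subring_inter[OF B'.lattice D] .
    show "b ` {..<n} \<subseteq> N \<inter> ?D" using N(2) var_plus by (auto simp: b_def)
    show "integral_elem B (\<phi> ` X.series_in L) y" if "y \<in> b ` {..<n}" for y
      using that b_int integral_elem_mono[OF _ iE] by auto
  qed simp
  then obtain G where G: "finite G" "G \<subseteq> N" "G \<subseteq> ?D" "\<one>\<^bsub>B\<^esub> \<in> G"
    and bG': "\<forall>y\<in>b ` {..<n}. \<forall>g\<in>G. y \<otimes>\<^bsub>B\<^esub> g \<in> lin_span B (\<phi> ` X.series_in L) (\<lambda>g. g) G"
    by (elim exE conjE) (rule that; blast)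
  have bG: "b j \<otimes>\<^bsub>B\<^esub> g \<in> lin_span B (\<phi> ` X.series_in L) (\<lambda>g. g) G" if "j < n" "g \<in> G" for j g
    using bG' that by simp
  have \<phi>_const: "\<phi> (const_series R r) = \<rho>\<^sub>B r" if "r \<in> carrier R" for r
    using X.ev_const[OF that] assms(8) that by (simp add: \<phi>_def)
  interpret F: finite_evaluation R L u n m B N w \<phi> f G
    using f f_const \<phi>_const G bG by unfold_locales (auto simp: b_def)
  obtain k where f_bounded: "\<And>h. h \<in> T.S.nbhd k \<Longrightarrow> f h \<in> N"
  proof -
    have "openin (topo (tate_algebra n R)) {h \<in> topspace (topo (tate_algebra n R)). f h \<in> N}"
      using openin_continuous_map_preimage[OF quotient_imp_continuous_map[OF f_quot]] N(1)
      by (simp add: bounded_lattice_def)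
    moreover have "\<zero>\<^bsub>tate_algebra n R\<^esub> \<in> {h \<in> topspace (topo (tate_algebra n R)). f h \<in> N}"
      using ring_hom_zero[OF f ring_T B.ring_axioms] B'.L_zero by (simp add: T.S.topspace_eq)
    ultimately obtain k where "T.S.nbhd k \<subseteq> {h \<in> topspace (topo (tate_algebra n R)). f h \<in> N}"
      using T.S.open_contains_nbhd by blast
    then show ?thesis using that by blast
  qed
  have Gc: "G \<subseteq> carrier B" using G(2) B'.L_sub by blast

  \<comment> \<open>Finite generation of \<open>A\<close> by noetherianness\<close>
  interpret NA: noetherian_action "tate_algebra m R" B \<phi>
    using noeth[of m] \<phi>.hom by (intro noetherian_action.intro noetherian_action_axioms.intro B.cring_axioms)
  have X_act: "\<phi> s \<otimes>\<^bsub>B\<^esub> i a = i (X.ev s \<otimes>\<^bsub>A\<^esub> a)"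
    if "s \<in> carrier (tate_algebra m R)" "a \<in> carrier A" for s a
    using that X.ev_closed by (simp add: \<phi>_def)
  \<comment> \<open>The action on \<open>B\<close> factors through \<open>A\<close>, so the image of
    \<open>A\<close> is stable under it.\<close>
  have submod: "NA.submod (i ` carrier A)"
    unfolding NA.submod_def
  proof (intro conjI ballI)
    show "\<zero>\<^bsub>B\<^esub> \<in> i ` carrier A" by (intro image_eqI[of _ _ "\<zero>\<^bsub>A\<^esub>"]) auto
    show "x \<oplus>\<^bsub>B\<^esub> y \<in> i ` carrier A" if xy: "x \<in> i ` carrier A" "y \<in> i ` carrier A" for x y
    proof -
      obtain a a' where aa: "a \<in> carrier A" "x = i a" "a' \<in> carrier A" "y = i a'" using xy by blast
      then have "x \<oplus>\<^bsub>B\<^esub> y = i (a \<oplus>\<^bsub>A\<^esub> a')" by simp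
      then show ?thesis using A.a_closed[OF aa(1,3)] by (rule image_eqI)
    qed
    show "\<phi> s \<otimes>\<^bsub>B\<^esub> x \<in> i ` carrier A"
      if s: "s \<in> carrier (tate_algebra m R)" and x: "x \<in> i ` carrier A" for s x
    proof -
      obtain a where a: "a \<in> carrier A" "x = i a" using x by blast
      show ?thesis unfolding a(2) X_act[OF s a(1)] using X.ev_closed[OF s] a(1) by (intro imageI A.m_closed)
    qed
  qed auto
  have i_spn: "i ` carrier A \<subseteq> NA.spn G"
    using F.f_image_in[of k, OF f_bounded] unfolding f_surj by auto
  obtain Y where Y: "finite Y" "Y \<subseteq> i ` carrier A" "i ` carrier A \<subseteq> NA.spn Y"
    using NA.submodule_finitely_generated[OF G(1) Gc submod i_spn] by (elim exE conjE)
  obtain Z where Z: "Z \<subseteq> carrier A" "finite Z" "Y = i ` Z"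
    using finite_subset_image[OF Y(1,2)] by (elim exE conjE)

  \<comment> \<open>The presentation of \<open>A\<close>\<close>
  obtain l where l: "A'.nbhd l \<subseteq> plus_ring A"
    using A'.open_contains_nbhd[OF A.plus_open Ap(2)] by blast
  \<comment> \<open>One power of \<open>v\<close> brings a generator into \<open>M\<close>, a
    further power into a neighbourhood contained in \<open>A\<^sup>+\<close>. As \<open>v\<close> is
    the image of the unit \<open>u\<close>, the scaling can be undone by constants of
    \<open>R\<close>.\<close>
  have "\<exists>k::nat. v [^]\<^bsub>A\<^esub> k \<otimes>\<^bsub>A\<^esub> z \<in> M \<inter> plus_ring A" if "z \<in> carrier A" for z
  proof -
    obtain k :: nat where "v [^]\<^bsub>A\<^esub> k \<otimes>\<^bsub>A\<^esub> z \<in> M" using A'.absorb \<open>z \<in> carrier A\<close> by blast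
    then have "v [^]\<^bsub>A\<^esub> l \<otimes>\<^bsub>A\<^esub> (v [^]\<^bsub>A\<^esub> k \<otimes>\<^bsub>A\<^esub> z) \<in> A'.nbhd l" by (rule A'.nbhdI)
    moreover have "v [^]\<^bsub>A\<^esub> (l + k) \<otimes>\<^bsub>A\<^esub> z = v [^]\<^bsub>A\<^esub> l \<otimes>\<^bsub>A\<^esub> (v [^]\<^bsub>A\<^esub> k \<otimes>\<^bsub>A\<^esub> z)"
      using that v(1) by (simp add: A.nat_pow_mult[symmetric] A.m_assoc)
    ultimately show ?thesis using l A'.nbhd_subset_L[of l] by (intro exI[of _ "l + k"]) auto
  qed
  then obtain \<kappa> :: "'a \<Rightarrow> nat" where \<kappa>: "\<And>z. z \<in> Z \<Longrightarrow> v [^]\<^bsub>A\<^esub> \<kappa> z \<otimes>\<^bsub>A\<^esub> z \<in> M \<inter> plus_ring A"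
    using Z(1) by (metis subsetD)
  obtain p d where pd: "(\<lambda>z. v [^]\<^bsub>A\<^esub> \<kappa> z \<otimes>\<^bsub>A\<^esub> z) ` Z = d ` {..<p::nat}"
    using enumerate_finite[OF finite_imageI[OF Z(2)]] by metis
  \<comment> \<open>The first \<open>m\<close> variables keep their values, so a series in
    \<open>X\<close> has the same value as before; the following \<open>p\<close> variables are
    \<open>Y\<close>.\<close>
  define a where "a j = (if j < m then e j else d (j - m))" for j
  have dM: "d j \<in> M \<inter> plus_ring A" if "j < p" for j
  proof -
    have "d j \<in> (\<lambda>z. v [^]\<^bsub>A\<^esub> \<kappa> z \<otimes>\<^bsub>A\<^esub> z) ` Z" unfolding pd using that by simp
    then show ?thesis using \<kappa> by auto
  qed
  have aM: "a j \<in> M" and a_plus: "a j \<in> plus_ring A" if "j < m + p" for j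
    using that dM[of "j - m"] eM[of j] E(2) by (auto simp: a_def Ee)
  interpret W: tate_eval R L u "m + p" A M v \<rho>\<^sub>A a
    using series[of "m + p"] lat_\<rho> aM by (intro tate_eval.intro tate_eval_axioms.intro)
  have W_X: "h \<in> carrier (tate_algebra (m + p) R)" "X.ev h = W.ev h"
    if "h \<in> carrier (tate_algebra m R)" for h
    using W.ev_cong[OF X.tate_eval_axioms _ _ that] by (auto simp: a_def)
  let ?I = "W.ev ` carrier (tate_algebra (m + p) R)"
  have I: "subring ?I A"
    using ring_hom_ring.img_is_subring[OF ring_hom_ringI2[OF ring_T A.ring_axioms W.ev_hom]
        ring.carrier_is_subring[OF ring_T]] .
  note I' = subringE[OF I]
  have Z_I: "z \<in> ?I" if z: "z \<in> Z" for z
  proof -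
    have zc: "z \<in> carrier A" using z Z(1) by blast
    have "v [^]\<^bsub>A\<^esub> \<kappa> z \<otimes>\<^bsub>A\<^esub> z \<in> d ` {..<p}" unfolding pd[symmetric] using z by (rule imageI)
    then obtain j where j: "j < p" "v [^]\<^bsub>A\<^esub> \<kappa> z \<otimes>\<^bsub>A\<^esub> z = d j" by auto
    have ev_d: "W.ev (mono_series R (Poly_Mapping.single (m + j) 1) \<one>\<^bsub>R\<^esub>) = d j"
      using W.ev_var[of "m + j"] j(1) by (simp add: a_def)
    have "mono_series R (Poly_Mapping.single (m + j) 1) \<one>\<^bsub>R\<^esub> \<in> carrier (tate_algebra (m + p) R)"
      using j(1) by (intro W.mono_closed) auto
    from imageI[OF this, of W.ev] have dI: "d j \<in> ?I" by (simp only: ev_d)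
    \<comment> \<open>This constant undoes the scaling of the generator \<open>z\<close>.\<close>
    let ?r = "inv\<^bsub>R\<^esub> u [^]\<^bsub>R\<^esub> \<kappa> z"
    have r: "?r \<in> carrier R" using u(1) by simp
    have rI: "\<rho>\<^sub>A ?r \<in> ?I"
      using imageI[OF W.const_closed[OF r], of W.ev] by (simp only: W.ev_const[OF r])
    have "\<rho>\<^sub>A ?r \<otimes>\<^bsub>A\<^esub> d j = z"
    proof -
      have "inv\<^bsub>R\<^esub> u [^]\<^bsub>R\<^esub> \<kappa> z \<otimes>\<^bsub>R\<^esub> u [^]\<^bsub>R\<^esub> \<kappa> z = \<one>\<^bsub>R\<^esub>"
        using u(1) R.nat_pow_distrib[of "inv\<^bsub>R\<^esub> u" u "\<kappa> z"] by (simp add: R.m_comm)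
      then have "\<rho>\<^sub>A ?r \<otimes>\<^bsub>A\<^esub> \<rho>\<^sub>A (u [^]\<^bsub>R\<^esub> \<kappa> z) = \<one>\<^bsub>A\<^esub>"
        using r uc \<rho>.hom_mult[of ?r "u [^]\<^bsub>R\<^esub> \<kappa> z"] \<rho>.hom_one by simp
      then have "\<rho>\<^sub>A ?r \<otimes>\<^bsub>A\<^esub> v [^]\<^bsub>A\<^esub> \<kappa> z = \<one>\<^bsub>A\<^esub>"
        using ring_hom_pow[OF rA(1) R.ring_axioms A.ring_axioms uc] by (simp add: v_def)
      moreover have "\<rho>\<^sub>A ?r \<otimes>\<^bsub>A\<^esub> d j = (\<rho>\<^sub>A ?r \<otimes>\<^bsub>A\<^esub> v [^]\<^bsub>A\<^esub> \<kappa> z) \<otimes>\<^bsub>A\<^esub> z"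
        using j(2)[symmetric] zc v(1) r \<rho>.hom_closed[OF r] by (simp add: A.m_assoc A.Units_closed)
      ultimately show ?thesis using zc by simp
    qed
    then show ?thesis using I'(6)[OF rI dI] by simp
  qed
  have surj: "?I = carrier A"
  proof
    show "?I \<subseteq> carrier A" by (rule I'(1))
    have Yc: "(\<lambda>g. g) \<in> Y \<rightarrow> carrier B" using Y(2) by auto
    \<comment> \<open>The inclusion is proved inside \<open>B\<close>, where the span lives;
      injectivity of \<open>i\<close> then brings it back to \<open>A\<close>.\<close>
    have "NA.spn Y \<subseteq> i ` ?I"
    proof (rule NA.img.span_minimal[OF Yc Y(1)])
      show "\<zero>\<^bsub>B\<^esub> \<in> i ` ?I" using I'(2) by (intro image_eqI[of _ _ "\<zero>\<^bsub>A\<^esub>"]) auto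
      show "x \<oplus>\<^bsub>B\<^esub> y \<in> i ` ?I" if xy: "x \<in> i ` ?I" "y \<in> i ` ?I" for x y
      proof -
        obtain c where c: "c \<in> ?I" "x = i c" using xy(1) by (rule imageE)
        obtain c' where c': "c' \<in> ?I" "y = i c'" using xy(2) by (rule imageE)
        have "i (c \<oplus>\<^bsub>A\<^esub> c') = x \<oplus>\<^bsub>B\<^esub> y"
          using subsetD[OF I'(1) c(1)] subsetD[OF I'(1) c'(1)] c(2) c'(2) by simp
        then show ?thesis using imageI[OF I'(7)[OF c(1) c'(1)], of i] by simp
      qed
      show "c \<otimes>\<^bsub>B\<^esub> y \<in> i ` ?I" if cy: "c \<in> \<phi> ` carrier (tate_algebra m R)" "y \<in> Y" for c y
      proof -
        obtain s where s: "s \<in> carrier (tate_algebra m R)" "c = \<phi> s" using cy(1) by (rule imageE)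
        obtain z where z: "z \<in> Z" "y = i z" using cy(2) unfolding Z(3) by (rule imageE)
        have "X.ev s \<in> ?I" using imageI[OF W_X(1)[OF s(1)], of W.ev] by (simp only: W_X(2)[OF s(1)])
        then have "X.ev s \<otimes>\<^bsub>A\<^esub> z \<in> ?I" by (rule I'(6)) (rule Z_I[OF z(1)])
        then have "i (X.ev s \<otimes>\<^bsub>A\<^esub> z) \<in> i ` ?I" by (rule imageI)
        moreover have "z \<in> carrier A" using z(1) Z(1) by (rule subsetD[rotated])
        ultimately show ?thesis using X_act[OF s(1)] s(2) z(2) by simp
      qed
    qed
    then have sub: "i ` carrier A \<subseteq> i ` ?I" using Y(3) by (rule order_trans[rotated])
    show "carrier A \<subseteq> ?I"
    proof
      fix x assume x: "x \<in> carrier A"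
      show "x \<in> ?I" using subsetD[OF sub imageI[OF x]] inj_on_image_mem_iff[OF assms(10) x I'(1)] by simp
    qed
  qed

  \<comment> \<open>The topology and the plus ring of \<open>A\<close>\<close>
  have W_plus: "W.series_in (plus_ring R) = plus_ring (tate_algebra (m + p) R)"
    by (simp add: W.series_in_def plus_series)
  have "quotient_map (topo (tate_algebra (m + p) R)) (topo A) W.ev"
    using quotient_map_if_surj[OF W.E.lattice_hom_axioms W.S.topological_tate_lattice_axioms
        A'.topological_tate_lattice_axioms surj] .
  moreover have "W.ev ` plus_ring (tate_algebra (m + p) R) \<subseteq> plus_ring A"
    using W.ev_series_in[OF rA(3) R.plus_subring A.plus_subring l a_plus] unfolding W_plus by blast
  moreover have "integral_elem A (W.ev ` plus_ring (tate_algebra (m + p) R)) x" if x: "x \<in> plus_ring A" for x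
  proof -
    have xc: "x \<in> carrier A" using x Ap(1) by blast
    \<comment> \<open>As \<open>G\<close> lies in the ring \<open>?D\<close>, products of
      \<open>?D\<close> with \<open>G\<close> lie in \<open>?D\<close> and so in the span over the
      series in \<open>X\<close> with coefficients in \<open>R\<^sup>+\<close>. This is the
      condition for transitivity of integrality.\<close>
    have D_spn: "?D \<subseteq> F.spn (plus_ring R)"
      using F.f_series_in[of k, OF f_bounded R.plus_subring L(3)] by (simp add: T_plus)
    have "integral_elem B ?D (i x)" by (rule f_int[OF subsetD[OF ii(3) imageI[OF x]]])
    then have "integral_elem B (\<phi> ` X.series_in (plus_ring R)) (i x)"
    proof (rule B.integral_elem_trans[OF F.img_subring[OF R.plus_subring] G(1) Gc G(4) subringE(1)[OF D], rotated])
      show "y \<otimes>\<^bsub>B\<^esub> g \<in> F.spn (plus_ring R)" if "y \<in> ?D" "g \<in> G" for y g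
        by (rule subsetD[OF D_spn subringE(6)[OF D that(1) subsetD[OF G(3) that(2)]]])
    qed
    \<comment> \<open>Since \<open>\<phi>\<close> factors through \<open>i\<close>, the coefficients
      come from \<open>A\<close>, and the equation can be pulled back along the injection.\<close>
    then have "integral_elem B (i ` (X.ev ` X.series_in (plus_ring R))) (i x)"
      by (simp add: \<phi>_def image_comp)
    moreover have "X.ev ` X.series_in (plus_ring R) \<subseteq> carrier A"
      using X.ev_closed by (auto simp: X.series_in_def)
    ultimately have "integral_elem A (X.ev ` X.series_in (plus_ring R)) x"
      using integral_elem_inj[OF A.cring_axioms B.cring_axioms ii(1) assms(10) _ xc] by simp
    moreover have "X.ev ` X.series_in (plus_ring R) \<subseteq> W.ev ` plus_ring (tate_algebra (m + p) R)"
    proof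
      fix y assume "y \<in> X.ev ` X.series_in (plus_ring R)"
      then obtain h where h: "y = X.ev h" "h \<in> X.series_in (plus_ring R)" by (rule imageE)
      then have hX: "h \<in> carrier (tate_algebra m R)" "range h \<subseteq> plus_ring R"
        by (simp_all add: X.series_in_def)
      have "h \<in> plus_ring (tate_algebra (m + p) R)" using W_X(1)[OF hX(1)] hX(2) by (simp add: plus_series)
      from imageI[OF this, of W.ev] show "y \<in> W.ev ` plus_ring (tate_algebra (m + p) R)"
        by (simp only: h(1) W_X(2)[OF hX(1)])
    qed
    ultimately show ?thesis by (rule integral_elem_mono)
  qed
  ultimately show ?thesis
    using assms(4) W.ev_hom W.ev_const surj unfolding topologically_finite_type_def
    by (intro conjI exI[of _ "m + p"] exI[of _ W.ev]) simp_all
qed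

end
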